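(* Let $k\ge -\tfrac12$, let $M=\begin{pmatrix} a & b\\ c& d\end{pmatrix}$ be a real matrix with $\det M=1$ and $b\neq 0$, let $m\in\mathbb{R}$, $\sigma\in S^m$ and $f\in\mathcal{S}(\mathbb{R})$. Then: (i) for every non-negative integer $l$ there exists a constant $C_{m,l}>0$, depending on $m$ and $l$, such that for all $y,\lambda\in\mathbb{R}$ $$\left|\mathcal{D}_k^M\!\left(e^{-\frac{i}{2}\frac{a}{b}(\cdot)^2}\sigma(\cdot,y)\right)(\lambda)\right|\le\frac{C_{m,l}}{|b|^{2k+2}}\,(1+y^2)^{m/2}\,\bigl(1+(\lambda/b)^2\bigr)^{-l};$$ (ii) for all $\lambda\in\mathbb{R}$, $$\mathcal{D}_k^M(P_{\sigma,M}f)(\lambda)=\int_{\mathbb{R}}\int_{\mathbb{R}}\mathcal{D}_k^M\!\left(e^{-\frac{i}{2}\frac{a}{b}(\cdot)^2}\sigma(\cdot,y)\right)(z)\;\mathcal{D}_k^M(f)(y)\;e^{-\frac{i}{2}\frac{d}{b}(z^2-\lambda^2+y^2)}\,W_k(\lambda,-y,z)\,d\mu_k(z)\,d\mu_k(y).$$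
   Context: Notation (the symbol is written $\sigma$ to avoid a clash with the matrix entry $a$; $k$, $M$, $\sigma$ are fixed before the constants are chosen). $d\mu_k(x)=\frac{|x|^{2k+1}}{2^{k+1}\Gamma(k+1)}dx$ on $\mathbb{R}$. Powers $(ib)^{k+1}$ use the principal branch. Dunkl kernel: for real $\lambda,x$, $E_k(i\lambda,x)=j_k(\lambda x)+\frac{i\lambda x}{2(k+1)}j_{k+1}(\lambda x)$, where $j_\nu(z)=\Gamma(\nu+1)\sum_{n\ge0}\frac{(-1)^n(z/2)^{2n}}{n!\,\Gamma(n+\nu+1)}$. Linear canonical Dunkl kernel: $E_k^M(\lambda,x)=e^{\frac{i}{2}\left(\frac{d}{b}\lambda^2+\frac{a}{b}x^2\right)}E_k(-i\lambda/b,x)$. Since $M^{-1}=\begin{pmatrix} d&-b\\-c&a\end{pmatrix}$, one has $E_k^{M^{-1}}(x,\lambda)=e^{-\frac{i}{2}\left(\frac{a}{b}x^2+\frac{d}{b}\lambda^2\right)}E_k(ix/b,\lambda)$. Linear canonical Dunkl transform: $\mathcal{D}_k^M(f)(\lambda)=\frac{1}{(ib)^{k+1}}\int_{\mathbb{R}}f(x)E_k^M(\lambda,x)\,d\mu_k(x)$. Symbol class $S^m$ ($m\in\mathbb{R}$): all $\sigma\in C^\infty(\mathbb{R}\times\mathbb{R};\mathbb{C})$ such that for all integers $l,n,r\ge0$ there is a constant $C$ with $|(1+x^2)^r\partial_x^l\partial_\lambda^n\sigma(x,\lambda)|\le C(1+|\lambda|^2)^{(m-n)/2}$ for all $x,\lambda\in\mathbb{R}$.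 Pseudo-differential operator: $P_{\sigma,M}(f)(x)=\int_{\mathbb{R}}\sigma(x,\lambda)\,\mathcal{D}_k^M(f)(\lambda)\,E_k^{M^{-1}}(x,\lambda)\,d\mu_k(\lambda)$ for $f\in\mathcal{S}(\mathbb{R})$. $W_k$ is the kernel of the Dunkl product formula $E_k(i\lambda,x)E_k(i\lambda,y)=\int_{\mathbb{R}}E_k(i\lambda,z)W_k(x,y,z)\,d\mu_k(z)$. Explicitly, for $k>-\frac12$ and $x,y\ne0$: $W_k(x,y,z)=\bigl(1-\sigma_{x,y,z}+\sigma_{z,x,y}+\sigma_{z,y,x}\bigr)\Delta_k(|x|,|y|,|z|)$, with $\sigma_{u,v,w}=\frac{u^2+v^2-w^2}{2uv}$ if $u,v\neq0$ and $0$ otherwise (these three-index quantities are unrelated to the symbol $\sigma$), and $\Delta_k(|x|,|y|,|z|)=\frac{2^{1-k}\Gamma(k+1)^2}{\sqrt\pi\,\Gamma(k+1/2)}\,\frac{\bigl([(|x|+|y|)^2-z^2][z^2-(|x|-|y|)^2]\bigr)^{k-1/2}}{|xyz|^{2k}}$ if $\bigl||x|-|y|\bigr|<|z|<|x|+|y|$, and $0$ otherwise. In the degenerate cases, $W_k(x,y,z)\,d\mu_k(z)$ is understood as the Dirac measure at $x+y$ (when $x=0$ or $y=0$, or when $k=-\frac12$). *)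

theory Defs
  imports "HOL-Analysis.Analysis"
begin

section \<open>The measure, the Dunkl kernel and the linear canonical Dunkl transform\<close>

definition dunkl_measure :: "real \<Rightarrow> real measure" where
  "dunkl_measure k =
     density lborel (\<lambda>x. ennreal (\<bar>x\<bar> powr (2 * k + 1) / (2 powr (k + 1) * Gamma (k + 1))))"

definition norm_bessel :: "real \<Rightarrow> real \<Rightarrow> real" where
  "norm_bessel \<nu> z =
     Gamma (\<nu> + 1) * (\<Sum>n. (-1) ^ n * (z / 2) ^ (2 * n) / (fact n * Gamma (real n + \<nu> + 1)))"

text \<open>Only imaginary spectral parameters occur: for real \<open>\<xi>\<close>, the term
  \<open>dunkl_kernel k \<xi> x\<close> is \<open>E\<^sub>k(i\<xi>, x)\<close>.\<close>

definition dunkl_kernel :: "real \<Rightarrow> real \<Rightarrow> real \<Rightarrow> complex" where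
  "dunkl_kernel k \<xi> x =
     of_real (norm_bessel k (\<xi> * x))
     + \<i> * of_real (\<xi> * x) / of_real (2 * (k + 1)) * of_real (norm_bessel (k + 1) (\<xi> * x))"

text \<open>For \<open>M = (a b; c d)\<close> the entries are \<open>a = M $ 1 $ 1\<close>, \<open>b = M $ 1 $ 2\<close>,
  \<open>c = M $ 2 $ 1\<close>, \<open>d = M $ 2 $ 2\<close>.\<close>

definition lc_dunkl_kernel :: "real \<Rightarrow> real^2^2 \<Rightarrow> real \<Rightarrow> real \<Rightarrow> complex" where
  "lc_dunkl_kernel k M \<xi> x =
     (let a = M $ 1 $ 1; b = M $ 1 $ 2; d = M $ 2 $ 2
      in exp (\<i> / 2 * of_real (d / b * \<xi>\<^sup>2 + a / b * x\<^sup>2)) * dunkl_kernel k (- \<xi> / b) x)"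

definition lc_dunkl_transform ::
    "real \<Rightarrow> real^2^2 \<Rightarrow> (real \<Rightarrow> complex) \<Rightarrow> real \<Rightarrow> complex" where
  "lc_dunkl_transform k M f \<xi> =
     1 / (\<i> * of_real (M $ 1 $ 2)) powr of_real (k + 1)
     * (\<integral>x. f x * lc_dunkl_kernel k M \<xi> x \<partial>dunkl_measure k)"


section \<open>Schwartz functions and symbols\<close>

definition schwartz :: "(real \<Rightarrow> complex) set" where
  "schwartz = {f.
     let D = (\<lambda>n. ((\<lambda>g x. vector_derivative g (at x)) ^^ n) f) in
     (\<forall>n x. D n differentiable at x) \<and>
     (\<forall>n r. \<exists>C. \<forall>x. \<bar>x\<bar> ^ r * cmod (D n x) \<le> C)}"

definition partial1 :: "(real \<Rightarrow> real \<Rightarrow> complex) \<Rightarrow> real \<Rightarrow> real \<Rightarrow> complex" where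
  "partial1 g x \<xi> = vector_derivative (\<lambda>t. g t \<xi>) (at x)"

definition partial2 :: "(real \<Rightarrow> real \<Rightarrow> complex) \<Rightarrow> real \<Rightarrow> real \<Rightarrow> complex" where
  "partial2 g x \<xi> = vector_derivative (\<lambda>t. g x t) (at \<xi>)"

text \<open>Joint regularity on the plane: \<open>g\<close> is of class \<open>C\<close> to the \<open>n+1\<close> iff it is (Frechet)
  differentiable and both of its partial derivatives are of class \<open>C\<close> to the \<open>n\<close>.\<close>

primrec Ck_plane :: "nat \<Rightarrow> (real \<Rightarrow> real \<Rightarrow> complex) \<Rightarrow> bool" where
  "Ck_plane 0 g \<longleftrightarrow> continuous_on UNIV (\<lambda>(x, \<xi>). g x \<xi>)"
| "Ck_plane (Suc n) g \<longleftrightarrow>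
     (\<forall>p. (\<lambda>(x, \<xi>). g x \<xi>) differentiable at p) \<and>
     Ck_plane n (partial1 g) \<and> Ck_plane n (partial2 g)"

definition symbol_class :: "real \<Rightarrow> (real \<Rightarrow> real \<Rightarrow> complex) set" where
  "symbol_class m = {\<sigma>. (\<forall>n. Ck_plane n \<sigma>) \<and>
     (\<forall>l n r :: nat. \<exists>C. \<forall>x \<xi>.
        cmod (of_real ((1 + x\<^sup>2) ^ r) * (partial1 ^^ l) ((partial2 ^^ n) \<sigma>) x \<xi>)
          \<le> C * (1 + \<bar>\<xi>\<bar>\<^sup>2) powr ((m - real n) / 2))}"


section \<open>The pseudo-differential operator\<close>

definition pseudo_diff_op ::
    "real \<Rightarrow> real^2^2 \<Rightarrow> (real \<Rightarrow> real \<Rightarrow> complex) \<Rightarrow> (real \<Rightarrow> complex) \<Rightarrow> real \<Rightarrow> complex" where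
  "pseudo_diff_op k M \<sigma> f x =
     (\<integral>\<xi>. \<sigma> x \<xi> * lc_dunkl_transform k M f \<xi> * lc_dunkl_kernel k (matrix_inv M) x \<xi>
        \<partial>dunkl_measure k)"

lemma matrix_inv_2_2_det_1:
  fixes M :: "real^2^2"
  assumes "det M = 1"
  shows "matrix_inv M = vector [vector [M $ 2 $ 2, - M $ 1 $ 2], vector [- M $ 2 $ 1, M $ 1 $ 1]]"
    (is "_ = ?N")
proof -
  have d: "M $ 1 $ 1 * M $ 2 $ 2 - M $ 1 $ 2 * M $ 2 $ 1 = 1"
    using assms by (simp add: det_2)
  have 1: "M ** ?N = mat 1" and 2: "?N ** M = mat 1"
    using d by (auto simp: vec_eq_iff forall_2 matrix_matrix_mult_def sum_2 mat_def algebra_simps)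
  have "M ** matrix_inv M = mat 1 \<and> matrix_inv M ** M = mat 1"
    unfolding matrix_inv_def by (rule someI[of _ ?N]) (use 1 2 in simp)
  then have "matrix_inv M = (?N ** M) ** matrix_inv M"
    by (simp add: 2)
  also have "\<dots> = ?N"
    using \<open>M ** matrix_inv M = mat 1 \<and> _\<close> by (simp flip: matrix_mul_assoc)
  finally show ?thesis .
qed

lemma lc_dunkl_kernel_matrix_inv:
  fixes M :: "real^2^2"
  assumes "det M = 1"
  shows "lc_dunkl_kernel k (matrix_inv M) x \<xi> =
     exp (- (\<i> / 2) * of_real (M $ 1 $ 1 / M $ 1 $ 2 * x\<^sup>2 + M $ 2 $ 2 / M $ 1 $ 2 * \<xi>\<^sup>2))
     * dunkl_kernel k (x / M $ 1 $ 2) \<xi>"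
  using assms
  by (simp add: lc_dunkl_kernel_def matrix_inv_2_2_det_1 Let_def algebra_simps minus_diff_commute)


section \<open>The kernel of the Dunkl product formula\<close>

definition dunkl_sigma :: "real \<Rightarrow> real \<Rightarrow> real \<Rightarrow> real" where
  "dunkl_sigma u v w = (if u \<noteq> 0 \<and> v \<noteq> 0 then (u\<^sup>2 + v\<^sup>2 - w\<^sup>2) / (2 * u * v) else 0)"

definition dunkl_Delta :: "real \<Rightarrow> real \<Rightarrow> real \<Rightarrow> real \<Rightarrow> real" where
  "dunkl_Delta k u v w =
     (if \<bar>u - v\<bar> < w \<and> w < u + v
      then 2 powr (1 - k) * (Gamma (k + 1))\<^sup>2 / (sqrt pi * Gamma (k + 1 / 2))
           * (((u + v)\<^sup>2 - w\<^sup>2) * (w\<^sup>2 - (u - v)\<^sup>2)) powr (k - 1 / 2) / (\<bar>u * v * w\<bar> powr (2 * k))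
      else 0)"

definition dunkl_W :: "real \<Rightarrow> real \<Rightarrow> real \<Rightarrow> real \<Rightarrow> real" where
  "dunkl_W k x y z =
     (1 - dunkl_sigma x y z + dunkl_sigma z x y + dunkl_sigma z y x)
     * dunkl_Delta k \<bar>x\<bar> \<bar>y\<bar> \<bar>z\<bar>"

text \<open>\<open>integral_dunkl_W k x y g\<close> is the integral of \<open>g\<close> against \<open>W\<^sub>k(x, y, z) d\<mu>\<^sub>k(z)\<close>, which
  is the Dirac measure at \<open>x + y\<close> in the degenerate cases.\<close>

definition integral_dunkl_W :: "real \<Rightarrow> real \<Rightarrow> real \<Rightarrow> (real \<Rightarrow> complex) \<Rightarrow> complex" where
  "integral_dunkl_W k x y g =
     (if k = - 1 / 2 \<or> x = 0 \<or> y = 0 then g (x + y)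
      else (\<integral>z. g z * of_real (dunkl_W k x y z) \<partial>dunkl_measure k))"

end

theory Submission
  imports Defs
begin

text \<open>On functions of one real variable let
  \<open>T \<phi> (x) = \<phi>' (x) + (2 * k + 1) / (2 * x) * (\<phi> x - \<phi> (- x))\<close> be the Dunkl operator. If \<open>T \<phi>\<close> is an imaginary
  multiple of \<open>\<phi>\<close>, then \<open>\<bar>\<phi> x\<bar>\<^sup>2 + \<bar>\<phi> (- x)\<bar>\<^sup>2\<close> decreases in \<open>x > 0\<close>. This bounds the Dunkl kernel and
  shows that an eigenfunction is determined by its value at 0. Uniqueness yields the product formula:
  \<open>E (x) E (y)\<close> and the integral of \<open>E\<close> over the triangle sides \<open>z = sqrt (x\<^sup>2 + y\<^sup>2 + 2 * x * y * t)\<close>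
  with respect to \<open>(1 + t) (1 - t\<^sup>2) powr (k - 1 / 2)\<close> satisfy the same equation in \<open>x\<close>, and
  substituting \<open>z\<close> for \<open>t\<close> turns the weight into \<open>W\<close>. The first claim follows by integrating by parts
  against \<open>T\<close>, which preserves rapid decrease uniformly in the parameter \<open>y\<close>; the
  second by two applications of Fubini's theorem, with the product formula in between.\<close>

subsection \<open>The Dunkl kernel as an eigenfunction of the Dunkl operator\<close>

text \<open>The canonical transform adds only unimodular quadratic exponentials (chirps) and a
  rescaling by b. The chirp put in front of \<sigma> is the inverse of the one in the kernel, so
  both claims concern the plain Dunkl transform at -\<lambda>/b. Two obstacles shape the work. The
  quotient \<open>(\<phi> x - \<phi> (- x)) / x\<close> is singular at 0, while its smoothness and
  decay are wanted uniformly in a parameter; it is therefore written as the integral of \<phi>'(t x)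
  over t in [-1, 1]. Moreover W changes sign and, for k < 1/2, is unbounded at the edges of the
  triangle, so absolute integrability has to precede every exchange of integrals; in the variable t
  the singularities collect in the weight \<open>(1 - t\<^sup>2) powr (k - 1 / 2)\<close>, whose
  integral is a Beta value. At k = -1/2 this weight is no longer integrable, but there the
  reflection term of T vanishes, E is the ordinary exponential, and its addition theorem replaces
  the product formula.\<close>

definition bessel_series :: "real \<Rightarrow> real \<Rightarrow> real" where
  "bessel_series \<nu> s = (\<Sum>n. (-1) ^ n / (4 ^ n * fact n * pochhammer (\<nu> + 1) n) * s ^ n)"

lemma pochhammer_ge_half_power:
  fixes a :: real
  assumes "a \<ge> 1 / 2"
  shows "pochhammer a n \<ge> (1 / 2) ^ n"
proof (induction n)
  case (Suc n)
  have "(1 / 2) ^ n * (1 / 2) \<le> pochhammer a n * (a + real n)"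
    using Suc assms order_trans[OF _ Suc, of 0] by (intro mult_mono) auto
  then show ?case by (simp add: pochhammer_rec' mult.commute pochhammer_Suc)
qed simp

text \<open>Since \<nu> + 1 \<ge> 1/2, the n-th Pochhammer symbol is at least (1/2)^n, which 4^n
  more than compensates; the exponential series in |s| is a majorant.\<close>

lemma summable_bessel_series:
  fixes s :: real
  assumes "\<nu> \<ge> - 1 / 2"
  shows "summable (\<lambda>n. (-1) ^ n / (4 ^ n * fact n * pochhammer (\<nu> + 1) n) * s ^ n)"
proof (rule summable_comparison_test[OF exI[of _ 0]])
  show "\<forall>n\<ge>0. norm ((-1) ^ n / (4 ^ n * fact n * pochhammer (\<nu> + 1) n) * s ^ n)
      \<le> \<bar>s\<bar> ^ n /\<^sub>R fact n"
  proof (intro allI impI)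
    fix n :: nat
    have p: "pochhammer (\<nu> + 1) n \<ge> (1 / 2) ^ n"
      using assms by (intro pochhammer_ge_half_power) auto
    then have pos: "pochhammer (\<nu> + 1) n > 0"
      by (rule less_le_trans[rotated]) simp
    have "1 \<le> (4::real) ^ n * (1 / 2) ^ n"
      by (simp flip: power_mult_distrib)
    also have "\<dots> \<le> 4 ^ n * pochhammer (\<nu> + 1) n"
      using p by (intro mult_left_mono) auto
    finally have "1 / (4 ^ n * pochhammer (\<nu> + 1) n) \<le> 1"
      by simp
    then have "1 / (4 ^ n * pochhammer (\<nu> + 1) n) * (\<bar>s\<bar> ^ n / fact n) \<le> 1 * (\<bar>s\<bar> ^ n / fact n)"
      by (rule mult_right_mono) simp
    then show "norm ((-1) ^ n / (4 ^ n * fact n * pochhammer (\<nu> + 1) n) * s ^ n)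
      \<le> \<bar>s\<bar> ^ n /\<^sub>R fact n"
      using pos by (simp add: norm_mult power_abs abs_mult divide_simps mult_ac)
  qed
  show "summable (\<lambda>n. \<bar>s\<bar> ^ n /\<^sub>R fact n)"
    by (rule summable_exp_generic)
qed

lemma norm_bessel_eq_series:
  assumes "\<nu> \<ge> - 1 / 2"
  shows "norm_bessel \<nu> z = bessel_series \<nu> (z\<^sup>2)"
proof -
  have G: "Gamma (\<nu> + 1) \<noteq> 0"
    using assms by (intro less_imp_neq[THEN not_sym] Gamma_real_pos) auto
  have "\<nu> + 1 \<notin> \<int>\<^sub>\<le>\<^sub>0"
    using assms by (auto dest: nonpos_Ints_nonpos)
  then have "Gamma (real n + \<nu> + 1) = Gamma (\<nu> + 1) * pochhammer (\<nu> + 1) n" for n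
    using G by (subst pochhammer_Gamma) (auto simp: add_ac)
  moreover have "(z / 2) ^ (2 * n) = (z\<^sup>2) ^ n / 4 ^ n" for n
    by (simp only: power_mult) (simp add: power_divide)
  ultimately have eq: "(-1) ^ n * (z / 2) ^ (2 * n) / (fact n * Gamma (real n + \<nu> + 1)) =
      (-1) ^ n / (4 ^ n * fact n * pochhammer (\<nu> + 1) n) * (z\<^sup>2) ^ n / Gamma (\<nu> + 1)" for n
    by (simp add: mult_ac)
  show ?thesis
    unfolding norm_bessel_def bessel_series_def eq
    using G by (subst suminf_divide[OF summable_bessel_series[OF assms]]) simp
qed

lemma has_field_derivative_bessel_series:
  assumes "\<nu> \<ge> - 1 / 2"
  shows "(bessel_series \<nu> has_field_derivative - bessel_series (\<nu> + 1) s / (4 * (\<nu> + 1))) (at s)"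
proof -
  let ?c = "\<lambda>n. (-1) ^ n / (4 ^ n * fact n * pochhammer (\<nu> + 1) n)"
  have "diffs ?c n * s ^ n = - 1 / (4 * (\<nu> + 1)) *
      ((-1) ^ n / (4 ^ n * fact n * pochhammer (\<nu> + 1 + 1) n) * s ^ n)" for n
    using assms by (simp add: diffs_def pochhammer_rec divide_simps)
  then have "(\<Sum>n. diffs ?c n * s ^ n) = - 1 / (4 * (\<nu> + 1)) * bessel_series (\<nu> + 1) s"
    unfolding bessel_series_def
    using suminf_mult[OF summable_bessel_series[of "\<nu> + 1" s], of "- 1 / (4 * (\<nu> + 1))"] assms
    by simp
  moreover have "((\<lambda>s. \<Sum>n. ?c n * s ^ n) has_field_derivative (\<Sum>n. diffs ?c n * s ^ n)) (at s)"
    by (intro termdiffs_strong_converges_everywhere summable_bessel_series assms)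
  moreover have "bessel_series \<nu> = (\<lambda>s. \<Sum>n. ?c n * s ^ n)"
    by (simp only: fun_eq_iff bessel_series_def simp_thms)
  ultimately show ?thesis by simp
qed

text \<open>Normalised three-term recurrence of the Bessel functions. It holds coefficient by
  coefficient: the constant terms of the difference cancel, both being 1, and its coefficient n + 1
  matches coefficient n at index \<nu> + 2.\<close>

lemma bessel_series_recurrence:
  assumes "\<nu> \<ge> - 1 / 2"
  shows "s * bessel_series (\<nu> + 2) s = 4 * (\<nu> + 1) * (\<nu> + 2) * (bessel_series (\<nu> + 1) s - bessel_series \<nu> s)"
proof -
  let ?c = "\<lambda>\<nu> n. (-1) ^ n / (4 ^ n * fact n * pochhammer (\<nu> + 1) n) * s ^ n"
  have sm: "summable (?c (\<nu> + 1))" "summable (?c \<nu>)" "summable (?c (\<nu> + 2))"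
    using assms by (intro summable_bessel_series; simp)+
  have eq: "4 * (\<nu> + 1) * (\<nu> + 2) * (?c (\<nu> + 1) (Suc n) - ?c \<nu> (Suc n)) = s * ?c (\<nu> + 2) n" for n
  proof -
    define Q where "Q = pochhammer (\<nu> + 3) n"
    have Q: "Q > 0"
      unfolding Q_def using assms by (intro pochhammer_pos) auto
    have p1: "pochhammer (\<nu> + 2) (Suc n) = (\<nu> + 2) * Q"
      by (simp add: Q_def pochhammer_rec add.assoc)
    \<comment> \<open>Splitting off the last or the first factor of one Pochhammer symbol expresses
      all three of them through \<open>Q\<close>.\<close>
    have "pochhammer (\<nu> + 1) (Suc (Suc n)) = pochhammer (\<nu> + 1) (Suc n) * (\<nu> + 2 + real n)"
      by (simp only: pochhammer_Suc[of _ "Suc n"]) (simp add: algebra_simps)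
    moreover have "pochhammer (\<nu> + 1) (Suc (Suc n)) = (\<nu> + 1) * ((\<nu> + 2) * Q)"
      using p1 by (subst pochhammer_rec) (simp add: add.assoc)
    ultimately have p0: "pochhammer (\<nu> + 1) (Suc n) = (\<nu> + 1) * (\<nu> + 2) * Q / (\<nu> + 2 + real n)"
      using assms by (simp add: field_simps)
    have nz: "\<nu> + 1 \<noteq> 0" "\<nu> + 2 \<noteq> 0" "\<nu> + 2 + real n \<noteq> 0" "Q \<noteq> 0"
      using assms Q by auto
    have "\<nu> + 1 + 1 = \<nu> + 2" "\<nu> + 2 + 1 = \<nu> + 3" by auto
    then show ?thesis
      using nz by (simp only: p0 p1 Q_def[symmetric]) (simp add: divide_simps, simp add: algebra_simps)
  qed
  have "(\<Sum>n. 4 * (\<nu> + 1) * (\<nu> + 2) * (?c (\<nu> + 1) n - ?c \<nu> n)) =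
      (\<Sum>n. 4 * (\<nu> + 1) * (\<nu> + 2) * (?c (\<nu> + 1) (Suc n) - ?c \<nu> (Suc n)))"
    unfolding suminf_split_head[OF summable_mult[OF summable_diff[OF sm(1,2)]]] by simp
  also have "\<dots> = s * bessel_series (\<nu> + 2) s"
    unfolding eq bessel_series_def by (intro suminf_mult sm)
  finally show ?thesis
    unfolding suminf_mult[OF summable_diff[OF sm(1,2)]] suminf_diff[OF sm(1,2), symmetric]
    by (simp only: bessel_series_def)
qed

text \<open>E is the even part at t^2 plus i t times the odd part at t^2. Both are kept as functions
  of s = t^2, so that \<open>s = x\<^sup>2 + y\<^sup>2 + 2 * x * y * t\<close> can be inserted later
  without a square root.\<close>

definition dunkl_even :: "real \<Rightarrow> real \<Rightarrow> real" where
  "dunkl_even k = bessel_series k"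

definition dunkl_odd :: "real \<Rightarrow> real \<Rightarrow> real" where
  "dunkl_odd k s = bessel_series (k + 1) s / (2 * (k + 1))"

definition dunkl_odd' :: "real \<Rightarrow> real \<Rightarrow> real" where
  "dunkl_odd' k s = - bessel_series (k + 2) s / (8 * (k + 1) * (k + 2))"

lemma has_field_derivative_dunkl_even:
  assumes "k \<ge> - 1 / 2"
  shows "(dunkl_even k has_field_derivative - dunkl_odd k s / 2) (at s)"
  using has_field_derivative_bessel_series[OF assms, of s]
  unfolding dunkl_even_def dunkl_odd_def by (simp add: mult_ac)

lemma has_field_derivative_dunkl_odd:
  assumes "k \<ge> - 1 / 2"
  shows "(dunkl_odd k has_field_derivative dunkl_odd' k s) (at s)"
proof -
  have "((\<lambda>s. bessel_series (k + 1) s / (2 * (k + 1))) has_field_derivative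
      - bessel_series (k + 1 + 1) s / (4 * (k + 1 + 1)) / (2 * (k + 1))) (at s)"
    using assms by (intro DERIV_cdivide has_field_derivative_bessel_series) auto
  moreover have "- bessel_series (k + 1 + 1) s / (4 * (k + 1 + 1)) / (2 * (k + 1)) = dunkl_odd' k s"
    unfolding dunkl_odd'_def using assms by (simp add: field_simps)
  ultimately show ?thesis
    unfolding dunkl_odd_def[abs_def] by metis
qed

text \<open>The Bessel recurrence read as a differential equation. Together with
  \<open>has_field_derivative_dunkl_even\<close> it closes a first-order system for the two parts,
  so second derivatives never appear.\<close>

lemma dunkl_odd_ode:
  assumes "k \<ge> - 1 / 2"
  shows "2 * s * dunkl_odd' k s = dunkl_even k s - (2 * k + 2) * dunkl_odd k s"
proof -
  have nz: "k + 1 \<noteq> 0" "k + 2 \<noteq> 0" using assms by auto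
  have "2 * s * dunkl_odd' k s = - (s * bessel_series (k + 2) s) / (4 * (k + 1) * (k + 2))"
    unfolding dunkl_odd'_def using nz by (simp add: divide_simps)
  also have "\<dots> = bessel_series k s - bessel_series (k + 1) s"
    unfolding bessel_series_recurrence[OF assms] using nz by (simp add: divide_simps)
  also have "\<dots> = dunkl_even k s - (2 * k + 2) * dunkl_odd k s"
    unfolding dunkl_odd_def dunkl_even_def using nz by (simp add: divide_simps)
  finally show ?thesis .
qed

lemma continuous_on_bessel_series:
  assumes "\<nu> \<ge> - 1 / 2"
  shows "continuous_on S (bessel_series \<nu>)"
  using has_field_derivative_bessel_series[OF assms]
  by (meson DERIV_isCont continuous_at_imp_continuous_on)

lemma continuous_on_dunkl_parts:
  assumes "k \<ge> - 1 / 2"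
  shows "continuous_on S (dunkl_even k)" "continuous_on S (dunkl_odd k)" "continuous_on S (dunkl_odd' k)"
  unfolding dunkl_even_def dunkl_odd_def[abs_def] dunkl_odd'_def[abs_def] using assms
  by (auto intro!: continuous_intros continuous_on_bessel_series)

lemma dunkl_even_0: "dunkl_even k 0 = 1"
proof -
  have "dunkl_even k 0 = (\<Sum>n. (-1) ^ n / (4 ^ n * fact n * pochhammer (k + 1) n) * 0 ^ n)"
    by (simp only: dunkl_even_def bessel_series_def)
  then show ?thesis by (simp only: powser_zero) simp
qed

section \<open>The Dunkl kernel as a function of the product of its arguments\<close>

definition dunkl_exp :: "real \<Rightarrow> real \<Rightarrow> complex" where
  "dunkl_exp k t = Complex (dunkl_even k (t\<^sup>2)) (t * dunkl_odd k (t\<^sup>2))"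

lemma dunkl_kernel_eq_exp:
  assumes "k \<ge> - 1 / 2"
  shows "dunkl_kernel k \<xi> x = dunkl_exp k (\<xi> * x)"
  unfolding dunkl_kernel_def dunkl_exp_def dunkl_even_def dunkl_odd_def using assms
  by (simp add: norm_bessel_eq_series complex_eq_iff)

lemma dunkl_exp_0: "dunkl_exp k 0 = 1"
  by (simp add: dunkl_exp_def dunkl_even_0 complex_eq_iff)

lemma dunkl_exp_minus: "dunkl_exp k (- t) = cnj (dunkl_exp k t)"
  by (simp add: dunkl_exp_def complex_eq_iff)

text \<open>The derivative with \<open>dunkl_odd'\<close> already eliminated by
  \<open>dunkl_odd_ode\<close>, which makes the eigenvalue equation a purely algebraic
  identity.\<close>

definition dunkl_exp' :: "real \<Rightarrow> real \<Rightarrow> complex" where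
  "dunkl_exp' k t = Complex (- t * dunkl_odd k (t\<^sup>2)) (dunkl_even k (t\<^sup>2) - (2 * k + 1) * dunkl_odd k (t\<^sup>2))"

lemma has_vector_derivative_Complex:
  assumes "(f has_field_derivative f') (at x within S)" "(g has_field_derivative g') (at x within S)"
  shows "((\<lambda>x. Complex (f x) (g x)) has_vector_derivative Complex f' g') (at x within S)"
  using assms unfolding has_vector_derivative_complex_iff by simp

lemma has_vector_derivative_dunkl_exp:
  assumes "k \<ge> - 1 / 2"
  shows "(dunkl_exp k has_vector_derivative dunkl_exp' k t) (at t)"
  unfolding dunkl_exp_def[abs_def] dunkl_exp'_def
proof (rule has_vector_derivative_Complex)
  show "((\<lambda>t. dunkl_even k (t\<^sup>2)) has_real_derivative - t * dunkl_odd k (t\<^sup>2)) (at t)"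
    using DERIV_chain2[OF has_field_derivative_dunkl_even[OF assms] DERIV_power[OF DERIV_ident, of 2 t]]
    by (simp add: mult_ac)
  have "((\<lambda>t. t * dunkl_odd k (t\<^sup>2)) has_real_derivative
      dunkl_odd k (t\<^sup>2) + t * (dunkl_odd' k (t\<^sup>2) * (2 * t))) (at t)"
    using DERIV_mult[OF DERIV_ident
        DERIV_chain2[OF has_field_derivative_dunkl_odd[OF assms] DERIV_power[OF DERIV_ident, of 2 t]]]
    by (simp add: algebra_simps)
  moreover have "dunkl_odd k (t\<^sup>2) + t * (dunkl_odd' k (t\<^sup>2) * (2 * t)) =
      dunkl_even k (t\<^sup>2) - (2 * k + 1) * dunkl_odd k (t\<^sup>2)"
    using dunkl_odd_ode[OF assms, of "t\<^sup>2"] by (simp add: algebra_simps power2_eq_square)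
  ultimately show "((\<lambda>t. t * dunkl_odd k (t\<^sup>2)) has_real_derivative
      dunkl_even k (t\<^sup>2) - (2 * k + 1) * dunkl_odd k (t\<^sup>2)) (at t)"
    by simp
qed

lemma dunkl_exp_eigen:
  assumes "x \<noteq> 0"
  shows "dunkl_exp' k x + of_real ((2 * k + 1) / (2 * x)) * (dunkl_exp k x - dunkl_exp k (- x))
    = \<i> * dunkl_exp k x"
  using assms by (simp add: complex_eq_iff dunkl_exp_def dunkl_exp'_def field_simps)

section \<open>Energy bound and uniqueness of eigenfunctions\<close>

text \<open>The reflection term couples the values at x and - x, so the two are estimated together.
  In the derivative of the sum the imaginary eigenvalue contributes nothing, and the reflection term
  leaves - 2 q times the squared distance of \<phi>(x) and \<phi>(- x), where q = (2 k + 1) / (2 x).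
  The sign of q is where k \<ge> -1/2 enters.\<close>

lemma dunkl_eigenfunction_bound:
  fixes \<phi> :: "real \<Rightarrow> complex"
  assumes k: "k \<ge> - 1 / 2"
    and der: "\<And>x. (\<phi> has_vector_derivative \<phi>' x) (at x)"
    and eig: "\<And>x. x \<noteq> 0 \<Longrightarrow>
      \<phi>' x + of_real ((2 * k + 1) / (2 * x)) * (\<phi> x - \<phi> (- x)) = \<i> * of_real c * \<phi> x"
  shows "(cmod (\<phi> x))\<^sup>2 + (cmod (\<phi> (- x)))\<^sup>2 \<le> 2 * (cmod (\<phi> 0))\<^sup>2"
proof -
  define en where "en x = (Re (\<phi> x))\<^sup>2 + (Im (\<phi> x))\<^sup>2 + ((Re (\<phi> (- x)))\<^sup>2 + (Im (\<phi> (- x)))\<^sup>2)" for x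
  have dR: "((\<lambda>x. Re (\<phi> x)) has_real_derivative Re (\<phi>' x)) (at x)"
    and dI: "((\<lambda>x. Im (\<phi> x)) has_real_derivative Im (\<phi>' x)) (at x)" for x
    using der[of x] unfolding has_vector_derivative_complex_iff by auto
  have dR': "((\<lambda>x. Re (\<phi> (- x))) has_real_derivative - Re (\<phi>' (- x))) (at x)"
    and dI': "((\<lambda>x. Im (\<phi> (- x))) has_real_derivative - Im (\<phi>' (- x))) (at x)" for x
    using DERIV_chain2[OF dR DERIV_minus[OF DERIV_ident]] DERIV_chain2[OF dI DERIV_minus[OF DERIV_ident]]
    by auto
  have den: "(en has_real_derivative
      2 * (Re (\<phi> x) * Re (\<phi>' x) + Im (\<phi> x) * Im (\<phi>' x)
         - Re (\<phi> (- x)) * Re (\<phi>' (- x)) - Im (\<phi> (- x)) * Im (\<phi>' (- x)))) (at x)" for x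
    unfolding en_def[abs_def]
    by (rule derivative_eq_intros dR dI dR' dI' refl)+ (simp add: algebra_simps)
  have nonpos: "2 * (Re (\<phi> x) * Re (\<phi>' x) + Im (\<phi> x) * Im (\<phi>' x)
         - Re (\<phi> (- x)) * Re (\<phi>' (- x)) - Im (\<phi> (- x)) * Im (\<phi>' (- x))) \<le> 0" if "x > 0" for x
  proof -
    define q where "q = (2 * k + 1) / (2 * x)"
    have q: "q \<ge> 0" using that k by (simp add: q_def)
    have q': "(2 * k + 1) / (2 * - x) = - q" by (simp add: q_def)
    have e1: "\<phi>' x = \<i> * of_real c * \<phi> x - of_real q * (\<phi> x - \<phi> (- x))"
      using eig[of x] that unfolding q_def[symmetric] by (simp add: algebra_simps)
    have "\<phi>' (- x) + of_real (- q) * (\<phi> (- x) - \<phi> (- (- x))) = \<i> * of_real c * \<phi> (- x)"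
      using eig[of "- x"] that unfolding q' by simp
    then have e2: "\<phi>' (- x) = \<i> * of_real c * \<phi> (- x) - of_real q * (\<phi> x - \<phi> (- x))"
      by (simp add: algebra_simps)
    have "Re (\<phi> x) * Re (\<phi>' x) + Im (\<phi> x) * Im (\<phi>' x)
         - Re (\<phi> (- x)) * Re (\<phi>' (- x)) - Im (\<phi> (- x)) * Im (\<phi>' (- x))
       = - q * ((Re (\<phi> x) - Re (\<phi> (- x)))\<^sup>2 + (Im (\<phi> x) - Im (\<phi> (- x)))\<^sup>2)"
      unfolding e1 e2 by (simp add: algebra_simps power2_eq_square)
    also have "\<dots> \<le> 0" using q by simp
    finally show ?thesis by simp
  qed
  have le: "en x \<le> en 0" if "x > 0" for x
  proof (rule DERIV_nonpos_imp_decreasing_open[of 0 x])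
    show "continuous_on {0..x} en"
      using den by (meson DERIV_isCont continuous_at_imp_continuous_on)
    show "\<exists>y'. (en has_real_derivative y') (at y) \<and> y' \<le> 0" if "0 < y" "y < x" for y
      using den[of y] nonpos[OF \<open>0 < y\<close>] by blast
  qed (use that in auto)
  have sym: "en (- x) = en x" for x by (simp add: en_def)
  have "en x \<le> en 0"
    using le[of x] le[of "- x"] sym[of x] by (cases x "0::real" rule: linorder_cases) auto
  then show ?thesis by (simp add: en_def cmod_power2)
qed

lemma norm_dunkl_exp_le_1:
  assumes "k \<ge> - 1 / 2"
  shows "cmod (dunkl_exp k t) \<le> 1"
proof -
  have "(cmod (dunkl_exp k t))\<^sup>2 + (cmod (dunkl_exp k (- t)))\<^sup>2 \<le> 2 * (cmod (dunkl_exp k 0))\<^sup>2"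
    by (rule dunkl_eigenfunction_bound[OF assms has_vector_derivative_dunkl_exp[OF assms], where c = 1])
       (use dunkl_exp_eigen in simp_all)
  \<comment> \<open>The values at t and - t are conjugate, so both squares on the left agree and the
    factor 2 cancels.\<close>
  then have "(cmod (dunkl_exp k t))\<^sup>2 \<le> 1\<^sup>2"
    by (simp add: dunkl_exp_minus dunkl_exp_0)
  then show ?thesis by (rule power2_le_imp_le) simp
qed

lemma dunkl_eigenfunction_unique:
  fixes \<phi> \<psi> :: "real \<Rightarrow> complex"
  assumes k: "k \<ge> - 1 / 2"
    and "\<And>x. (\<phi> has_vector_derivative \<phi>' x) (at x)" "\<And>x. (\<psi> has_vector_derivative \<psi>' x) (at x)"
    and "\<And>x. x \<noteq> 0 \<Longrightarrow>
      \<phi>' x + of_real ((2 * k + 1) / (2 * x)) * (\<phi> x - \<phi> (- x)) = \<i> * of_real c * \<phi> x"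
    and "\<And>x. x \<noteq> 0 \<Longrightarrow>
      \<psi>' x + of_real ((2 * k + 1) / (2 * x)) * (\<psi> x - \<psi> (- x)) = \<i> * of_real c * \<psi> x"
    and "\<phi> 0 = \<psi> 0"
  shows "\<phi> x = \<psi> x"
proof -
  have "(cmod (\<phi> x - \<psi> x))\<^sup>2 + (cmod (\<phi> (- x) - \<psi> (- x)))\<^sup>2 \<le> 2 * (cmod (\<phi> 0 - \<psi> 0))\<^sup>2"
  proof (rule dunkl_eigenfunction_bound[OF k, where c = c])
    show "((\<lambda>x. \<phi> x - \<psi> x) has_vector_derivative \<phi>' x - \<psi>' x) (at x)" for x
      by (intro has_vector_derivative_diff assms)
    show "\<phi>' x - \<psi>' x + of_real ((2 * k + 1) / (2 * x)) * (\<phi> x - \<psi> x - (\<phi> (- x) - \<psi> (- x)))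
        = \<i> * of_real c * (\<phi> x - \<psi> x)" if "x \<noteq> 0" for x
      unfolding right_diff_distrib[of "\<i> * of_real c"] assms(4,5)[OF that, symmetric]
      by (simp only: ring_distribs) simp
  qed
  then have "(cmod (\<phi> x - \<psi> x))\<^sup>2 \<le> 0"
    using assms(6) by (smt (verit) cancel_comm_monoid_add_class.diff_cancel norm_zero power_zero_numeral zero_le_power2)
  then show ?thesis by simp
qed

lemma continuous_on_dunkl_exp [continuous_intros]:
  assumes "k \<ge> - 1 / 2" "continuous_on S g"
  shows "continuous_on S (\<lambda>x. dunkl_exp k (g x))"
proof -
  have "continuous_on UNIV (dunkl_exp k)"
    using has_vector_derivative_continuous[OF has_vector_derivative_dunkl_exp[OF assms(1)]]
    by (meson continuous_at_imp_continuous_on)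
  then show ?thesis
    by (rule continuous_on_compose2) (use assms in auto)
qed

lemma borel_measurable_dunkl_exp [measurable]:
  assumes "k \<ge> - 1 / 2"
  shows "dunkl_exp k \<in> borel_measurable borel"
  by (intro borel_measurable_continuous_onI continuous_on_dunkl_exp assms continuous_intros)

subsection \<open>Uniformly rapidly decreasing families and their Hadamard quotients\<close>

lemma has_vector_derivative_lebesgue_integral:
  fixes f f' :: "real \<Rightarrow> 'a \<Rightarrow> 'b::{banach, second_countable_topology}"
  assumes int: "\<And>x. integrable N (f x)"
    and der: "\<And>x t. t \<in> space N \<Longrightarrow> ((\<lambda>x. f x t) has_vector_derivative f' x t) (at x)"
    and bound: "\<And>x t. t \<in> space N \<Longrightarrow> \<bar>x - x0\<bar> < 1 \<Longrightarrow> norm (f' x t) \<le> w t"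
    and w: "integrable N w"
    and meas: "f' x0 \<in> borel_measurable N"
  shows "((\<lambda>x. \<integral>t. f x t \<partial>N) has_vector_derivative (\<integral>t. f' x0 t \<partial>N)) (at x0)"
proof -
  have int': "integrable N (f' x0)"
    by (rule Bochner_Integration.integrable_bound[OF w meas]) (auto intro!: AE_I2 bound order_trans[OF _ abs_ge_self])
  have w0: "0 \<le> w t" if "t \<in> space N" for t
    using order_trans[OF norm_ge_zero bound[OF that, of x0]] by simp
  \<comment> \<open>The mean value inequality on the unit ball around \<open>x0\<close> makes
    \<open>w t\<close> a Lipschitz constant there.\<close>
  have lip: "norm (f y t - f x0 t) \<le> w t * \<bar>y - x0\<bar>" if t: "t \<in> space N" and y: "y \<in> ball x0 1" for y t
  proof -
    have "norm (f y t - f x0 t) \<le> w t * norm (y - x0)"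
    proof (rule differentiable_bound[of "ball x0 1"])
      show "((\<lambda>x. f x t) has_derivative (\<lambda>h. h *\<^sub>R f' x t)) (at x within ball x0 1)" for x
        using der[OF t, of x] by (simp add: has_vector_derivative_def has_derivative_at_withinI)
      show "onorm (\<lambda>h. h *\<^sub>R f' x t) \<le> w t" if "x \<in> ball x0 1" for x
        using bound[OF t, of x] that w0[OF t]
        by (intro onorm_bound) (auto simp: dist_real_def abs_minus_commute mult_ac intro!: mult_left_mono)
    qed (use y in auto)
    then show ?thesis by simp
  qed
  \<comment> \<open>Remainder of the first-order expansion divided by the increment. It is dominated
    by \<open>2 * w t\<close>: one \<open>w\<close> from the difference quotient, one from the
    derivative.\<close>
  let ?R = "\<lambda>y t. (1 / norm (y - x0)) *\<^sub>R (f y t - (f x0 t + (y - x0) *\<^sub>R f' x0 t))"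
  have lim: "((\<lambda>y. \<integral>t. ?R y t \<partial>N) \<longlongrightarrow> 0) (at x0 within ball x0 1)"
    unfolding tendsto_at_iff_sequentially comp_def
  proof (intro allI impI)
    fix X assume X: "\<forall>i. X i \<in> ball x0 1 - {x0}" "X \<longlonglongrightarrow> x0"
    have "(\<lambda>i. \<integral>t. ?R (X i) t \<partial>N) \<longlonglongrightarrow> (\<integral>t. 0 \<partial>N)"
    proof (rule integral_dominated_convergence)
      show "integrable N (\<lambda>t. 2 * w t)" using w by simp
      show "AE t in N. (\<lambda>i. ?R (X i) t) \<longlonglongrightarrow> 0"
      proof (rule AE_I2)
        fix t assume t: "t \<in> space N"
        have "((\<lambda>y. ?R y t) \<longlongrightarrow> 0) (at x0 within ball x0 1)"
          using has_vector_derivative_at_within[OF der[OF t]] unfolding has_vector_derivative_def has_derivative_within by blast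
        then show "(\<lambda>i. ?R (X i) t) \<longlonglongrightarrow> 0"
          using X unfolding tendsto_at_iff_sequentially comp_def by blast
      qed
      show "AE t in N. norm (?R (X i) t) \<le> 2 * w t" for i
      proof (rule AE_I2)
        fix t assume t: "t \<in> space N"
        have X': "X i \<in> ball x0 1" "X i \<noteq> x0" using X by auto
        have "norm (f (X i) t - (f x0 t + (X i - x0) *\<^sub>R f' x0 t))
            \<le> norm (f (X i) t - f x0 t) + norm ((X i - x0) *\<^sub>R f' x0 t)"
          unfolding diff_diff_add[symmetric] by (rule norm_triangle_ineq4)
        also have "\<dots> \<le> w t * \<bar>X i - x0\<bar> + \<bar>X i - x0\<bar> * w t"
          using lip[OF t X'(1)] mult_left_mono[OF bound[OF t, of x0], of "\<bar>X i - x0\<bar>"]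
          by (intro add_mono) simp_all
        finally show "norm (?R (X i) t) \<le> 2 * w t"
          using X'(2) by (simp add: divide_simps mult_ac)
      qed
      have "integrable N (?R (X i))" for i
        using int int' by auto
      then show "?R (X i) \<in> borel_measurable N" for i
        by (rule borel_measurable_integrable)
    qed simp
    then show "(\<lambda>i. \<integral>t. ?R (X i) t \<partial>N) \<longlonglongrightarrow> 0" by simp
  qed
  have eq: "(\<integral>t. ?R y t \<partial>N) = (1 / norm (y - x0)) *\<^sub>R
      ((\<integral>t. f y t \<partial>N) - ((\<integral>t. f x0 t \<partial>N) + (y - x0) *\<^sub>R (\<integral>t. f' x0 t \<partial>N)))" for y
    using int int' by simp
  have "((\<lambda>x. \<integral>t. f x t \<partial>N) has_vector_derivative (\<integral>t. f' x0 t \<partial>N)) (at x0 within ball x0 1)"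
    unfolding has_vector_derivative_def has_derivative_within
    using lim unfolding eq by (intro conjI bounded_linear_scaleR_left)
  then show ?thesis
    by (simp add: at_within_open[of x0 "ball x0 1"])
qed

section \<open>Families of Schwartz functions with uniform seminorms\<close>

text \<open>Decay at every order of differentiation is an infinite descent along derivatives, hence
  the coinduction: an operation preserves the class once the derivative of its result has the same
  shape again. \<open>C\<close> precedes the quantifier over \<open>i\<close>, so all bounds are
  uniform in the index, which will be the second argument of the symbol.\<close>

coinductive schwartz_family :: "('i \<Rightarrow> real \<Rightarrow> complex) \<Rightarrow> bool" where
  "\<lbrakk>\<forall>r. \<exists>C. \<forall>i x. \<bar>x\<bar> ^ r * cmod (g i x) \<le> C;
    \<forall>i x. (g i has_vector_derivative g' i x) (at x); schwartz_family g'\<rbrakk> \<Longrightarrow> schwartz_family g"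

lemma schwartz_family_bound:
  "schwartz_family g \<Longrightarrow> \<exists>C. \<forall>i x. \<bar>x\<bar> ^ r * cmod (g i x) \<le> C"
  by (erule schwartz_family.cases) blast

lemma schwartz_family_derivE:
  assumes "schwartz_family g"
  obtains g' where "\<And>i x. (g i has_vector_derivative g' i x) (at x)" "schwartz_family g'"
  using assms by (erule_tac schwartz_family.cases) blast

lemma schwartz_family_continuous:
  assumes "schwartz_family g"
  shows "continuous_on S (g i)"
  using schwartz_family_derivE[OF assms] has_vector_derivative_continuous continuous_at_imp_continuous_on
  by metis

lemma rapid_decay_add:
  fixes g h :: "'i \<Rightarrow> real \<Rightarrow> complex"
  assumes "\<exists>C. \<forall>i x. \<bar>x\<bar> ^ r * cmod (g i x) \<le> C" "\<exists>C. \<forall>i x. \<bar>x\<bar> ^ r * cmod (h i x) \<le> C"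
  shows "\<exists>C. \<forall>i x. \<bar>x\<bar> ^ r * cmod (g i x + h i x) \<le> C"
proof -
  obtain C D where C: "\<bar>x\<bar> ^ r * cmod (g i x) \<le> C" and D: "\<bar>x\<bar> ^ r * cmod (h i x) \<le> D" for i x
    using assms by blast
  have "\<bar>x\<bar> ^ r * cmod (g i x + h i x) \<le> C + D" for i x
  proof -
    have "\<bar>x\<bar> ^ r * cmod (g i x + h i x) \<le> \<bar>x\<bar> ^ r * (cmod (g i x) + cmod (h i x))"
      by (intro mult_left_mono norm_triangle_ineq) auto
    also have "\<dots> \<le> C + D" using C[of x i] D[of x i] by (simp add: distrib_left)
    finally show ?thesis .
  qed
  then show ?thesis by blast
qed

lemma schwartz_family_add:
  assumes "schwartz_family g" "schwartz_family h"
  shows "schwartz_family (\<lambda>i x. g i x + h i x)"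
  using assms
proof (coinduction arbitrary: g h)
  case schwartz_family
  obtain g' where g': "\<And>i x. (g i has_vector_derivative g' i x) (at x)" "schwartz_family g'"
    using schwartz_family_derivE[OF schwartz_family(1)] by blast
  obtain h' where h': "\<And>i x. (h i has_vector_derivative h' i x) (at x)" "schwartz_family h'"
    using schwartz_family_derivE[OF schwartz_family(2)] by blast
  have b: "\<exists>C. \<forall>i x. \<bar>x\<bar> ^ r * cmod (g i x + h i x) \<le> C" for r
    by (intro rapid_decay_add schwartz_family_bound schwartz_family)
  have d: "((\<lambda>x. g i x + h i x) has_vector_derivative g' i x + h' i x) (at x)" for i x
    by (intro has_vector_derivative_add g' h')
  have ex: "\<exists>g h. (\<lambda>i x. g' i x + h' i x) = (\<lambda>i x. g i x + h i x) \<and> schwartz_family g \<and> schwartz_family h"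
    by (rule exI[of _ g'], rule exI[of _ h']) (use g' h' in simp)
  show ?case
    by (rule exI[of _ "\<lambda>i x. g i x + h i x"], rule exI[of _ "\<lambda>i x. g' i x + h' i x"])
       (intro conjI disjI1 refl allI; fact)
qed

lemma rapid_decay_cmult:
  fixes g :: "'i \<Rightarrow> real \<Rightarrow> complex"
  assumes "\<exists>C. \<forall>i x. \<bar>x\<bar> ^ r * cmod (g i x) \<le> C"
  shows "\<exists>C. \<forall>i x. \<bar>x\<bar> ^ r * cmod (c * g i x) \<le> C"
proof -
  obtain C where C: "\<bar>x\<bar> ^ r * cmod (g i x) \<le> C" for i x
    using assms by blast
  have "\<bar>x\<bar> ^ r * cmod (c * g i x) \<le> cmod c * C" for i x
    using mult_left_mono[OF C[of x i], of "cmod c"] by (simp add: norm_mult mult_ac)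
  then show ?thesis by blast
qed

lemma schwartz_family_cmult:
  assumes "schwartz_family g"
  shows "schwartz_family (\<lambda>i x. c * g i x)"
  using assms
proof (coinduction arbitrary: g)
  case schwartz_family
  obtain g' where g': "\<And>i x. (g i has_vector_derivative g' i x) (at x)" "schwartz_family g'"
    using schwartz_family_derivE[OF schwartz_family] by blast
  have b: "\<exists>C. \<forall>i x. \<bar>x\<bar> ^ r * cmod (c * g i x) \<le> C" for r
    by (intro rapid_decay_cmult schwartz_family_bound schwartz_family)
  have d: "((\<lambda>x. c * g i x) has_vector_derivative c * g' i x) (at x)" for i x
    by (intro has_vector_derivative_mult_right g')
  have ex: "\<exists>g. (\<lambda>i x. c * g' i x) = (\<lambda>i x. c * g i x) \<and> schwartz_family g"
    by (rule exI[of _ g']) (use g' in simp)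
  show ?case
    by (rule exI[of _ "\<lambda>i x. c * g i x"], rule exI[of _ "\<lambda>i x. c * g' i x"])
       (intro conjI disjI1 refl allI; fact)
qed

lemma schwartz_family_mult_x:
  assumes "schwartz_family g"
  shows "schwartz_family (\<lambda>i x. of_real x * g i x)"
proof -
  \<comment> \<open>The form x g is not stable, its derivative being x g' + g. The form x g + h is:
    its derivative is x g' + (g + h').\<close>
  have "schwartz_family (\<lambda>i x. of_real x * g i x + h i x)" if "schwartz_family g" "schwartz_family h"
    for g h :: "'a \<Rightarrow> real \<Rightarrow> complex"
    using that
  proof (coinduction arbitrary: g h)
    case schwartz_family
    obtain g' where g': "\<And>i x. (g i has_vector_derivative g' i x) (at x)" "schwartz_family g'"
      using schwartz_family_derivE[OF schwartz_family(1)] by blast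
    obtain h' where h': "\<And>i x. (h i has_vector_derivative h' i x) (at x)" "schwartz_family h'"
      using schwartz_family_derivE[OF schwartz_family(2)] by blast
    have d: "((\<lambda>x. of_real x * g i x + h i x) has_vector_derivative
        of_real x * g' i x + (g i x + h' i x)) (at x)" for i x
    proof -
      have "((\<lambda>x. of_real x) has_vector_derivative (1 :: complex)) (at x)"
        using has_vector_derivative_of_real[OF DERIV_ident] by simp
      from has_vector_derivative_add[OF has_vector_derivative_mult[OF this g'(1)] h'(1)]
      show ?thesis by (simp add: add.assoc)
    qed
    have b: "\<exists>C. \<forall>i x. \<bar>x\<bar> ^ r * cmod (of_real x * g i x) \<le> C" for r
      using schwartz_family_bound[OF schwartz_family(1), of "Suc r"] by (simp add: norm_mult mult_ac)
    have ex: "\<exists>g1 h1. (\<lambda>i x. of_real x * g' i x + (g i x + h' i x)) = (\<lambda>i x. of_real x * g1 i x + h1 i x)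
        \<and> schwartz_family g1 \<and> schwartz_family h1"
      by (rule exI[of _ g'], rule exI[of _ "\<lambda>i x. g i x + h' i x"])
         (use g'(2) schwartz_family_add[OF schwartz_family(1) h'(2)] in simp)
    note bh = rapid_decay_add[OF b schwartz_family_bound[OF schwartz_family(2)]]
    show ?case
      by (rule exI[of _ "\<lambda>i x. of_real x * g i x + h i x"], rule exI[of _ "\<lambda>i x. of_real x * g' i x + (g i x + h' i x)"])
       (intro conjI disjI1 refl allI; fact)
  qed
  from this[OF assms schwartz_family_cmult[OF assms, of 0]] show ?thesis by simp
qed

text \<open>A chirp has modulus 1 and differentiation only brings down i \<alpha> x, so the
  derivative is the same chirp times g' + i \<alpha> x g, which is covered by the preceding closure
  properties.\<close>

lemma schwartz_family_chirp:
  assumes "schwartz_family g"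
  shows "schwartz_family (\<lambda>i x. exp (\<i> / 2 * of_real (\<alpha> * x\<^sup>2)) * g i x)"
  using assms
proof (coinduction arbitrary: g)
  case schwartz_family
  let ?p = "\<lambda>x. exp (\<i> / 2 * of_real (\<alpha> * x\<^sup>2))"
  obtain g' where g': "\<And>i x. (g i has_vector_derivative g' i x) (at x)" "schwartz_family g'"
    using schwartz_family_derivE[OF schwartz_family] by blast
  have p: "(?p has_vector_derivative \<i> * of_real \<alpha> * of_real x * ?p x) (at x)" for x
  proof -
    have "((\<lambda>z. exp (\<i> / 2 * (of_real \<alpha> * z\<^sup>2))) has_field_derivative
        exp (\<i> / 2 * (of_real \<alpha> * (of_real x)\<^sup>2)) * (\<i> / 2 * (of_real \<alpha> * (2 * of_real x)))) (at (of_real x))"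
      by (auto intro!: derivative_eq_intros)
    from has_vector_derivative_real_field[OF this] show ?thesis
      by (simp add: mult_ac)
  qed
  have "?p x * g' i x + \<i> * of_real \<alpha> * of_real x * ?p x * g i x =
      ?p x * (g' i x + \<i> * of_real \<alpha> * (of_real x * g i x))" for i x
    by (simp only: ring_distribs mult_ac)
  note e = this
  have d: "((\<lambda>x. ?p x * g i x) has_vector_derivative
      ?p x * (g' i x + \<i> * of_real \<alpha> * (of_real x * g i x))) (at x)" for i x
    using has_vector_derivative_mult[OF p g'(1)] unfolding e .
  have b: "\<exists>C. \<forall>i x. \<bar>x\<bar> ^ r * cmod (?p x * g i x) \<le> C" for r
    using schwartz_family_bound[OF schwartz_family, of r] by (simp add: norm_mult)
  have "schwartz_family (\<lambda>i x. g' i x + \<i> * of_real \<alpha> * (of_real x * g i x))"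
    by (intro schwartz_family_add schwartz_family_cmult schwartz_family_mult_x schwartz_family g')
  then have ex: "\<exists>g1. (\<lambda>i x. ?p x * (g' i x + \<i> * of_real \<alpha> * (of_real x * g i x))) =
      (\<lambda>i x. ?p x * g1 i x) \<and> schwartz_family g1"
    by (intro exI[of _ "\<lambda>i x. g' i x + \<i> * of_real \<alpha> * (of_real x * g i x)"] conjI refl)
  show ?case
    by (rule exI[of _ "\<lambda>i x. ?p x * g i x"], rule exI[of _ "\<lambda>i x. ?p x * (g' i x + \<i> * of_real \<alpha> * (of_real x * g i x))"])
       (intro conjI disjI1 refl allI; fact)
qed

section \<open>Integrals over [-1, 1] and Hadamard quotients\<close>

definition unit_interval_measure :: "real measure" where
  "unit_interval_measure = restrict_space lborel {- 1..1}"

lemma space_unit_interval_measure [simp]: "space unit_interval_measure = {- 1..1}"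
  by (simp add: unit_interval_measure_def space_restrict_space)

lemma finite_measure_unit_interval: "finite_measure unit_interval_measure"
  by (rule finite_measureI) (simp add: unit_interval_measure_def space_restrict_space emeasure_restrict_space)

lemma integral_unit_interval_measure:
  fixes f :: "real \<Rightarrow> complex"
  shows "(\<integral>t. f t \<partial>unit_interval_measure) = (\<integral>t. indicator {- 1..1} t *\<^sub>R f t \<partial>lborel)"
  unfolding unit_interval_measure_def by (subst integral_restrict_space) auto

lemma integrable_unit_interval_continuous:
  fixes f :: "real \<Rightarrow> complex"
  assumes "continuous_on {- 1..1} f"
  shows "integrable unit_interval_measure f"
  using borel_integrable_compact[OF compact_Icc assms]
  unfolding unit_interval_measure_def by (subst integrable_restrict_space) auto

text \<open>For \<open>g = h'\<close> and \<open>n = 0\<close> this is the Hadamard quotient \<open>(h x - h (- x)) / x\<close>, and every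
  further \<open>x\<close>-derivative raises \<open>n\<close> and the order of the derivative of \<open>h\<close> by one.\<close>

definition hadamard :: "nat \<Rightarrow> ('i \<Rightarrow> real \<Rightarrow> complex) \<Rightarrow> 'i \<Rightarrow> real \<Rightarrow> complex" where
  "hadamard n g i x = (\<integral>t. of_real t ^ n * g i (t * x) \<partial>unit_interval_measure)"

lemma schwartz_family_integrable_unit:
  assumes "schwartz_family g"
  shows "integrable unit_interval_measure (\<lambda>t. of_real t ^ n * g i (t * x))"
  by (intro integrable_unit_interval_continuous continuous_intros
      continuous_on_compose2[OF schwartz_family_continuous[OF assms, of UNIV]]) auto

lemma has_vector_derivative_hadamard:
  assumes g: "schwartz_family g" and g': "schwartz_family g'"
    and d: "\<And>i x. (g i has_vector_derivative g' i x) (at x)"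
  shows "(hadamard n g i has_vector_derivative hadamard (Suc n) g' i x) (at x)"
proof -
  interpret finite_measure unit_interval_measure by (rule finite_measure_unit_interval)
  obtain C where C: "cmod (g' i x) \<le> C" for i x
    using schwartz_family_bound[OF g', of 0] by auto
  show ?thesis
    unfolding hadamard_def[abs_def]
  proof (rule has_vector_derivative_lebesgue_integral)
    show "integrable unit_interval_measure (\<lambda>t. of_real t ^ n * g i (t * x))" for x
      by (rule schwartz_family_integrable_unit[OF g])
    show "((\<lambda>x. of_real t ^ n * g i (t * x)) has_vector_derivative of_real t ^ Suc n * g' i (t * x)) (at x)"
      for x t
    proof -
      have "((\<lambda>x. t * x) has_vector_derivative t) (at x)"
        by (auto intro!: derivative_eq_intros simp flip: has_real_derivative_iff_has_vector_derivative)
      from has_vector_derivative_mult_right[OF vector_diff_chain_at[OF this d], of "of_real t ^ n"]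
      show ?thesis by (simp add: comp_def scaleR_conv_of_real mult_ac)
    qed
    show "cmod (of_real t ^ Suc n * g' i (t * x)) \<le> C"
      if "t \<in> space unit_interval_measure" for x t
    proof -
      have "cmod (of_real t ^ Suc n * g' i (t * x)) = \<bar>t\<bar> ^ Suc n * cmod (g' i (t * x))"
        by (simp add: norm_mult norm_power)
      also have "\<dots> \<le> 1 * C"
        using that C by (intro mult_mono power_le_one) auto
      finally show ?thesis by simp
    qed
    show "integrable unit_interval_measure (\<lambda>t. C)" by simp
    show "(\<lambda>t. of_real t ^ Suc n * g' i (t * x)) \<in> borel_measurable unit_interval_measure"
      by (rule borel_measurable_integrable schwartz_family_integrable_unit[OF g'])+
  qed
qed

text \<open>Fundamental theorem for t^n g(t x) on [-1, 1]: a factor x is traded for boundary values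
  at x and - x and a quotient of lower order. For n = 0 the truncated \<open>n - 1\<close> is
  harmless because of its factor \<open>of_nat n\<close>.\<close>

lemma hadamard_parts:
  assumes g: "schwartz_family g" and g': "schwartz_family g'"
    and d: "\<And>i x. (g i has_vector_derivative g' i x) (at x)"
  shows "of_real x * hadamard n g' i x =
    g i x - (- 1) ^ n * g i (- x) - of_nat n * hadamard (n - 1) g i x"
proof -
  let ?F = "\<lambda>t. of_real t ^ n * g i (t * x)"
  let ?f = "\<lambda>t. of_real x * (of_real t ^ n * g' i (t * x)) + of_nat n * (of_real t ^ (n - 1) * g i (t * x))"
  have D: "(?F has_vector_derivative ?f t) (at t)" for t
  proof -
    have 1: "((\<lambda>t. t * x) has_vector_derivative x) (at t)"
      by (auto intro!: derivative_eq_intros simp flip: has_real_derivative_iff_has_vector_derivative)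
    have "((\<lambda>z. z ^ n) has_field_derivative of_nat n * of_real t ^ (n - 1)) (at (of_real t :: complex))"
      by (auto intro!: derivative_eq_intros)
    from has_vector_derivative_real_field[OF this]
    have 2: "((\<lambda>t. of_real t ^ n :: complex) has_vector_derivative of_nat n * of_real t ^ (n - 1)) (at t)" .
    from has_vector_derivative_mult[OF 2 vector_diff_chain_at[OF 1 d, unfolded comp_def]]
    show ?thesis by (simp add: scaleR_conv_of_real mult_ac)
  qed
  have "(\<integral>t. indicator {- 1..1} t *\<^sub>R ?f t \<partial>lborel) = ?F 1 - ?F (- 1)"
  proof (rule integral_FTC_Icc)
    show "(?F has_vector_derivative ?f t) (at t within {- 1..1})" for t
      using D by (rule has_vector_derivative_at_within)
    show "continuous_on {- 1..1} ?f"
      by (intro continuous_intros continuous_on_compose2[OF schwartz_family_continuous[OF g, of UNIV]]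
          continuous_on_compose2[OF schwartz_family_continuous[OF g', of UNIV]]) auto
  qed simp
  then have "(\<integral>t. ?f t \<partial>unit_interval_measure) = ?F 1 - ?F (- 1)"
    unfolding integral_unit_interval_measure .
  moreover have "(\<integral>t. ?f t \<partial>unit_interval_measure) =
      of_real x * hadamard n g' i x + of_nat n * hadamard (n - 1) g i x"
    unfolding hadamard_def
    using schwartz_family_integrable_unit[OF g] schwartz_family_integrable_unit[OF g'] by simp
  ultimately show ?thesis by (simp add: algebra_simps)
qed

lemma hadamard_bounded:
  assumes "schwartz_family g"
  shows "\<exists>C. \<forall>i x. cmod (hadamard n g i x) \<le> C"
proof -
  interpret finite_measure unit_interval_measure by (rule finite_measure_unit_interval)
  obtain C where C: "cmod (g i x) \<le> C" for i x
    using schwartz_family_bound[OF assms, of 0] by auto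
  have "cmod (hadamard n g i x) \<le> (\<integral>t. C \<partial>unit_interval_measure)" for i x
    unfolding hadamard_def
  proof (rule Bochner_Integration.integral_norm_bound_integral)
    show "integrable unit_interval_measure (\<lambda>t. of_real t ^ n * g i (t * x))"
      by (rule schwartz_family_integrable_unit[OF assms])
    show "cmod (of_real t ^ n * g i (t * x)) \<le> C" if "t \<in> space unit_interval_measure" for t
    proof -
      have "cmod (of_real t ^ n * g i (t * x)) = \<bar>t\<bar> ^ n * cmod (g i (t * x))"
        by (simp add: norm_mult norm_power)
      also have "\<dots> \<le> 1 * C"
        using that C by (intro mult_mono power_le_one) auto
      finally show ?thesis by simp
    qed
  qed simp
  then show ?thesis by blast
qed

text \<open>A named derivative that can be iterated with \<open>^^\<close>; the coinductive
  predicate only asserts that some derivative exists.\<close>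

definition deriv_family :: "('i \<Rightarrow> real \<Rightarrow> complex) \<Rightarrow> 'i \<Rightarrow> real \<Rightarrow> complex" where
  "deriv_family g i x = vector_derivative (g i) (at x)"

lemma schwartz_family_deriv:
  assumes "schwartz_family g"
  shows "(g i has_vector_derivative deriv_family g i x) (at x)" "schwartz_family (deriv_family g)"
proof -
  obtain g' where g': "\<And>i x. (g i has_vector_derivative g' i x) (at x)" "schwartz_family g'"
    using schwartz_family_derivE[OF assms] by blast
  then have "deriv_family g = g'"
    by (auto simp: deriv_family_def fun_eq_iff intro!: vector_derivative_at)
  then show "(g i has_vector_derivative deriv_family g i x) (at x)" "schwartz_family (deriv_family g)"
    using g' by auto
qed

text \<open>Decay is not inherited pointwise from the integrand, because t x stays small near t = 0
  however large x is. Each power of x is removed by \<open>hadamard_parts\<close> instead, which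
  undoes one derivative and lowers n by one; n + 1 derivatives are just enough to end with boundary
  terms alone.\<close>

lemma rapid_decay_hadamard:
  assumes "schwartz_family g"
  shows "\<exists>C. \<forall>i x. \<bar>x\<bar> ^ r * cmod (hadamard n ((deriv_family ^^ Suc n) g) i x) \<le> C"
proof (induction n arbitrary: r)
  have D: "schwartz_family ((deriv_family ^^ m) g)" for m
    by (induction m) (auto intro: assms schwartz_family_deriv)
  have step: "\<exists>C. \<forall>i x. \<bar>x\<bar> ^ r * cmod (hadamard n ((deriv_family ^^ Suc n) g) i x) \<le> C"
    if n: "\<And>r. n > 0 \<Longrightarrow> \<exists>C. \<forall>i x. \<bar>x\<bar> ^ r * cmod (hadamard (n - 1) ((deriv_family ^^ n) g) i x) \<le> C" for n r
  proof (cases r)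
    case 0
    then show ?thesis using hadamard_bounded[OF D[of "Suc n"]] by simp
  next
    case (Suc r')
    let ?g = "(deriv_family ^^ n) g"
    obtain C where C: "\<bar>x\<bar> ^ r' * cmod (?g i x) \<le> C" for i x
      using schwartz_family_bound[OF D, of r'] by blast
    \<comment> \<open>For n = 0 the term of lower order is absent and any \<open>B\<close> will do,
      here 0.\<close>
    obtain B where B: "of_nat n * (\<bar>x\<bar> ^ r' * cmod (hadamard (n - 1) ?g i x)) \<le> of_nat n * B" for i x
    proof (cases "n = 0")
      case False
      then obtain B where "\<bar>x\<bar> ^ r' * cmod (hadamard (n - 1) ?g i x) \<le> B" for i x
        using n[of r'] by blast
      then show ?thesis by (intro that[of B] mult_left_mono) auto
    qed (use that[of 0] in simp)
    have "\<bar>x\<bar> ^ r * cmod (hadamard n ((deriv_family ^^ Suc n) g) i x) \<le> 2 * C + of_nat n * B" for i x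
    proof -
      have "\<bar>x\<bar> ^ r * cmod (hadamard n ((deriv_family ^^ Suc n) g) i x) =
          \<bar>x\<bar> ^ r' * cmod (of_real x * hadamard n (deriv_family ?g) i x)"
        by (simp add: Suc norm_mult mult_ac)
      also have "\<dots> = \<bar>x\<bar> ^ r' * cmod (?g i x - (- 1) ^ n * ?g i (- x) - of_nat n * hadamard (n - 1) ?g i x)"
        by (subst hadamard_parts[OF D schwartz_family_deriv(2)[OF D] schwartz_family_deriv(1)[OF D]]) simp
      also have "\<dots> \<le> \<bar>x\<bar> ^ r' * (cmod (?g i x) + cmod (?g i (- x)) + of_nat n * cmod (hadamard (n - 1) ?g i x))"
      proof (intro mult_left_mono)
        have "cmod (?g i x - (- 1) ^ n * ?g i (- x) - of_nat n * hadamard (n - 1) ?g i x)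
          \<le> cmod (?g i x) + cmod ((- 1) ^ n * ?g i (- x)) + cmod (of_nat n * hadamard (n - 1) ?g i x)"
          using norm_triangle_ineq4[of "?g i x - (- 1) ^ n * ?g i (- x)" "of_nat n * hadamard (n - 1) ?g i x"]
            norm_triangle_ineq4[of "?g i x" "(- 1) ^ n * ?g i (- x)"] by linarith
        then show "cmod (?g i x - (- 1) ^ n * ?g i (- x) - of_nat n * hadamard (n - 1) ?g i x)
          \<le> cmod (?g i x) + cmod (?g i (- x)) + of_nat n * cmod (hadamard (n - 1) ?g i x)"
          by (simp add: norm_mult norm_power)
      qed simp
      also have "\<dots> \<le> C + C + of_nat n * B"
        using C[of x i] C[of "- x" i] B[of x i] by (simp add: algebra_simps)
      finally show ?thesis by simp
    qed
    then show ?thesis by blast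
  qed
  {
    case 0
    show ?case by (rule step) simp
  next
    case (Suc n)
    show ?case by (rule step) (use Suc in simp)
  }
qed

lemma schwartz_family_hadamard:
  assumes "schwartz_family g"
  shows "schwartz_family (hadamard 0 (deriv_family g))"
proof -
  have "schwartz_family (hadamard n ((deriv_family ^^ Suc n) g))" for n
  proof (coinduction arbitrary: n)
    case schwartz_family
    have D: "schwartz_family ((deriv_family ^^ m) g)" for m
      by (induction m) (auto intro: assms schwartz_family_deriv)
    have d: "(hadamard n ((deriv_family ^^ Suc n) g) i has_vector_derivative
        hadamard (Suc n) ((deriv_family ^^ Suc (Suc n)) g) i x) (at x)" for i x
      by (rule has_vector_derivative_hadamard[OF D D])
         (use schwartz_family_deriv(1)[OF D, of "Suc n"] in simp)
    note b = rapid_decay_hadamard[OF assms, of _ n]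
    have ex: "\<exists>m. hadamard (Suc n) ((deriv_family ^^ Suc (Suc n)) g) = hadamard m ((deriv_family ^^ Suc m) g)"
      by (intro exI[of _ "Suc n"] refl)
    show ?case
      by (rule exI[of _ "hadamard n ((deriv_family ^^ Suc n) g)"], rule exI[of _ "hadamard (Suc n) ((deriv_family ^^ Suc (Suc n)) g)"])
       (intro conjI disjI1 refl allI; fact)
  qed
  from this[of 0] show ?thesis by simp
qed

subsection \<open>Integration by parts and decay of the Dunkl transform\<close>

definition dunkl_density :: "real \<Rightarrow> real \<Rightarrow> real" where
  "dunkl_density k x = \<bar>x\<bar> powr (2 * k + 1) / (2 powr (k + 1) * Gamma (k + 1))"

lemma dunkl_density_nonneg: "k \<ge> - 1 / 2 \<Longrightarrow> dunkl_density k x \<ge> 0"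
  unfolding dunkl_density_def by (auto intro!: divide_nonneg_pos mult_pos_pos Gamma_real_pos)

lemma borel_measurable_dunkl_density [measurable]: "dunkl_density k \<in> borel_measurable borel"
  unfolding dunkl_density_def[abs_def] by measurable

lemma dunkl_density_minus: "dunkl_density k (- x) = dunkl_density k x"
  by (simp add: dunkl_density_def)

lemma dunkl_measure_eq: "dunkl_measure k = density lborel (\<lambda>x. ennreal (dunkl_density k x))"
  by (simp add: dunkl_measure_def dunkl_density_def)

lemma sets_dunkl_measure [simp, measurable_cong]: "sets (dunkl_measure k) = sets borel"
  by (simp add: dunkl_measure_def)

lemma space_dunkl_measure [simp]: "space (dunkl_measure k) = UNIV"
  by (simp add: dunkl_measure_def)

lemma sigma_finite_dunkl_measure: "sigma_finite_measure (dunkl_measure k)"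
  unfolding dunkl_measure_eq
  by (subst sigma_finite_measure.sigma_finite_iff_density_finite[OF sigma_finite_lborel]) auto

lemma integral_dunkl_measure:
  fixes f :: "real \<Rightarrow> 'b::{banach, second_countable_topology}"
  assumes "k \<ge> - 1 / 2" "f \<in> borel_measurable borel"
  shows "(\<integral>x. f x \<partial>dunkl_measure k) = (\<integral>x. dunkl_density k x *\<^sub>R f x \<partial>lborel)"
  unfolding dunkl_measure_eq using assms
  by (subst integral_density) (auto simp: dunkl_density_nonneg)

lemma integrable_dunkl_measure:
  fixes f :: "real \<Rightarrow> 'b::{banach, second_countable_topology}"
  assumes "k \<ge> - 1 / 2" "f \<in> borel_measurable borel"
  shows "integrable (dunkl_measure k) f \<longleftrightarrow> integrable lborel (\<lambda>x. dunkl_density k x *\<^sub>R f x)"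
  unfolding dunkl_measure_eq using assms
  by (subst integrable_density) (auto simp: dunkl_density_nonneg)

text \<open>An integrable majorant for rapidly decreasing functions. The first factor absorbs the
  density, with the exponent rounded up to a natural number so that Schwartz seminorms control it;
  what remains is the derivative of arctan.\<close>

definition dunkl_weight :: "real \<Rightarrow> real \<Rightarrow> real" where
  "dunkl_weight k x = inverse ((1 + \<bar>x\<bar> ^ nat \<lceil>2 * k + 1\<rceil>) * (1 + x\<^sup>2))"

lemma one_plus_abs_power_pos: "0 < 1 + \<bar>x :: real\<bar> ^ n"
  by (rule add_pos_nonneg) auto

lemma dunkl_weight_nonneg: "dunkl_weight k x \<ge> 0"
  unfolding dunkl_weight_def by simp

lemma borel_measurable_dunkl_weight [measurable]: "dunkl_weight k \<in> borel_measurable borel"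
  unfolding dunkl_weight_def[abs_def] by measurable

lemma abs_powr_le_power:
  fixes k x :: real
  assumes "k \<ge> - 1 / 2"
  shows "\<bar>x\<bar> powr (2 * k + 1) \<le> 1 + \<bar>x\<bar> ^ nat \<lceil>2 * k + 1\<rceil>"
proof (cases "\<bar>x\<bar> \<le> 1")
  case True
  then have "\<bar>x\<bar> powr (2 * k + 1) \<le> 1" using assms by (intro powr_le1) auto
  then show ?thesis by (simp add: add_increasing2)
next
  case False
  have "\<bar>x\<bar> powr (2 * k + 1) \<le> \<bar>x\<bar> powr (real (nat \<lceil>2 * k + 1\<rceil>))"
    using False by (intro powr_mono) linarith+
  also have "\<dots> = \<bar>x\<bar> ^ nat \<lceil>2 * k + 1\<rceil>"
    using False by (intro powr_realpow) auto
  finally show ?thesis by simp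
qed

lemma integrable_inverse_one_plus_square: "integrable lborel (\<lambda>x::real. inverse (1 + x\<^sup>2))"
proof -
  have "set_integrable lborel (einterval (- \<infinity>) \<infinity>) (\<lambda>x::real. inverse (1 + x\<^sup>2))"
  proof (rule interval_integral_FTC_nonneg(1))
    show "DERIV arctan x :> inverse (1 + x\<^sup>2)" for x by (rule DERIV_arctan)
    show "isCont (\<lambda>x. inverse (1 + x\<^sup>2)) x" for x :: real
      by (intro continuous_intros) (auto simp: power2_eq_square add_nonneg_eq_0_iff)
    show "((arctan \<circ> real_of_ereal) \<longlongrightarrow> - (pi / 2)) (at_right (- \<infinity>))"
      by (simp add: ereal_tendsto_simps tendsto_arctan_at_bot)
    show "((arctan \<circ> real_of_ereal) \<longlongrightarrow> pi / 2) (at_left \<infinity>)"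
      by (simp add: ereal_tendsto_simps tendsto_arctan_at_top)
  qed auto
  then show ?thesis by (simp add: set_integrable_def)
qed

lemma integrable_dunkl_weight:
  assumes "k \<ge> - 1 / 2"
  shows "integrable (dunkl_measure k) (dunkl_weight k)"
proof -
  let ?c = "2 powr (k + 1) * Gamma (k + 1)"
  have c: "?c > 0" using assms by (auto intro!: mult_pos_pos Gamma_real_pos)
  have "integrable lborel (\<lambda>x. dunkl_density k x *\<^sub>R dunkl_weight k x)"
  proof (rule Bochner_Integration.integrable_bound)
    show "integrable lborel (\<lambda>x. inverse (1 + x\<^sup>2) * (1 / ?c))"
      by (intro integrable_mult_left integrable_inverse_one_plus_square)
    show "AE x in lborel. norm (dunkl_density k x *\<^sub>R dunkl_weight k x) \<le> norm (inverse (1 + x\<^sup>2) * (1 / ?c))"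
    proof (rule AE_I2)
      fix x :: real
      let ?p = "1 + \<bar>x\<bar> ^ nat \<lceil>2 * k + 1\<rceil>"
      have "\<bar>x\<bar> powr (2 * k + 1) * inverse ?p \<le> ?p * inverse ?p"
        using one_plus_abs_power_pos[of x "nat \<lceil>2 * k + 1\<rceil>"]
        by (intro mult_right_mono abs_powr_le_power assms) auto
      also have "\<dots> = 1" using one_plus_abs_power_pos[of x "nat \<lceil>2 * k + 1\<rceil>"] by simp
      finally have "\<bar>x\<bar> powr (2 * k + 1) * inverse ?p * (inverse (1 + x\<^sup>2) * (1 / ?c)) \<le>
          1 * (inverse (1 + x\<^sup>2) * (1 / ?c))"
        using c by (intro mult_right_mono) auto
      moreover have "dunkl_density k x * dunkl_weight k x =
          \<bar>x\<bar> powr (2 * k + 1) * inverse ?p * (inverse (1 + x\<^sup>2) * (1 / ?c))"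
        by (simp add: dunkl_density_def dunkl_weight_def divide_inverse mult_ac)
      moreover have "dunkl_density k x * dunkl_weight k x \<ge> 0"
        by (intro mult_nonneg_nonneg dunkl_density_nonneg dunkl_weight_nonneg assms)
      moreover have "inverse (1 + x\<^sup>2) * (1 / ?c) \<ge> 0" using c by simp
      ultimately show "norm (dunkl_density k x *\<^sub>R dunkl_weight k x) \<le> norm (inverse (1 + x\<^sup>2) * (1 / ?c))"
        unfolding real_scaleR_def real_norm_def by linarith
    qed
  qed measurable
  then show ?thesis
    using assms by (simp add: integrable_dunkl_measure)
qed

lemma rapid_decay_dominated:
  fixes F :: "'i \<Rightarrow> real \<Rightarrow> real"
  assumes "\<And>r. \<exists>C. \<forall>i x. \<bar>x\<bar> ^ r * F i x \<le> C"
  shows "\<exists>C\<ge>0. \<forall>i x. F i x \<le> C * dunkl_weight k x"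
proof -
  let ?p = "nat \<lceil>2 * k + 1\<rceil>"
  obtain C where C: "\<And>r i x. \<bar>x\<bar> ^ r * F i x \<le> C r"
    using assms by metis
  \<comment> \<open>Multiplying out the inverse weight gives the monomials of degree 0, 2,
    \<open>?p\<close> and \<open>?p + 2\<close>, one seminorm for each.\<close>
  let ?C = "max 0 (C 0 + C 2 + C ?p + C (?p + 2))"
  have "F i x \<le> ?C * dunkl_weight k x" for i x
  proof -
    have pos: "(1 + \<bar>x\<bar> ^ ?p) * (1 + x\<^sup>2) > 0"
      by (intro mult_pos_pos one_plus_abs_power_pos add_pos_nonneg) auto
    have "F i x * ((1 + \<bar>x\<bar> ^ ?p) * (1 + x\<^sup>2)) =
        \<bar>x\<bar> ^ 0 * F i x + \<bar>x\<bar> ^ 2 * F i x + \<bar>x\<bar> ^ ?p * F i x + \<bar>x\<bar> ^ (?p + 2) * F i x"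
      unfolding power_add power2_abs by (simp add: algebra_simps)
    also have "\<dots> \<le> ?C"
      using C[of x 0 i] C[of x 2 i] C[of x ?p i] C[of x "?p + 2" i] by linarith
    finally show ?thesis
      unfolding dunkl_weight_def using pos by (simp add: field_simps)
  qed
  then show ?thesis by (intro exI[of _ ?C]) auto
qed

lemma schwartz_family_dominated:
  assumes "schwartz_family g"
  shows "\<exists>C\<ge>0. \<forall>i x. cmod (g i x) \<le> C * dunkl_weight k x"
  using rapid_decay_dominated[of "\<lambda>i x. cmod (g i x)" k] schwartz_family_bound[OF assms] by blast

lemma borel_measurable_schwartz_family:
  assumes "schwartz_family g"
  shows "g i \<in> borel_measurable borel"
  by (rule borel_measurable_continuous_onI[OF schwartz_family_continuous[OF assms]])

lemma integrable_schwartz_dunkl_exp: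
  assumes k: "k \<ge> - 1 / 2" and g: "schwartz_family g"
  shows "integrable (dunkl_measure k) (\<lambda>x. g i x * dunkl_exp k (\<xi> * x))"
proof -
  obtain C where C: "C \<ge> 0" "\<And>i x. cmod (g i x) \<le> C * dunkl_weight k x"
    using schwartz_family_dominated[OF g] by blast
  note [measurable] = borel_measurable_schwartz_family[OF g] borel_measurable_dunkl_exp[OF k]
  show ?thesis
  proof (rule Bochner_Integration.integrable_bound)
    show "integrable (dunkl_measure k) (\<lambda>x. C * dunkl_weight k x)"
      by (intro integrable_mult_right integrable_dunkl_weight k)
    show "AE x in dunkl_measure k. norm (g i x * dunkl_exp k (\<xi> * x)) \<le> norm (C * dunkl_weight k x)"
    proof (rule AE_I2)
      fix x
      have "cmod (g i x) * cmod (dunkl_exp k (\<xi> * x)) \<le> (C * dunkl_weight k x) * 1"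
        using C by (intro mult_mono norm_dunkl_exp_le_1 k) (auto intro: dunkl_weight_nonneg mult_nonneg_nonneg)
      then show "norm (g i x * dunkl_exp k (\<xi> * x)) \<le> norm (C * dunkl_weight k x)"
        using C(1) dunkl_weight_nonneg[of k x] by (simp add: norm_mult)
    qed
  qed measurable
qed

lemma schwartz_family_transform_bounded:
  assumes k: "k \<ge> - 1 / 2" and g: "schwartz_family g"
  shows "\<exists>C. \<forall>i \<xi>. cmod (\<integral>x. g i x * dunkl_exp k (\<xi> * x) \<partial>dunkl_measure k) \<le> C"
proof -
  obtain C where C: "C \<ge> 0" "\<And>i x. cmod (g i x) \<le> C * dunkl_weight k x"
    using schwartz_family_dominated[OF g] by blast
  have "cmod (\<integral>x. g i x * dunkl_exp k (\<xi> * x) \<partial>dunkl_measure k) \<le>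
      (\<integral>x. C * dunkl_weight k x \<partial>dunkl_measure k)" for i \<xi>
  proof (rule Bochner_Integration.integral_norm_bound_integral)
    show "cmod (g i x * dunkl_exp k (\<xi> * x)) \<le> C * dunkl_weight k x" for x
      unfolding norm_mult using C(2)[of i x] norm_dunkl_exp_le_1[OF k, of "\<xi> * x"]
      by (meson mult_left_le norm_ge_zero order_trans)
  qed (intro integrable_schwartz_dunkl_exp integrable_mult_right integrable_dunkl_weight k g)+
  then show ?thesis by blast
qed

text \<open>The Dunkl operator mixes x and - x and has a coefficient singular at 0, so the
  fundamental theorem of calculus is applied on the half line, to the sum of both values. The
  product formula uses the same folding to exploit the parity of W.\<close>

lemma lborel_integral_symmetrize:
  fixes f :: "real \<Rightarrow> 'b::{banach, second_countable_topology}"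
  assumes "integrable lborel f"
  shows "integrable lborel (\<lambda>x. indicator {0<..} x *\<^sub>R (f x + f (- x)))"
    and "(\<integral>x. f x \<partial>lborel) = (\<integral>x. indicator {0<..} x *\<^sub>R (f x + f (- x)) \<partial>lborel)"
proof -
  have i1: "integrable lborel (\<lambda>x. indicator {0<..} x *\<^sub>R f x)"
    and i2: "integrable lborel (\<lambda>x. indicator {..<0} x *\<^sub>R f x)"
    using assms by (auto intro!: integrable_mult_indicator)
  have i3: "integrable lborel (\<lambda>x. indicator {0<..} x *\<^sub>R f (- x))"
    using lborel_integrable_real_affine[OF i2, of "-1" 0] by (simp add: indicator_def)
  show "integrable lborel (\<lambda>x. indicator {0<..} x *\<^sub>R (f x + f (- x)))"
    using Bochner_Integration.integrable_add[OF i1 i3] by (simp add: scaleR_add_right)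
  have "(\<integral>x. f x \<partial>lborel) = (\<integral>x. indicator {0<..} x *\<^sub>R f x + indicator {..<0} x *\<^sub>R f x \<partial>lborel)"
  proof (rule integral_cong_AE)
    show "AE x in lborel. f x = indicator {0<..} x *\<^sub>R f x + indicator {..<0} x *\<^sub>R f x"
      using AE_lborel_singleton[of "0::real"] by eventually_elim (auto simp: indicator_def)
  qed (use assms i1 i2 in auto)
  also have "\<dots> = (\<integral>x. indicator {0<..} x *\<^sub>R f x \<partial>lborel) + (\<integral>x. indicator {..<0} x *\<^sub>R f x \<partial>lborel)"
    by (rule Bochner_Integration.integral_add[OF i1 i2])
  also have "(\<integral>x. indicator {..<0} x *\<^sub>R f x \<partial>lborel) = (\<integral>x. indicator {0<..} x *\<^sub>R f (- x) \<partial>lborel)"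
    by (subst lborel_integral_real_affine[of "-1" _ 0]) (auto simp: indicator_def)
  also have "(\<integral>x. indicator {0<..} x *\<^sub>R f x \<partial>lborel) + \<dots> =
      (\<integral>x. indicator {0<..} x *\<^sub>R (f x + f (- x)) \<partial>lborel)"
    by (subst Bochner_Integration.integral_add[OF i1 i3, symmetric]) (simp add: scaleR_add_right)
  finally show "(\<integral>x. f x \<partial>lborel) = (\<integral>x. indicator {0<..} x *\<^sub>R (f x + f (- x)) \<partial>lborel)" .
qed

text \<open>The reflection quotient is taken in its Hadamard form, which has no singularity at 0 and
  is a Schwartz family again; \<open>dunkl_op_eq\<close> recovers the usual formula away from
  0.\<close>

definition dunkl_op :: "real \<Rightarrow> ('i \<Rightarrow> real \<Rightarrow> complex) \<Rightarrow> 'i \<Rightarrow> real \<Rightarrow> complex" where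
  "dunkl_op k g i x = deriv_family g i x + of_real ((2 * k + 1) / 2) * hadamard 0 (deriv_family g) i x"

lemma schwartz_family_dunkl_op:
  assumes "schwartz_family g"
  shows "schwartz_family (dunkl_op k g)"
  unfolding dunkl_op_def[abs_def]
  by (intro schwartz_family_add schwartz_family_cmult schwartz_family_hadamard schwartz_family_deriv assms)

lemma dunkl_op_eq:
  assumes "schwartz_family g" "x \<noteq> 0"
  shows "dunkl_op k g i x = deriv_family g i x + of_real ((2 * k + 1) / (2 * x)) * (g i x - g i (- x))"
proof -
  have "of_real x * hadamard 0 (deriv_family g) i x = g i x - g i (- x)"
    using hadamard_parts[OF assms(1) schwartz_family_deriv(2)[OF assms(1)]
        schwartz_family_deriv(1)[OF assms(1)], of x 0 i] by simp
  then have "hadamard 0 (deriv_family g) i x = (g i x - g i (- x)) / of_real x"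
    using assms(2) by (simp add: field_simps)
  then show ?thesis by (simp add: dunkl_op_def)
qed

text \<open>T is skew-symmetric for the measure and E is an eigenfunction with eigenvalue i \<xi>.
  Concretely, \<open>\<psi>\<close> is the difference of the two integrands; multiplied by the
  density and folded onto the half line it is, up to a constant, the derivative of
  \<open>\<Phi>\<close>.\<close>

lemma dunkl_integration_by_parts:
  assumes k: "k \<ge> - 1 / 2" and g: "schwartz_family g"
  shows "(\<integral>x. dunkl_op k g i x * dunkl_exp k (\<xi> * x) \<partial>dunkl_measure k) =
    - \<i> * of_real \<xi> * (\<integral>x. g i x * dunkl_exp k (\<xi> * x) \<partial>dunkl_measure k)"
proof -
  let ?c = "2 powr (k + 1) * Gamma (k + 1)"
  have c: "?c > 0" using k by (auto intro!: mult_pos_pos Gamma_real_pos)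
  define p where "p = 2 * k + 1"
  have p: "p \<ge> 0" using k by (simp add: p_def)
  define E where "E x = dunkl_exp k (\<xi> * x)" for x
  define E' where "E' x = of_real \<xi> * dunkl_exp' k (\<xi> * x)" for x
  define \<psi> where "\<psi> x = dunkl_op k g i x * E x + \<i> * of_real \<xi> * (g i x * E x)" for x
  define H where "H x = g i x * E x - g i (- x) * E (- x)" for x
  define \<Phi> where "\<Phi> x = (x powr p) *\<^sub>R H x" for x
  define \<phi> where "\<phi> x = (x powr p) *\<^sub>R (\<psi> x + \<psi> (- x))" for x
  have gD: "schwartz_family (dunkl_op k g)" by (rule schwartz_family_dunkl_op[OF g])
  have contE: "continuous_on S (\<lambda>x. E (q x))" if "continuous_on S q" for S and q :: "real \<Rightarrow> real"
    unfolding E_def using that by (intro continuous_intros k)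
  have contg: "continuous_on S (\<lambda>x. g i (q x))" if "continuous_on S q" for S and q :: "real \<Rightarrow> real"
    by (rule continuous_on_compose2[OF schwartz_family_continuous[OF g, of UNIV] that]) auto
  have contD: "continuous_on S (\<lambda>x. dunkl_op k g i (q x))" if "continuous_on S q" for S and q :: "real \<Rightarrow> real"
    by (rule continuous_on_compose2[OF schwartz_family_continuous[OF gD, of UNIV] that]) auto
  have dE: "(E has_vector_derivative E' x) (at x)" for x
  proof -
    have "((\<lambda>x. \<xi> * x) has_vector_derivative \<xi>) (at x)"
      by (auto intro!: derivative_eq_intros simp flip: has_real_derivative_iff_has_vector_derivative)
    from vector_diff_chain_at[OF this has_vector_derivative_dunkl_exp[OF k]]
    show ?thesis by (simp add: comp_def E_def[abs_def] E'_def scaleR_conv_of_real)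
  qed
  have dg: "(g i has_vector_derivative deriv_family g i x) (at x)" for x
    by (rule schwartz_family_deriv(1)[OF g])
  have neg: "((\<lambda>x. f (- x)) has_vector_derivative - f' (- x)) (at x)"
    if "\<And>x. (f has_vector_derivative f' x) (at x)" for f f' :: "real \<Rightarrow> complex" and x
  proof -
    have "((\<lambda>x. - x :: real) has_vector_derivative - 1) (at x)"
      by (auto intro!: derivative_eq_intros simp flip: has_real_derivative_iff_has_vector_derivative)
    from vector_diff_chain_at[OF this that] show ?thesis by (simp add: comp_def)
  qed
  \<comment> \<open>The equation for \<open>dunkl_exp\<close>, rescaled by \<xi>. At \<xi> = 0 the
    rescaling would divide by 0, but then E is constant and both sides vanish.\<close>
  have eigE: "E' x = \<i> * of_real \<xi> * E x - of_real (p / (2 * x)) * (E x - E (- x))" if "x \<noteq> 0" for x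
  proof (cases "\<xi> = 0")
    case False
    have "dunkl_exp' k (\<xi> * x) = \<i> * dunkl_exp k (\<xi> * x) -
        of_real (p / (2 * (\<xi> * x))) * (dunkl_exp k (\<xi> * x) - dunkl_exp k (- (\<xi> * x)))"
      using dunkl_exp_eigen[of "\<xi> * x" k] that False unfolding p_def[symmetric] by (simp add: algebra_simps)
    then show ?thesis
      unfolding E'_def E_def using False that by (simp add: field_simps)
  qed (simp add: E'_def E_def)
  have d\<Phi>: "(\<Phi> has_vector_derivative \<phi> x) (at x)" if x: "x > 0" for x
  proof -
    have dH: "(H has_vector_derivative (g i x * E' x + deriv_family g i x * E x) -
        (g i (- x) * (- E' (- x)) + (- deriv_family g i (- x)) * E (- x))) (at x)"
      unfolding H_def[abs_def]
      by (intro has_vector_derivative_diff has_vector_derivative_mult neg dE dg)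
    have dp: "((\<lambda>x. x powr p) has_real_derivative p * x powr (p - 1)) (at x)"
      using x by (rule has_real_derivative_powr)
    have xp: "x powr (p - 1) = x powr p / x" using x by (simp add: powr_diff)
    have "(\<Phi> has_vector_derivative (x powr p) *\<^sub>R ((g i x * E' x + deriv_family g i x * E x) -
        (g i (- x) * (- E' (- x)) + (- deriv_family g i (- x)) * E (- x)))
        + (p * x powr (p - 1)) *\<^sub>R H x) (at x)"
      unfolding \<Phi>_def[abs_def] by (rule has_vector_derivative_scaleR[OF dp dH])
    moreover have "(x powr p) *\<^sub>R ((g i x * E' x + deriv_family g i x * E x) -
        (g i (- x) * (- E' (- x)) + (- deriv_family g i (- x)) * E (- x)))
        + (p * x powr (p - 1)) *\<^sub>R H x = \<phi> x"
    proof -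
      define q where "q = (of_real (p / (2 * x)) :: complex)"
      have q: "(of_real (p / x) :: complex) = 2 * q" "(of_real (p / (2 * - x)) :: complex) = - q"
        using x by (simp_all add: q_def)
      have e1: "E' x = \<i> * of_real \<xi> * E x - q * (E x - E (- x))"
        using eigE[of x] x by (simp add: q_def)
      have e2: "E' (- x) = \<i> * of_real \<xi> * E (- x) - q * (E x - E (- x))"
        using eigE[of "- x"] x unfolding q by (simp add: algebra_simps)
      have o1: "dunkl_op k g i x = deriv_family g i x + q * (g i x - g i (- x))"
        using dunkl_op_eq[OF g, of x k i] x by (simp add: q_def p_def)
      have o2: "dunkl_op k g i (- x) = deriv_family g i (- x) + q * (g i x - g i (- x))"
        using dunkl_op_eq[OF g, of "- x" k i] x unfolding p_def[symmetric] q by (simp add: algebra_simps)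
      have "(p * x powr (p - 1)) *\<^sub>R H x = (x powr p) *\<^sub>R (2 * q * H x)"
        unfolding xp q(1)[symmetric] by (simp add: scaleR_conv_of_real)
      then show ?thesis
        unfolding \<phi>_def \<psi>_def o1 o2 e1 e2 H_def
        by (simp only: scaleR_add_right[symmetric]) (simp add: algebra_simps)
    qed
    ultimately show ?thesis by simp
  qed
  have int\<psi>: "integrable (dunkl_measure k) \<psi>"
    unfolding \<psi>_def[abs_def] E_def
    by (intro Bochner_Integration.integrable_add integrable_mult_right integrable_schwartz_dunkl_exp k g gD)
  have meas\<psi>: "\<psi> \<in> borel_measurable borel"
    using int\<psi> by (auto dest: borel_measurable_integrable)
  have int': "integrable lborel (\<lambda>x. dunkl_density k x *\<^sub>R \<psi> x)"
    using int\<psi> integrable_dunkl_measure[OF k meas\<psi>] by simp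
  have eq\<phi>: "indicator {0<..} x *\<^sub>R (dunkl_density k x *\<^sub>R \<psi> x + dunkl_density k (- x) *\<^sub>R \<psi> (- x)) =
      (1 / ?c) *\<^sub>R (indicator {0<..} x *\<^sub>R \<phi> x)" for x
    by (auto simp: indicator_def dunkl_density_def \<phi>_def p_def scaleR_add_right divide_inverse mult.commute)
  have "integrable lborel (\<lambda>x. ?c *\<^sub>R (1 / ?c) *\<^sub>R (indicator {0<..} x *\<^sub>R \<phi> x))"
    using lborel_integral_symmetrize(1)[OF int'] unfolding eq\<phi> by (rule integrable_scaleR_right)
  then have set_int: "set_integrable lborel {0<..} \<phi>"
    using c by (simp add: set_integrable_def zero_less_mult_iff)
  have "(LBINT x=ereal 0..\<infinity>. \<phi> x) = 0 - 0"
  proof (rule interval_integral_FTC_integrable)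
    show "(\<Phi> has_vector_derivative \<phi> x) (at x)" if "ereal 0 < ereal x" for x
      using d\<Phi> that by simp
    have "continuous_on {0<..} \<phi>"
      unfolding \<phi>_def \<psi>_def by (intro continuous_intros contg contE contD) auto
    then show "isCont \<phi> x" if "ereal 0 < ereal x" for x
      using that by (simp add: continuous_on_eq_continuous_at)
    have "einterval (ereal 0) \<infinity> = {0<..}" by (auto simp: einterval_def)
    then show "set_integrable lborel (einterval (ereal 0) \<infinity>) \<phi>" using set_int by simp
    \<comment> \<open>For k = -1/2 the factor \<open>x powr p\<close> is 1, so the boundary value
      has to vanish by \<open>H 0 = 0\<close> and not by the weight.\<close>
    have "(\<Phi> \<longlongrightarrow> 0) (at_right 0)"
    proof (rule Lim_null_comparison)
      have H0: "H 0 = 0" by (simp add: H_def)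
      have "continuous_on UNIV H" unfolding H_def by (intro continuous_intros contg contE)
      then have "isCont H 0" by (simp add: continuous_on_eq_continuous_at)
      then have "(H \<longlongrightarrow> H 0) (at_right 0)"
        by (simp add: continuous_within tendsto_within_subset isCont_def filterlim_at_split)
      then show "((\<lambda>x. norm (H x)) \<longlongrightarrow> 0) (at_right 0)"
        using tendsto_norm_zero[of H] H0 by simp
      show "\<forall>\<^sub>F x in at_right 0. norm (\<Phi> x) \<le> norm (H x)"
      proof (rule eventually_at_rightI[of 0 1])
        fix x :: real assume "x \<in> {0<..<1}"
        then have "x powr p \<le> 1" using p by (intro powr_le1) auto
        then show "norm (\<Phi> x) \<le> norm (H x)"
          by (simp add: \<Phi>_def mult_left_le_one_le)
      qed simp
    qed
    then show "((\<Phi> \<circ> real_of_ereal) \<longlongrightarrow> 0) (at_right (ereal 0))"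
      by (simp add: ereal_tendsto_simps)
    \<comment> \<open>The power of x is at most 1 + x^n with n the ceiling of p; seminorms of g with
      one further power of x leave a multiple of 1/x.\<close>
    have "(\<Phi> \<longlongrightarrow> 0) at_top"
    proof -
      let ?n = "nat \<lceil>p\<rceil>"
      obtain C1 where C1: "\<And>i x. \<bar>x\<bar> ^ 1 * cmod (g i x) \<le> C1"
        using schwartz_family_bound[OF g] by blast
      obtain C2 where C2: "\<And>i x. \<bar>x\<bar> ^ Suc ?n * cmod (g i x) \<le> C2"
        using schwartz_family_bound[OF g] by blast
      have b: "norm (\<Phi> x) \<le> 2 * (C1 + C2) * inverse x" if "x > 0" for x
      proof -
        have h: "\<bar>x\<bar> * (1 + \<bar>x\<bar> ^ ?n) * cmod (g i y) \<le> C1 + C2" if "\<bar>y\<bar> = \<bar>x\<bar>" for y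
          using C1[of y i] C2[of y i] that by (simp add: algebra_simps)
        have "norm (H x) \<le> cmod (g i x) * 1 + cmod (g i (- x)) * 1"
          unfolding H_def E_def
          by (rule order_trans[OF norm_triangle_ineq4])
             (auto simp only: norm_mult intro!: add_mono mult_left_mono norm_dunkl_exp_le_1 k norm_ge_zero)
        then have "norm (\<Phi> x) \<le> (1 + \<bar>x\<bar> ^ ?n) * (cmod (g i x) + cmod (g i (- x)))"
          unfolding \<Phi>_def norm_scaleR
          using abs_powr_le_power[OF k, of x] that by (intro mult_mono) (auto simp: p_def)
        then have "\<bar>x\<bar> * norm (\<Phi> x) \<le> \<bar>x\<bar> * ((1 + \<bar>x\<bar> ^ ?n) * (cmod (g i x) + cmod (g i (- x))))"
          by (rule mult_left_mono) simp
        also have "\<dots> \<le> 2 * (C1 + C2)"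
          using h[of x] h[of "- x"] by (simp add: algebra_simps)
        finally show ?thesis using that by (simp add: field_simps)
      qed
      show ?thesis
      proof (rule Lim_null_comparison)
        show "\<forall>\<^sub>F x in at_top. norm (\<Phi> x) \<le> 2 * (C1 + C2) * inverse x"
          using eventually_gt_at_top[of 0] by eventually_elim (rule b)
        show "((\<lambda>x. 2 * (C1 + C2) * inverse x) \<longlongrightarrow> 0) at_top"
          by (intro tendsto_mult_right_zero tendsto_inverse_0_at_top filterlim_ident)
      qed
    qed
    then show "((\<Phi> \<circ> real_of_ereal) \<longlongrightarrow> 0) (at_left \<infinity>)"
      by (simp add: ereal_tendsto_simps)
  qed simp
  then have zero: "(\<integral>x. indicator {0<..} x *\<^sub>R \<phi> x \<partial>lborel) = 0"
    by (simp add: interval_lebesgue_integral_def set_lebesgue_integral_def einterval_def greaterThan_def)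
  have "(\<integral>x. \<psi> x \<partial>dunkl_measure k) = (\<integral>x. (1 / ?c) *\<^sub>R (indicator {0<..} x *\<^sub>R \<phi> x) \<partial>lborel)"
    unfolding integral_dunkl_measure[OF k meas\<psi>] lborel_integral_symmetrize(2)[OF int'] eq\<phi> ..
  also have "\<dots> = 0" unfolding integral_scaleR_right zero by simp
  finally have "(\<integral>x. \<psi> x \<partial>dunkl_measure k) = 0" .
  moreover have "(\<integral>x. \<psi> x \<partial>dunkl_measure k) = (\<integral>x. dunkl_op k g i x * E x \<partial>dunkl_measure k) +
      \<i> * of_real \<xi> * (\<integral>x. g i x * E x \<partial>dunkl_measure k)"
    unfolding \<psi>_def[abs_def] E_def
    using integrable_schwartz_dunkl_exp[OF k g] integrable_schwartz_dunkl_exp[OF k gD] by simp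
  ultimately show ?thesis
    unfolding E_def by (simp add: add_eq_0_iff)
qed

text \<open>Each application of T to g pays for one factor \<xi>. Since T g is again a family, the
  induction runs over all families at once.\<close>

lemma schwartz_family_transform_rapid_decay:
  assumes k: "k \<ge> - 1 / 2" and g: "schwartz_family g"
  shows "\<exists>C. \<forall>i \<xi>. \<bar>\<xi>\<bar> ^ l * cmod (\<integral>x. g i x * dunkl_exp k (\<xi> * x) \<partial>dunkl_measure k) \<le> C"
  using g
proof (induction l arbitrary: g)
  case 0
  then show ?case using schwartz_family_transform_bounded[OF k] by simp
next
  case (Suc l)
  have "\<bar>\<xi>\<bar> * cmod (\<integral>x. g i x * dunkl_exp k (\<xi> * x) \<partial>dunkl_measure k) =
      cmod (\<integral>x. dunkl_op k g i x * dunkl_exp k (\<xi> * x) \<partial>dunkl_measure k)" for i \<xi>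
    by (simp add: dunkl_integration_by_parts[OF k Suc.prems] norm_mult)
  then have "\<bar>\<xi>\<bar> ^ Suc l * cmod (\<integral>x. g i x * dunkl_exp k (\<xi> * x) \<partial>dunkl_measure k) =
      \<bar>\<xi>\<bar> ^ l * cmod (\<integral>x. dunkl_op k g i x * dunkl_exp k (\<xi> * x) \<partial>dunkl_measure k)" for i \<xi>
    by (simp only: power_Suc2 mult.assoc)
  then show ?case
    using Suc.IH[OF schwartz_family_dunkl_op[OF Suc.prems, of k]] by (simp only:)
qed

subsection \<open>Integrals against the Jacobi weight\<close>

lemma absolutely_integrable_on_borel_iff:
  fixes f :: "real \<Rightarrow> real"
  assumes "f \<in> borel_measurable borel" "S \<in> sets borel"
  shows "f absolutely_integrable_on S \<longleftrightarrow> integrable lborel (\<lambda>x. indicator S x *\<^sub>R f x)"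
  unfolding set_integrable_def using assms by (intro integrable_completion) auto

lemma integral_eq_lborel_integral:
  fixes f :: "real \<Rightarrow> real"
  assumes "integrable lborel (\<lambda>x. indicator S x *\<^sub>R f x)"
  shows "integral S f = (\<integral>x. indicator S x *\<^sub>R f x \<partial>lborel)"
  using set_borel_integral_eq_integral(2)[of S f] assms
  by (simp add: set_integrable_def set_lebesgue_integral_def)

lemma lborel_change_of_variables:
  fixes f g g' :: "real \<Rightarrow> real"
  assumes S: "S \<in> sets borel" and T: "T \<in> sets borel" "g ` S = T"
    and f: "f \<in> borel_measurable borel" and fg: "(\<lambda>t. \<bar>g' t\<bar> * f (g t)) \<in> borel_measurable borel"
    and der: "\<And>t. t \<in> S \<Longrightarrow> (g has_real_derivative g' t) (at t)"
    and inj: "inj_on g S"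
  shows "integrable lborel (\<lambda>t. indicator S t *\<^sub>R (\<bar>g' t\<bar> * f (g t))) \<longleftrightarrow>
      integrable lborel (\<lambda>x. indicator T x *\<^sub>R f x)"
    and "integrable lborel (\<lambda>x. indicator T x *\<^sub>R f x) \<Longrightarrow>
      (\<integral>t. indicator S t *\<^sub>R (\<bar>g' t\<bar> * f (g t)) \<partial>lborel) = (\<integral>x. indicator T x *\<^sub>R f x \<partial>lborel)"
proof -
  \<comment> \<open>The value \<open>b\<close> stays free; instantiated with an integral, the one
    equivalence yields integrability as well as equality.\<close>
  have cov: "(\<lambda>t. \<bar>g' t\<bar> * f (g t)) absolutely_integrable_on S \<and> integral S (\<lambda>t. \<bar>g' t\<bar> * f (g t)) = b
      \<longleftrightarrow> f absolutely_integrable_on T \<and> integral T f = b" for b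
    unfolding T(2)[symmetric]
    by (rule has_absolute_integral_change_of_variables_1')
       (use S der inj in \<open>auto intro: has_field_derivative_at_within\<close>)
  show iff: "integrable lborel (\<lambda>t. indicator S t *\<^sub>R (\<bar>g' t\<bar> * f (g t))) \<longleftrightarrow>
      integrable lborel (\<lambda>x. indicator T x *\<^sub>R f x)"
    using cov unfolding absolutely_integrable_on_borel_iff[OF fg S] absolutely_integrable_on_borel_iff[OF f T(1)]
    by blast
  assume int: "integrable lborel (\<lambda>x. indicator T x *\<^sub>R f x)"
  have "integral S (\<lambda>t. \<bar>g' t\<bar> * f (g t)) = integral T f"
    using cov[of "integral T f"] int absolutely_integrable_on_borel_iff[OF f T(1)] by blast
  then show "(\<integral>t. indicator S t *\<^sub>R (\<bar>g' t\<bar> * f (g t)) \<partial>lborel) = (\<integral>x. indicator T x *\<^sub>R f x \<partial>lborel)"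
    using integral_eq_lborel_integral[OF int] integral_eq_lborel_integral[of S "\<lambda>t. \<bar>g' t\<bar> * f (g t)"] int iff
    by simp
qed

definition jacobi_weight :: "real \<Rightarrow> real \<Rightarrow> real" where
  "jacobi_weight k t = (1 - t\<^sup>2) powr (k - 1 / 2)"

lemma borel_measurable_jacobi_weight [measurable]: "jacobi_weight k \<in> borel_measurable borel"
  unfolding jacobi_weight_def[abs_def] by measurable

lemma jacobi_weight_nonneg: "jacobi_weight k t \<ge> 0"
  by (simp add: jacobi_weight_def)

lemma jacobi_weight_minus: "jacobi_weight k (- t) = jacobi_weight k t"
  by (simp add: jacobi_weight_def)

text \<open>For k < 1/2 the weight is unbounded towards the endpoints. The substitution u = t^2 on
  (0, 1) turns half of the integral into half of Beta(1/2, k + 1/2), and reflection supplies the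
  other half.\<close>

lemma jacobi_weight_lborel:
  assumes k: "k > - 1 / 2"
  shows "integrable lborel (\<lambda>t. indicator {- 1..1} t *\<^sub>R jacobi_weight k t)"
    and "(\<integral>t. indicator {- 1..1} t *\<^sub>R jacobi_weight k t \<partial>lborel) = sqrt pi * Gamma (k + 1 / 2) / Gamma (k + 1)"
proof -
  let ?f = "\<lambda>u::real. u powr (1 / 2 - 1) * (1 - u) powr (k + 1 / 2 - 1)"
  let ?h = "\<lambda>t. indicator {0<..<1} t *\<^sub>R jacobi_weight k t"
  have k': "k + 1 / 2 > 0" using k by simp
  have int: "integrable lborel (\<lambda>u. indicator {0..1} u *\<^sub>R ?f u)"
    using integrable_Beta[of "1 / 2" "k + 1 / 2"] k' by (simp add: set_integrable_def)
  \<comment> \<open>Closed and open interval agree even pointwise, because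
    \<open>0 powr a = 0\<close>.\<close>
  have eq: "(\<lambda>u. indicator {0..1} u *\<^sub>R ?f u) = (\<lambda>u. indicator {0<..<1} u *\<^sub>R ?f u)"
    by (auto simp: fun_eq_iff indicator_def)
  have "(\<integral>u. indicator {0..1} u *\<^sub>R ?f u \<partial>lborel) = Beta (1 / 2) (k + 1 / 2)"
    using has_integral_Beta_real[of "1 / 2" "k + 1 / 2"] k' integral_eq_lborel_integral[OF int]
    by (simp add: integral_unique)
  then have val: "(\<integral>u. indicator {0<..<1} u *\<^sub>R ?f u \<partial>lborel) = Beta (1 / 2) (k + 1 / 2)"
    unfolding eq .
  have img: "(\<lambda>t::real. t\<^sup>2) ` {0<..<1} = {0<..<1}"
  proof safe
    fix u :: real assume "u \<in> {0<..<1}"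
    then show "u \<in> (\<lambda>t. t\<^sup>2) ` {0<..<1}"
      by (intro image_eqI[of _ _ "sqrt u"]) auto
  qed (auto simp: abs_square_less_1)
  have inj: "inj_on (\<lambda>t::real. t\<^sup>2) {0<..<1}"
    by (auto simp: inj_on_def)
  have pt: "indicator {0<..<1} t *\<^sub>R (\<bar>2 * t\<bar> * ?f (t\<^sup>2)) = 2 * ?h t" for t
  proof (cases "t \<in> {0<..<1}")
    case True
    then have "(t\<^sup>2) powr (- (1 / 2)) = inverse t"
      by (simp add: powr_minus powr_half_sqrt)
    then have "t * (t\<^sup>2) powr (- (1 / 2)) = 1" using True by simp
    then have "\<bar>2 * t\<bar> * ((t\<^sup>2) powr (- (1 / 2)) * (1 - t\<^sup>2) powr (k - 1 / 2)) = 2 * (1 - t\<^sup>2) powr (k - 1 / 2)"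
      using True by simp
    then show ?thesis using True by (simp add: jacobi_weight_def)
  qed simp
  note cov = lborel_change_of_variables[of "{0<..<1}" "{0<..<1}" "\<lambda>t. t\<^sup>2" ?f "\<lambda>t. 2 * t", OF _ _ img _ _ _ inj]
  have "integrable lborel (\<lambda>t. indicator {0<..<1} t *\<^sub>R (\<bar>2 * t\<bar> * ?f (t\<^sup>2)))"
    by (subst cov(1)) (use int eq in \<open>auto intro!: derivative_eq_intros\<close>)
  then have "integrable lborel (\<lambda>t. (1 / 2) * (2 * ?h t))"
    unfolding pt by (rule integrable_mult_right)
  then have hi: "integrable lborel ?h" by simp
  have "(\<integral>t. indicator {0<..<1} t *\<^sub>R (\<bar>2 * t\<bar> * ?f (t\<^sup>2)) \<partial>lborel) = Beta (1 / 2) (k + 1 / 2)"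
    by (subst cov(2)) (use int eq val in \<open>auto intro!: derivative_eq_intros\<close>)
  then have hv: "(\<integral>t. ?h t \<partial>lborel) = Beta (1 / 2) (k + 1 / 2) / 2"
    unfolding pt by simp
  have hi': "integrable lborel (\<lambda>t. ?h (- t))"
    using lborel_integrable_real_affine[OF hi, of "- 1" 0] by simp
  have hv': "(\<integral>t. ?h (- t) \<partial>lborel) = Beta (1 / 2) (k + 1 / 2) / 2"
    using lborel_integral_real_affine[of "- 1" ?h 0] hv by simp
  \<comment> \<open>Both halves are 0 at t = 0, hence equality only almost everywhere.\<close>
  have ae: "AE t in lborel. ?h t + ?h (- t) = indicator {- 1..1} t *\<^sub>R jacobi_weight k t"
    using AE_lborel_singleton[of "0::real"]
    by eventually_elim (auto simp: indicator_def jacobi_weight_def le_less)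
  have sum: "integrable lborel (\<lambda>t. ?h t + ?h (- t))"
    by (intro Bochner_Integration.integrable_add hi hi')
  show "integrable lborel (\<lambda>t. indicator {- 1..1} t *\<^sub>R jacobi_weight k t)"
    by (rule integrable_cong_AE_imp[OF sum _ ae]) measurable
  have "(\<integral>t. indicator {- 1..1} t *\<^sub>R jacobi_weight k t \<partial>lborel) = (\<integral>t. ?h t + ?h (- t) \<partial>lborel)"
    by (rule integral_cong_AE) (use ae in auto)
  also have "\<dots> = Beta (1 / 2) (k + 1 / 2)"
    by (subst Bochner_Integration.integral_add[OF hi hi']) (simp only: hv hv' field_sum_of_halves)
  also have "\<dots> = sqrt pi * Gamma (k + 1 / 2) / Gamma (k + 1)"
    by (simp add: Beta_def Gamma_one_half_real add.commute)
  finally show "(\<integral>t. indicator {- 1..1} t *\<^sub>R jacobi_weight k t \<partial>lborel) = sqrt pi * Gamma (k + 1 / 2) / Gamma (k + 1)" .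
qed

lemma borel_measurable_unit_continuous:
  fixes q :: "real \<Rightarrow> real"
  assumes "continuous_on {- 1..1} q"
  shows "q \<in> borel_measurable unit_interval_measure"
  unfolding unit_interval_measure_def
  by (subst measurable_cong_sets[OF sets_restrict_space_cong[OF sets_lborel] refl])
     (rule borel_measurable_continuous_on_restrict[OF assms])

lemma integrable_jacobi:
  fixes q :: "real \<Rightarrow> real"
  assumes k: "k > - 1 / 2" and q: "continuous_on {- 1..1} q"
  shows "integrable unit_interval_measure (\<lambda>t. jacobi_weight k t * q t)"
proof -
  have w: "integrable unit_interval_measure (jacobi_weight k)"
    unfolding unit_interval_measure_def
    by (subst integrable_restrict_space) (use jacobi_weight_lborel(1)[OF k] in auto)
  obtain K where K: "\<And>t. t \<in> {- 1..1} \<Longrightarrow> norm (q t) \<le> K"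
    using compact_imp_bounded[OF compact_continuous_image[OF q compact_Icc]]
    unfolding bounded_iff by fastforce
  have [measurable]: "q \<in> borel_measurable unit_interval_measure"
    "jacobi_weight k \<in> borel_measurable unit_interval_measure"
    using borel_measurable_unit_continuous[OF q] w by auto
  show ?thesis
  proof (rule Bochner_Integration.integrable_bound)
    show "integrable unit_interval_measure (\<lambda>t. jacobi_weight k t * K)"
      using w by simp
    show "AE t in unit_interval_measure. norm (jacobi_weight k t * q t) \<le> norm (jacobi_weight k t * K)"
    proof (rule AE_I2)
      fix t assume "t \<in> space unit_interval_measure"
      then have "\<bar>q t\<bar> \<le> \<bar>K\<bar>" using K[of t] by auto
      then show "norm (jacobi_weight k t * q t) \<le> norm (jacobi_weight k t * K)"
        by (simp add: abs_mult mult_left_mono)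
    qed
  qed measurable
qed

definition jacobi_integral :: "real \<Rightarrow> (real \<Rightarrow> real) \<Rightarrow> real" where
  "jacobi_integral k q = (\<integral>t. jacobi_weight k t * q t \<partial>unit_interval_measure)"

lemma jacobi_integral_lborel:
  "jacobi_integral k q = (\<integral>t. indicator {- 1..1} t *\<^sub>R (jacobi_weight k t * q t) \<partial>lborel)"
  unfolding jacobi_integral_def unit_interval_measure_def
  by (subst integral_restrict_space) auto

lemma jacobi_integral_minus: "jacobi_integral k (\<lambda>t. q (- t)) = jacobi_integral k q"
  unfolding jacobi_integral_lborel
  by (subst lborel_integral_real_affine[of "- 1" _ 0])
     (auto simp: jacobi_weight_minus indicator_def intro!: Bochner_Integration.integral_cong)

lemma jacobi_integral_add:
  assumes "k > - 1 / 2" "continuous_on {- 1..1} p" "continuous_on {- 1..1} q"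
  shows "jacobi_integral k (\<lambda>t. p t + q t) = jacobi_integral k p + jacobi_integral k q"
  unfolding jacobi_integral_def using integrable_jacobi[OF assms(1)] assms(2,3)
  by (simp add: distrib_left)

lemma jacobi_integral_diff:
  assumes "k > - 1 / 2" "continuous_on {- 1..1} p" "continuous_on {- 1..1} q"
  shows "jacobi_integral k (\<lambda>t. p t - q t) = jacobi_integral k p - jacobi_integral k q"
  unfolding jacobi_integral_def using integrable_jacobi[OF assms(1)] assms(2,3)
  by (simp add: right_diff_distrib)

lemma jacobi_integral_cmult: "jacobi_integral k (\<lambda>t. c * q t) = c * jacobi_integral k q"
  unfolding jacobi_integral_def by (simp add: mult.left_commute)

lemma jacobi_integral_one_plus:
  assumes k: "k > - 1 / 2"
  shows "jacobi_integral k (\<lambda>t. 1 + t) = sqrt pi * Gamma (k + 1 / 2) / Gamma (k + 1)"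
proof -
  have "jacobi_integral k (\<lambda>t. - t) = jacobi_integral k (\<lambda>t. t)"
    by (rule jacobi_integral_minus)
  then have "jacobi_integral k (\<lambda>t. t) = 0"
    using jacobi_integral_cmult[of k "- 1" "\<lambda>t. t"] by simp
  then have "jacobi_integral k (\<lambda>t. 1 + t) = jacobi_integral k (\<lambda>t. 1)"
    by (subst jacobi_integral_add[OF k]) (auto intro!: continuous_intros)
  also have "\<dots> = sqrt pi * Gamma (k + 1 / 2) / Gamma (k + 1)"
    unfolding jacobi_integral_lborel using jacobi_weight_lborel(2)[OF k] by simp
  finally show ?thesis .
qed

text \<open>The antiderivative \<open>(1 - t\<^sup>2) powr (k + 1 / 2) * q t\<close> vanishes at
  both ends since k > -1/2. When q depends on t through s, its derivative carries ds/dt = 2 x y, and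
  this x later cancels the 1/x of the reflection term.\<close>

lemma jacobi_integral_by_parts:
  assumes k: "k > - 1 / 2"
    and q: "\<And>t. (q has_real_derivative q' t) (at t)" and q': "continuous_on {- 1..1} q'"
  shows "(2 * k + 1) * jacobi_integral k (\<lambda>t. t * q t) = jacobi_integral k (\<lambda>t. q' t * (1 - t\<^sup>2))"
proof -
  have contq: "continuous_on {- 1..1} q"
    using q by (meson DERIV_isCont continuous_at_imp_continuous_on)
  let ?p = "\<lambda>t. q' t * (1 - t\<^sup>2) - (2 * k + 1) * (t * q t)"
  let ?\<Psi> = "\<lambda>t. (1 - t\<^sup>2) powr (k + 1 / 2) * q t"
  have contp: "continuous_on {- 1..1} ?p"
    by (intro continuous_intros q' contq)
  \<comment> \<open>The weight may blow up at the endpoints, so differentiability is used in the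
    interior only, with continuity up to the boundary.\<close>
  have "((\<lambda>t. jacobi_weight k t * ?p t) has_integral ?\<Psi> 1 - ?\<Psi> (- 1)) {- 1..1}"
  proof (rule fundamental_theorem_of_calculus_interior)
    show "continuous_on {- 1..1} ?\<Psi>"
      by (intro continuous_on_mult contq continuous_on_powr' continuous_intros)
         (use k in \<open>auto simp: abs_square_le_1\<close>)
    fix t :: real assume t: "t \<in> {- 1<..<1}"
    then have t2: "1 - t\<^sup>2 > 0"
      by (simp add: abs_square_less_1 abs_less_iff)
    have "((\<lambda>t. (1 - t\<^sup>2) powr (k + 1 / 2)) has_real_derivative
        (k + 1 / 2) * (1 - t\<^sup>2) powr (k + 1 / 2 - 1) * (- (2 * t))) (at t)"
      by (rule DERIV_chain2[where g = "\<lambda>t. 1 - t\<^sup>2", OF has_real_derivative_powr[OF t2]]) (auto intro!: derivative_eq_intros)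
    from DERIV_mult[OF this q]
    have "(?\<Psi> has_real_derivative (k + 1 / 2) * (1 - t\<^sup>2) powr (k + 1 / 2 - 1) * (- (2 * t)) * q t
        + q' t * (1 - t\<^sup>2) powr (k + 1 / 2)) (at t)"
      by (simp add: mult_ac)
    moreover have "(1 - t\<^sup>2) powr (k + 1 / 2) = (1 - t\<^sup>2) * jacobi_weight k t"
    proof -
      have "(1 - t\<^sup>2) powr (1 + (k - 1 / 2)) = (1 - t\<^sup>2) powr 1 * (1 - t\<^sup>2) powr (k - 1 / 2)"
        by (rule powr_add)
      moreover have "1 + (k - 1 / 2) = k + 1 / 2" by simp
      ultimately show ?thesis using t2 by (simp add: jacobi_weight_def)
    qed
    moreover have "(1 - t\<^sup>2) powr (k + 1 / 2 - 1) = jacobi_weight k t"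
      by (simp add: jacobi_weight_def)
    ultimately have "(?\<Psi> has_real_derivative jacobi_weight k t * ?p t) (at t)"
      by (simp add: algebra_simps)
    then show "(?\<Psi> has_vector_derivative jacobi_weight k t * ?p t) (at t)"
      by (simp add: has_real_derivative_iff_has_vector_derivative)
  qed simp
  then have "integral {- 1..1} (\<lambda>t. jacobi_weight k t * ?p t) = 0"
    by (simp add: integral_unique)
  moreover have "integrable lborel (\<lambda>t. indicator {- 1..1} t *\<^sub>R (jacobi_weight k t * ?p t))"
    using integrable_jacobi[OF k contp] unfolding unit_interval_measure_def
    by (subst (asm) integrable_restrict_space) auto
  ultimately have "jacobi_integral k ?p = 0"
    unfolding jacobi_integral_lborel using integral_eq_lborel_integral by metis
  then show ?thesis
    by (subst (asm) jacobi_integral_diff[OF k])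
       (auto intro!: continuous_intros contq q' simp: jacobi_integral_cmult)
qed

subsection \<open>The product formula in angular form\<close>

text \<open>A continuous \<open>f'\<close> is bounded on the product of [x - 1, x + 1] and [-1, 1],
  so a constant multiple of the weight dominates.\<close>

lemma has_real_derivative_jacobi_integral:
  fixes f f' :: "real \<Rightarrow> real \<Rightarrow> real"
  assumes k: "k > - 1 / 2"
    and der: "\<And>x t. ((\<lambda>x. f x t) has_real_derivative f' x t) (at x)"
    and cont: "\<And>x. continuous_on {- 1..1} (f x)"
    and cont': "continuous_on UNIV (\<lambda>(x, t). f' x t)"
  shows "((\<lambda>x. jacobi_integral k (f x)) has_real_derivative jacobi_integral k (f' x)) (at x)"
proof -
  let ?S = "{x - 1..x + 1} \<times> {- 1..1}"
  have "compact ((\<lambda>(x, t). f' x t) ` ?S)"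
    by (intro compact_continuous_image continuous_on_subset[OF cont'] compact_Times compact_Icc) auto
  then obtain K where K: "\<And>z t. z \<in> {x - 1..x + 1} \<Longrightarrow> t \<in> {- 1..1} \<Longrightarrow> norm (f' z t) \<le> K"
    unfolding compact_eq_bounded_closed bounded_iff by fastforce
  have cont'': "continuous_on {- 1..1} (f' z)" for z
  proof -
    have "continuous_on {- 1..1 :: real} (\<lambda>t. (z, t))"
      by (intro continuous_intros)
    from continuous_on_compose2[OF cont' this] show ?thesis by simp
  qed
  have "((\<lambda>x. jacobi_integral k (f x)) has_vector_derivative jacobi_integral k (f' x)) (at x)"
    unfolding jacobi_integral_def
  proof (rule has_vector_derivative_lebesgue_integral)
    show "integrable unit_interval_measure (\<lambda>t. jacobi_weight k t * f z t)" for z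
      by (rule integrable_jacobi[OF k cont])
    show "((\<lambda>z. jacobi_weight k t * f z t) has_vector_derivative jacobi_weight k t * f' z t) (at z)" for z t
      using DERIV_cmult[OF der] by (simp add: has_real_derivative_iff_has_vector_derivative)
    show "norm (jacobi_weight k t * f' z t) \<le> jacobi_weight k t * K"
      if "t \<in> space unit_interval_measure" "\<bar>z - x\<bar> < 1" for z t
      using K[of z t] that jacobi_weight_nonneg[of k t] by (auto simp: abs_mult abs_less_iff intro!: mult_left_mono)
    show "integrable unit_interval_measure (\<lambda>t. jacobi_weight k t * K)"
      by (rule integrable_jacobi[OF k]) (intro continuous_intros)
    show "(\<lambda>t. jacobi_weight k t * f' x t) \<in> borel_measurable unit_interval_measure"
      by (rule borel_measurable_integrable[OF integrable_jacobi[OF k cont'']])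
  qed
  then show ?thesis by (simp add: has_real_derivative_iff_has_vector_derivative)
qed

text \<open>Reciprocal of the value in \<open>jacobi_integral_one_plus\<close>; it normalises the
  weight \<open>(1 + t) * jacobi_weight k t\<close> to total mass 1.\<close>

definition dunkl_product_const :: "real \<Rightarrow> real" where
  "dunkl_product_const k = Gamma (k + 1) / (sqrt pi * Gamma (k + 1 / 2))"

text \<open>The right-hand side is, as a function of \<open>x\<close>, an eigenfunction of the Dunkl operator, so
  it is determined by its value at \<open>x = 0\<close>.\<close>

lemma dunkl_exp_product_jacobi:
  assumes k: "k > - 1 / 2"
  shows "dunkl_exp k x * dunkl_exp k y = of_real (dunkl_product_const k) * Complex
    (jacobi_integral k (\<lambda>t. dunkl_even k (x\<^sup>2 + y\<^sup>2 + 2 * x * y * t) * (1 + t)))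
    (jacobi_integral k (\<lambda>t. (x + y) * dunkl_odd k (x\<^sup>2 + y\<^sup>2 + 2 * x * y * t) * (1 + t)))"
proof -
  have k': "k \<ge> - 1 / 2" using k by simp
  define c where "c = dunkl_product_const k"
  define s where "s x t = x\<^sup>2 + y\<^sup>2 + 2 * x * y * t" for x t
  define A where "A x t = dunkl_even k (s x t)" for x t
  define B where "B x t = dunkl_odd k (s x t)" for x t
  define B' where "B' x t = dunkl_odd' k (s x t)" for x t
  define u where "u x t = A x t * (1 + t)" for x t
  define v where "v x t = (x + y) * B x t * (1 + t)" for x t
  define u' where "u' x t = - B x t * (x + y * t) * (1 + t)" for x t
  define v' where "v' x t = B x t * (1 + t) + 2 * (x + y) * (x + y * t) * B' x t * (1 + t)" for x t
  define F where "F x = of_real c * Complex (jacobi_integral k (u x)) (jacobi_integral k (v x))" for x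
  define F' where "F' x = of_real c * Complex (jacobi_integral k (u' x)) (jacobi_integral k (v' x))" for x
  have ds: "((\<lambda>x. s x t) has_real_derivative 2 * (x + y * t)) (at x)" for x t
    unfolding s_def by (auto intro!: derivative_eq_intros)
  have dst: "(s x has_real_derivative 2 * x * y) (at t)" for x t
    unfolding s_def[abs_def] by (auto intro!: derivative_eq_intros)
  have du: "((\<lambda>x. u x t) has_real_derivative u' x t) (at x)" for x t
  proof -
    have "((\<lambda>x. A x t) has_real_derivative - B x t / 2 * (2 * (x + y * t))) (at x)"
      unfolding A_def B_def by (rule DERIV_chain2[OF has_field_derivative_dunkl_even[OF k'] ds])
    from DERIV_mult[OF this DERIV_const[of "1 + t"]] show ?thesis
      unfolding u_def u'_def by (simp add: algebra_simps)
  qed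
  have dBx: "((\<lambda>x. B x t) has_real_derivative B' x t * (2 * (x + y * t))) (at x)" for x t
    unfolding B_def B'_def by (rule DERIV_chain2[OF has_field_derivative_dunkl_odd[OF k'] ds])
  have dv: "((\<lambda>x. v x t) has_real_derivative v' x t) (at x)" for x t
    unfolding v_def v'_def by (rule derivative_eq_intros dBx refl)+ (simp add: algebra_simps)
  have comp: "continuous_on T (\<lambda>p. A (f p) (g p))" "continuous_on T (\<lambda>p. B (f p) (g p))"
    "continuous_on T (\<lambda>p. B' (f p) (g p))"
    if "continuous_on T f" "continuous_on T g" for T :: "'b::topological_space set" and f g
  proof -
    have "continuous_on T (\<lambda>p. s (f p) (g p))"
      unfolding s_def by (intro continuous_intros that)
    then show "continuous_on T (\<lambda>p. A (f p) (g p))" "continuous_on T (\<lambda>p. B (f p) (g p))"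
      "continuous_on T (\<lambda>p. B' (f p) (g p))"
      unfolding A_def B_def B'_def
      by (auto intro!: continuous_on_compose2[OF continuous_on_dunkl_parts(1)[OF k', of UNIV]]
          continuous_on_compose2[OF continuous_on_dunkl_parts(2)[OF k', of UNIV]]
          continuous_on_compose2[OF continuous_on_dunkl_parts(3)[OF k', of UNIV]])
  qed
  note cont = continuous_intros comp
  have dF: "(F has_vector_derivative F' x) (at x)" for x
    unfolding F_def[abs_def] F'_def
  proof (intro has_vector_derivative_mult_right has_vector_derivative_Complex has_real_derivative_jacobi_integral k du dv)
    show "continuous_on {- 1..1} (u x)" "continuous_on {- 1..1} (v x)" for x
      unfolding u_def v_def by (intro cont)+
    show "continuous_on UNIV (\<lambda>(x, t). u' x t)" "continuous_on UNIV (\<lambda>(x, t). v' x t)"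
      unfolding u'_def v'_def case_prod_beta by (intro cont)+
  qed
  \<comment> \<open>Changing the sign of x and of t together fixes s, and the weight is even. So F(-
    x) is an integral over the same s in which 1 + t has become 1 - t.\<close>
  have sym: "s (- x) (- t) = s x t" for x t
    by (simp add: s_def)
  have eig: "F' x + of_real ((2 * k + 1) / (2 * x)) * (F x - F (- x)) = \<i> * of_real 1 * F x" if x: "x \<noteq> 0" for x
  proof -
    let ?I = "jacobi_integral k"
    have partsA: "(2 * k + 1) * ?I (\<lambda>t. t * A x t) = ?I (\<lambda>t. - x * y * (B x t * (1 - t\<^sup>2)))"
    proof -
      have "(A x has_real_derivative - B x t / 2 * (2 * x * y)) (at t)" for t
        unfolding A_def[abs_def] B_def by (rule DERIV_chain2[OF has_field_derivative_dunkl_even[OF k'] dst])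
      from jacobi_integral_by_parts[OF k this] show ?thesis
        by (simp add: cont mult_ac)
    qed
    have partsB: "(2 * k + 1) * ?I (\<lambda>t. t * B x t) = ?I (\<lambda>t. 2 * x * y * (B' x t * (1 - t\<^sup>2)))"
    proof -
      have "(B x has_real_derivative B' x t * (2 * x * y)) (at t)" for t
        unfolding B_def[abs_def] B'_def by (rule DERIV_chain2[OF has_field_derivative_dunkl_odd[OF k'] dst])
      from jacobi_integral_by_parts[OF k this] show ?thesis
        by (simp add: cont mult_ac)
    qed
    have um: "?I (u (- x)) = ?I (\<lambda>t. A x t * (1 - t))"
      using jacobi_integral_minus[of k "u (- x)"] by (simp add: u_def A_def sym)
    have vm: "?I (v (- x)) = ?I (\<lambda>t. (y - x) * B x t * (1 - t))"
      using jacobi_integral_minus[of k "v (- x)"] by (simp add: v_def B_def sym)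
    have "?I (u x) - ?I (u (- x)) = ?I (\<lambda>t. 2 * (t * A x t))"
      unfolding um u_def by (subst jacobi_integral_diff[OF k, symmetric]) (auto intro!: cont simp: algebra_simps)
    then have uu: "?I (u x) - ?I (u (- x)) = 2 * ?I (\<lambda>t. t * A x t)"
      by (simp only: jacobi_integral_cmult)
    \<comment> \<open>Here (x + y) (1 + t) - (y - x) (1 - t) = 2 x + 2 y t.\<close>
    have vv: "?I (v x) - ?I (v (- x)) = 2 * x * ?I (B x) + 2 * y * ?I (\<lambda>t. t * B x t)"
      unfolding vm v_def jacobi_integral_cmult[symmetric]
      by (subst jacobi_integral_diff[OF k, symmetric], (intro cont)+,
          subst jacobi_integral_add[OF k, symmetric], (intro cont)+)
         (simp add: algebra_simps)
    have "(2 * k + 1) / (2 * x) * (?I (u x) - ?I (u (- x))) = ?I (\<lambda>t. - y * (B x t * (1 - t\<^sup>2)))"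
    proof -
      have "(2 * k + 1) / (2 * x) * (?I (u x) - ?I (u (- x))) = ((2 * k + 1) * ?I (\<lambda>t. t * A x t)) / x"
        unfolding uu using x by (simp add: field_simps)
      also have "\<dots> = ?I (\<lambda>t. - y * (B x t * (1 - t\<^sup>2)))"
        unfolding partsA jacobi_integral_cmult using x by simp
      finally show ?thesis .
    qed
    then have "?I (u' x) + (2 * k + 1) / (2 * x) * (?I (u x) - ?I (u (- x))) =
        ?I (\<lambda>t. u' x t + - y * (B x t * (1 - t\<^sup>2)))"
      unfolding u'_def by (subst jacobi_integral_add[OF k]) (auto intro!: cont)
    \<comment> \<open>The integrands agree pointwise, by (x + y t) + y (1 - t) = x + y.\<close>
    also have "\<dots> = ?I (\<lambda>t. (- 1) * v x t)"
      by (intro arg_cong[of _ _ ?I] ext) (simp add: u'_def v_def algebra_simps power2_eq_square)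
    also have "\<dots> = - ?I (v x)" unfolding jacobi_integral_cmult by simp
    finally have re: "?I (u' x) + (2 * k + 1) / (2 * x) * (?I (u x) - ?I (u (- x))) = - ?I (v x)" .
    have c1: "continuous_on {- 1..1} (v' x)" and c2: "continuous_on {- 1..1} (\<lambda>t. (2 * k + 1) * B x t)"
      and c3: "continuous_on {- 1..1} (\<lambda>t. 2 * y\<^sup>2 * (B' x t * (1 - t\<^sup>2)))"
      and c4: "continuous_on {- 1..1} (u x)"
      and c5: "continuous_on {- 1..1} (\<lambda>t. 2 * x * y * (B' x t * (1 - t\<^sup>2)))"
      and c6: "continuous_on {- 1..1} (\<lambda>t. (2 * k + 1) * (t * B x t))"
      unfolding u_def v'_def by (intro cont)+
    have "(2 * k + 1) / (2 * x) * (?I (v x) - ?I (v (- x))) =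
        (2 * k + 1) * ?I (B x) + y / x * ((2 * k + 1) * ?I (\<lambda>t. t * B x t))"
      unfolding vv using x by (simp add: field_simps)
    also have "\<dots> = ?I (\<lambda>t. (2 * k + 1) * B x t) + ?I (\<lambda>t. 2 * y\<^sup>2 * (B' x t * (1 - t\<^sup>2)))"
      unfolding partsB jacobi_integral_cmult using x by (simp add: power2_eq_square)
    finally have "?I (v' x) + (2 * k + 1) / (2 * x) * (?I (v x) - ?I (v (- x))) =
        ?I (\<lambda>t. v' x t + ((2 * k + 1) * B x t + 2 * y\<^sup>2 * (B' x t * (1 - t\<^sup>2))))"
      by (simp only: jacobi_integral_add[OF k c1 continuous_on_add[OF c2 c3]] jacobi_integral_add[OF k c2 c3])
    \<comment> \<open>The equation for \<open>dunkl_odd\<close> expresses A by B and B'. The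
      integrand then differs from u by the bracket on the right, whose integral is 0 by
      \<open>partsB\<close>.\<close>
    also have "\<dots> = ?I (\<lambda>t. u x t + (2 * x * y * (B' x t * (1 - t\<^sup>2)) - (2 * k + 1) * (t * B x t)))"
    proof (intro arg_cong[of _ _ ?I] ext)
      fix t
      have ode: "A x t = 2 * s x t * B' x t + (2 * k + 2) * B x t"
        using dunkl_odd_ode[OF k', of "s x t"] by (simp add: A_def B_def B'_def)
      show "v' x t + ((2 * k + 1) * B x t + 2 * y\<^sup>2 * (B' x t * (1 - t\<^sup>2))) =
          u x t + (2 * x * y * (B' x t * (1 - t\<^sup>2)) - (2 * k + 1) * (t * B x t))"
        unfolding u_def v'_def ode s_def by (simp add: algebra_simps power2_eq_square)
    qed
    also have "\<dots> = ?I (u x) + (?I (\<lambda>t. 2 * x * y * (B' x t * (1 - t\<^sup>2))) - ?I (\<lambda>t. (2 * k + 1) * (t * B x t)))"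
      by (simp only: jacobi_integral_add[OF k c4 continuous_on_diff[OF c5 c6]] jacobi_integral_diff[OF k c5 c6])
    also have "\<dots> = ?I (u x)"
      using partsB unfolding jacobi_integral_cmult by simp
    finally have im: "?I (v' x) + (2 * k + 1) / (2 * x) * (?I (v x) - ?I (v (- x))) = ?I (u x)" .
    have "F' x + of_real q * (F x - F (- x)) =
        of_real c * Complex (?I (u' x) + q * (?I (u x) - ?I (u (- x)))) (?I (v' x) + q * (?I (v x) - ?I (v (- x))))" for q
      unfolding F_def F'_def complex_eq_iff by (simp add: algebra_simps)
    then have "F' x + of_real ((2 * k + 1) / (2 * x)) * (F x - F (- x)) =
        of_real c * Complex (?I (u' x) + (2 * k + 1) / (2 * x) * (?I (u x) - ?I (u (- x))))
          (?I (v' x) + (2 * k + 1) / (2 * x) * (?I (v x) - ?I (v (- x))))" .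
    also have "\<dots> = \<i> * of_real 1 * F x"
      unfolding re im F_def by (simp add: complex_eq_iff)
    finally show ?thesis .
  qed
  have "F x = dunkl_exp k x * dunkl_exp k y"
  proof (rule dunkl_eigenfunction_unique[OF k' dF _ eig])
    show "((\<lambda>x. dunkl_exp k x * dunkl_exp k y) has_vector_derivative dunkl_exp' k x * dunkl_exp k y) (at x)" for x
      by (intro has_vector_derivative_mult_left has_vector_derivative_dunkl_exp k')
    show "dunkl_exp' k x * dunkl_exp k y + of_real ((2 * k + 1) / (2 * x)) *
        (dunkl_exp k x * dunkl_exp k y - dunkl_exp k (- x) * dunkl_exp k y) =
        \<i> * of_real 1 * (dunkl_exp k x * dunkl_exp k y)" if "x \<noteq> 0" for x
    proof -
      have "(dunkl_exp' k x + of_real ((2 * k + 1) / (2 * x)) * (dunkl_exp k x - dunkl_exp k (- x))) * dunkl_exp k y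
          = \<i> * dunkl_exp k x * dunkl_exp k y"
        unfolding dunkl_exp_eigen[OF that] ..
      then show ?thesis by (simp only: left_diff_distrib[symmetric] distrib_right mult.assoc of_real_1 mult_1_left)
    qed
    have G: "Gamma (k + 1) > 0" "Gamma (k + 1 / 2) > 0"
      using k by (auto intro!: Gamma_real_pos)
    have c1: "c * jacobi_integral k (\<lambda>t. 1 + t) = 1"
      unfolding jacobi_integral_one_plus[OF k] c_def dunkl_product_const_def using G by simp
    \<comment> \<open>At x = 0 the argument s is y^2 for every t, so only the total mass
      enters.\<close>
    have "u 0 = (\<lambda>t. dunkl_even k (y\<^sup>2) * (1 + t))" "v 0 = (\<lambda>t. (y * dunkl_odd k (y\<^sup>2)) * (1 + t))"
      by (auto simp: u_def v_def A_def B_def s_def)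
    then have "F 0 = of_real (c * jacobi_integral k (\<lambda>t. 1 + t)) * dunkl_exp k y"
      unfolding F_def by (simp only: jacobi_integral_cmult) (simp add: complex_eq_iff dunkl_exp_def)
    then show "F 0 = dunkl_exp k 0 * dunkl_exp k y"
      unfolding c1 by (simp add: dunkl_exp_0)
  qed
  then show ?thesis
    unfolding F_def u_def v_def A_def B_def s_def c_def by simp
qed

text \<open>At k = -1/2 the reflection term drops out and E' = i E, so this is the addition theorem
  of the ordinary exponential: the product formula with the Dirac measure at x + y.\<close>

lemma dunkl_exp_add:
  assumes "k = - 1 / 2"
  shows "dunkl_exp k (x + y) = dunkl_exp k x * dunkl_exp k y"
proof -
  have k: "k \<ge> - 1 / 2" using assms by simp
  have eq: "dunkl_exp' k x = \<i> * dunkl_exp k x" for x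
    using assms by (simp add: dunkl_exp_def dunkl_exp'_def complex_eq_iff)
  show ?thesis
  proof (rule dunkl_eigenfunction_unique[OF k, where c = 1 and \<phi> = "\<lambda>x. dunkl_exp k (x + y)"])
    show "((\<lambda>x. dunkl_exp k x * dunkl_exp k y) has_vector_derivative dunkl_exp' k x * dunkl_exp k y) (at x)" for x
      by (intro has_vector_derivative_mult_left has_vector_derivative_dunkl_exp k)
    show "((\<lambda>x. dunkl_exp k (x + y)) has_vector_derivative dunkl_exp' k (x + y)) (at x)" for x
    proof -
      have "((\<lambda>x. x + y) has_vector_derivative 1) (at x)"
        by (auto intro!: derivative_eq_intros simp flip: has_real_derivative_iff_has_vector_derivative)
      from vector_diff_chain_at[OF this has_vector_derivative_dunkl_exp[OF k]]
      show ?thesis by (simp add: comp_def)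
    qed
  qed (simp_all add: eq dunkl_exp_0, simp_all add: assms)
qed

subsection \<open>The product formula with the kernel W\<close>

text \<open>Law of cosines: \<open>sqrt s\<close> is the third side of a triangle with sides |x| and
  |y| whose enclosed angle has cosine t up to sign. The last identity is Heron's formula for sixteen
  times the squared area.\<close>

lemma dunkl_triangle_sqrt:
  fixes x y t :: real
  assumes xy: "x \<noteq> 0" "y \<noteq> 0" and t: "t \<in> {- 1<..<1}"
  defines "s \<equiv> x\<^sup>2 + y\<^sup>2 + 2 * x * y * t"
  shows "s > 0" "\<bar>\<bar>x\<bar> - \<bar>y\<bar>\<bar> < sqrt s" "sqrt s < \<bar>x\<bar> + \<bar>y\<bar>"
    and "((\<bar>x\<bar> + \<bar>y\<bar>)\<^sup>2 - s) * (s - (\<bar>x\<bar> - \<bar>y\<bar>)\<^sup>2) = (2 * \<bar>x * y\<bar>)\<^sup>2 * (1 - t\<^sup>2)"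
proof -
  have "\<bar>x * y * t\<bar> < \<bar>x * y\<bar>"
    unfolding abs_mult[of "x * y" t] using xy t by (auto intro!: mult_strict_left_mono[of _ 1, simplified])
  then have t': "- \<bar>x * y\<bar> < x * y * t" "x * y * t < \<bar>x * y\<bar>" by auto
  have m: "(\<bar>x\<bar> - \<bar>y\<bar>)\<^sup>2 = x\<^sup>2 + y\<^sup>2 - 2 * \<bar>x * y\<bar>" and p: "(\<bar>x\<bar> + \<bar>y\<bar>)\<^sup>2 = x\<^sup>2 + y\<^sup>2 + 2 * \<bar>x * y\<bar>"
    by (simp_all add: power2_sum power2_diff abs_mult)
  have lt: "(\<bar>x\<bar> - \<bar>y\<bar>)\<^sup>2 < s" "s < (\<bar>x\<bar> + \<bar>y\<bar>)\<^sup>2"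
    unfolding m p s_def using t' by (simp_all add: mult_ac)
  show "s > 0" using lt(1) by (rule le_less_trans[rotated]) simp
  show "\<bar>\<bar>x\<bar> - \<bar>y\<bar>\<bar> < sqrt s"
    using real_sqrt_less_mono[OF lt(1)] by simp
  show "sqrt s < \<bar>x\<bar> + \<bar>y\<bar>"
    using real_sqrt_less_mono[OF lt(2)] by simp
  have "((\<bar>x\<bar> + \<bar>y\<bar>)\<^sup>2 - s) * (s - (\<bar>x\<bar> - \<bar>y\<bar>)\<^sup>2) =
      (2 * \<bar>x * y\<bar>)\<^sup>2 - (2 * (x * y * t))\<^sup>2"
    unfolding m p s_def by (simp add: power2_eq_square algebra_simps)
  also have "\<dots> = (2 * \<bar>x * y\<bar>)\<^sup>2 * (1 - t\<^sup>2)"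
    by (simp add: power_mult_distrib algebra_simps)
  finally show "((\<bar>x\<bar> + \<bar>y\<bar>)\<^sup>2 - s) * (s - (\<bar>x\<bar> - \<bar>y\<bar>)\<^sup>2) = (2 * \<bar>x * y\<bar>)\<^sup>2 * (1 - t\<^sup>2)" .
qed

lemma dunkl_triangle_image:
  fixes x y :: real
  assumes xy: "x \<noteq> 0" "y \<noteq> 0"
  shows "(\<lambda>t. sqrt (x\<^sup>2 + y\<^sup>2 + 2 * x * y * t)) ` {- 1<..<1} = {\<bar>\<bar>x\<bar> - \<bar>y\<bar>\<bar><..<\<bar>x\<bar> + \<bar>y\<bar>}"
proof (intro equalityI subsetI)
  fix z assume "z \<in> (\<lambda>t. sqrt (x\<^sup>2 + y\<^sup>2 + 2 * x * y * t)) ` {- 1<..<1}"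
  then show "z \<in> {\<bar>\<bar>x\<bar> - \<bar>y\<bar>\<bar><..<\<bar>x\<bar> + \<bar>y\<bar>}"
    using dunkl_triangle_sqrt(2,3)[OF xy] by auto
next
  fix z assume z: "z \<in> {\<bar>\<bar>x\<bar> - \<bar>y\<bar>\<bar><..<\<bar>x\<bar> + \<bar>y\<bar>}"
  then have z0: "z > 0" by auto
  define t where "t = (z\<^sup>2 - x\<^sup>2 - y\<^sup>2) / (2 * (x * y))"
  have m: "(\<bar>x\<bar> - \<bar>y\<bar>)\<^sup>2 = x\<^sup>2 + y\<^sup>2 - 2 * \<bar>x * y\<bar>" and p: "(\<bar>x\<bar> + \<bar>y\<bar>)\<^sup>2 = x\<^sup>2 + y\<^sup>2 + 2 * \<bar>x * y\<bar>"
    by (simp_all add: power2_sum power2_diff abs_mult)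
  have "(\<bar>\<bar>x\<bar> - \<bar>y\<bar>\<bar>)\<^sup>2 < z\<^sup>2" "z\<^sup>2 < (\<bar>x\<bar> + \<bar>y\<bar>)\<^sup>2"
    using z z0 by (intro power_strict_mono; simp)+
  then have "\<bar>z\<^sup>2 - x\<^sup>2 - y\<^sup>2\<bar> < 2 * \<bar>x * y\<bar>"
    unfolding power2_abs m p by linarith
  then have "\<bar>t\<bar> < 1"
    unfolding t_def abs_divide using xy by (simp add: abs_mult)
  moreover have "x\<^sup>2 + y\<^sup>2 + 2 * x * y * t = z\<^sup>2"
    unfolding t_def using xy by (simp add: field_simps)
  ultimately show "z \<in> (\<lambda>t. sqrt (x\<^sup>2 + y\<^sup>2 + 2 * x * y * t)) ` {- 1<..<1}"
    using z0 by (intro image_eqI[of _ _ t]) auto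
qed

text \<open>The Jacobian is dz/dt = x y / z. All powers of z and of |x y| cancel, and the powers of
  2 collapse to 1/2; the missing half is made up by the negative z.\<close>

lemma dunkl_Delta_density_jacobi:
  fixes x y t :: real
  assumes k: "k > - 1 / 2" and xy: "x \<noteq> 0" "y \<noteq> 0" and t: "t \<in> {- 1<..<1}"
  defines "z \<equiv> sqrt (x\<^sup>2 + y\<^sup>2 + 2 * x * y * t)"
  shows "\<bar>x * y / z\<bar> * (dunkl_density k z * dunkl_Delta k \<bar>x\<bar> \<bar>y\<bar> \<bar>z\<bar>) =
    dunkl_product_const k / 2 * jacobi_weight k t"
proof -
  note tri = dunkl_triangle_sqrt[OF xy t, folded z_def]
  have z: "z > 0" using tri(1) by (simp add: z_def)
  have z2: "z\<^sup>2 = x\<^sup>2 + y\<^sup>2 + 2 * x * y * t" using tri(1) by (simp add: z_def)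
  define p where "p = \<bar>x * y\<bar>"
  have p: "p > 0" using xy by (simp add: p_def)
  define G where "G = Gamma (k + 1)"
  have G: "G > 0" using k by (auto simp: G_def intro!: Gamma_real_pos)
  define H where "H = sqrt pi * Gamma (k + 1 / 2)"
  have H: "H > 0" using k by (auto simp: H_def intro!: mult_pos_pos Gamma_real_pos)
  have t2: "1 - t\<^sup>2 \<ge> 0" using t by (simp add: abs_square_le_1 abs_le_iff)
  have D: "(((\<bar>x\<bar> + \<bar>y\<bar>)\<^sup>2 - z\<^sup>2) * (z\<^sup>2 - (\<bar>x\<bar> - \<bar>y\<bar>)\<^sup>2)) powr (k - 1 / 2) =
      (2 powr (2 * k - 1) * p powr (2 * k - 1)) * jacobi_weight k t"
  proof -
    have "((2 * p)\<^sup>2) powr (k - 1 / 2) = ((2 * p) powr 2) powr (k - 1 / 2)"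
      using p by simp
    also have "\<dots> = (2 * p) powr (2 * k - 1)"
      unfolding powr_powr by (simp add: algebra_simps)
    also have "\<dots> = 2 powr (2 * k - 1) * p powr (2 * k - 1)"
      using p by (simp add: powr_mult)
    finally show ?thesis
      unfolding z2 tri(4) p_def[symmetric] jacobi_weight_def using t2 by (simp add: powr_mult)
  qed
  have Delta: "dunkl_Delta k \<bar>x\<bar> \<bar>y\<bar> \<bar>z\<bar> = 2 powr (1 - k) * G\<^sup>2 / H *
      ((2 powr (2 * k - 1) * p powr (2 * k - 1)) * jacobi_weight k t) / (p powr (2 * k) * z powr (2 * k))"
  proof -
    have "\<bar>\<bar>x\<bar> * \<bar>y\<bar> * \<bar>z\<bar>\<bar> powr (2 * k) = p powr (2 * k) * z powr (2 * k)"
      using z p by (simp add: p_def abs_mult powr_mult)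
    then show ?thesis
      unfolding dunkl_Delta_def using tri(2,3) z D by (simp add: G_def H_def)
  qed
  have dens: "dunkl_density k z = z powr (2 * k + 1) / (2 powr (k + 1) * G)"
    using z by (simp add: dunkl_density_def G_def)
  have e1: "p powr (2 * k) = p * p powr (2 * k - 1)"
    using p powr_add[of p 1 "2 * k - 1"] by simp
  have e2: "z powr (2 * k + 1) = z * z powr (2 * k)"
    using z powr_add[of z "2 * k" 1] by simp
  have e3: "2 powr (k + 1) = 2 powr (1 - k) * 2 powr (2 * k - 1) * (2 :: real)"
    using powr_add[of 2 "1 - k" "2 * k - 1"] powr_add[of 2 k 1] by simp
  have xyz: "\<bar>x * y / z\<bar> = p / z" using z by (simp add: p_def)
  have pos: "p powr (2 * k - 1) > 0" "z powr (2 * k) > 0" "2 powr (1 - k) > (0::real)" "2 powr (2 * k - 1) > (0::real)"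
    using p z by auto
  have const: "dunkl_product_const k = G / H" by (simp add: dunkl_product_const_def G_def H_def)
  \<comment> \<open>With the powers as atoms the claim is an identity of rational
    expressions.\<close>
  define P Z T1 T2 J where "P = p powr (2 * k - 1)" and "Z = z powr (2 * k)"
    and "T1 = 2 powr (1 - k)" and "T2 = 2 powr (2 * k - 1)" and "J = jacobi_weight k t"
  show ?thesis
    unfolding xyz dens Delta e1 e2 e3 const
    unfolding P_def[symmetric] Z_def[symmetric] T1_def[symmetric] T2_def[symmetric] J_def[symmetric]
    using pos[folded P_def Z_def T1_def T2_def] p z G H by (simp add: field_simps power2_eq_square)
qed

lemma borel_measurable_dunkl_Delta [measurable]:
  "(\<lambda>z. dunkl_Delta k u v z) \<in> borel_measurable borel"
  unfolding dunkl_Delta_def by measurable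

lemma dunkl_Delta_nonneg: "k > - 1 / 2 \<Longrightarrow> dunkl_Delta k u v w \<ge> 0"
  unfolding dunkl_Delta_def by (auto intro!: divide_nonneg_nonneg mult_nonneg_nonneg Gamma_real_nonneg)

text \<open>Transfers integrals over z > 0 to the angular variable. The pair q, r allows the even
  and the odd part of the product formula to be treated alike.\<close>

lemma dunkl_Delta_integral:
  fixes q r :: "real \<Rightarrow> real"
  assumes k: "k > - 1 / 2" and xy: "x \<noteq> 0" "y \<noteq> 0"
    and q: "q \<in> borel_measurable borel" and r: "continuous_on {- 1..1} r"
    and qr: "\<And>t. t \<in> {- 1<..<1} \<Longrightarrow> q (sqrt (x\<^sup>2 + y\<^sup>2 + 2 * x * y * t)) = r t"
  shows "integrable lborel (\<lambda>z. indicator {0<..} z *\<^sub>R (dunkl_density k z * dunkl_Delta k \<bar>x\<bar> \<bar>y\<bar> \<bar>z\<bar> * q z))"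
    and "(\<integral>z. indicator {0<..} z *\<^sub>R (dunkl_density k z * dunkl_Delta k \<bar>x\<bar> \<bar>y\<bar> \<bar>z\<bar> * q z) \<partial>lborel) =
      dunkl_product_const k / 2 * jacobi_integral k r"
proof -
  note [measurable] = q
  let ?S = "{- 1<..<1 :: real}" and ?T = "{\<bar>\<bar>x\<bar> - \<bar>y\<bar>\<bar><..<\<bar>x\<bar> + \<bar>y\<bar>}"
  let ?g = "\<lambda>t. sqrt (x\<^sup>2 + y\<^sup>2 + 2 * x * y * t)"
  let ?g' = "\<lambda>t. x * y / ?g t"
  define f where "f z = dunkl_density k z * dunkl_Delta k \<bar>x\<bar> \<bar>y\<bar> \<bar>z\<bar> * q z" for z
  have f [measurable]: "f \<in> borel_measurable borel"
    unfolding f_def[abs_def] by measurable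
  have der: "(?g has_real_derivative ?g' t) (at t)" if "t \<in> ?S" for t
    using dunkl_triangle_sqrt(1)[OF xy that]
    by (auto intro!: derivative_eq_intros simp: field_simps)
  have inj: "inj_on ?g ?S"
    using xy by (auto simp: inj_on_def)
  note cov = lborel_change_of_variables[of ?S ?T ?g f ?g', OF _ _ dunkl_triangle_image[OF xy] f _ der inj]
  \<comment> \<open>\<open>dunkl_Delta\<close> is 0 where the triangle inequalities fail, so the
    half line shrinks to the image interval.\<close>
  have T: "indicator {0<..} z *\<^sub>R f z = indicator ?T z *\<^sub>R f z" for z
    by (auto simp: indicator_def f_def dunkl_Delta_def)
  have S: "indicator ?S t *\<^sub>R (\<bar>?g' t\<bar> * f (?g t)) =
      dunkl_product_const k / 2 * (indicator {- 1..1} t *\<^sub>R (jacobi_weight k t * r t))" for t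
  proof (cases "t \<in> ?S")
    case True
    have "\<bar>?g' t\<bar> * f (?g t) = dunkl_product_const k / 2 * jacobi_weight k t * r t"
      unfolding f_def qr[OF True] dunkl_Delta_density_jacobi[OF k xy True, symmetric] by simp
    then show ?thesis using True by simp
  next
    case False
    \<comment> \<open>At the endpoints the weight is \<open>0 powr (k - 1 / 2)\<close>, which is
      0.\<close>
    then have "t = 1 \<or> t = - 1 \<or> t \<notin> {- 1..1}" by auto
    then have "indicator {- 1..1} t *\<^sub>R (jacobi_weight k t * r t) = 0"
      by (auto simp: jacobi_weight_def)
    then show ?thesis using False by simp
  qed
  have "integrable lborel (\<lambda>t. indicator {- 1..1} t *\<^sub>R (jacobi_weight k t * r t))"
    using integrable_jacobi[OF k r] unfolding unit_interval_measure_def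
    by (subst (asm) integrable_restrict_space) auto
  then have "integrable lborel (\<lambda>t. indicator ?S t *\<^sub>R (\<bar>?g' t\<bar> * f (?g t)))"
    unfolding S by (rule integrable_mult_right)
  then have int: "integrable lborel (\<lambda>z. indicator ?T z *\<^sub>R f z)"
    by (subst (asm) cov(1)) auto
  then show "integrable lborel (\<lambda>z. indicator {0<..} z *\<^sub>R (dunkl_density k z * dunkl_Delta k \<bar>x\<bar> \<bar>y\<bar> \<bar>z\<bar> * q z))"
    unfolding f_def[symmetric] T .
  have "(\<integral>z. indicator ?T z *\<^sub>R f z \<partial>lborel) = (\<integral>t. indicator ?S t *\<^sub>R (\<bar>?g' t\<bar> * f (?g t)) \<partial>lborel)"
    by (subst cov(2)) (use int in auto)
  also have "\<dots> = dunkl_product_const k / 2 * jacobi_integral k r"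
    unfolding S jacobi_integral_lborel by simp
  finally show "(\<integral>z. indicator {0<..} z *\<^sub>R (dunkl_density k z * dunkl_Delta k \<bar>x\<bar> \<bar>y\<bar> \<bar>z\<bar> * q z) \<partial>lborel) =
      dunkl_product_const k / 2 * jacobi_integral k r"
    unfolding f_def[symmetric] T .
qed

lemma borel_measurable_dunkl_W [measurable]:
  "(\<lambda>z. dunkl_W k x y z) \<in> borel_measurable borel"
  unfolding dunkl_W_def dunkl_sigma_def by measurable

text \<open>Up to sign, \<open>dunkl_sigma u v w\<close> is the cosine of an angle of the triangle with side lengths
  \<open>\<bar>u\<bar>\<close>, \<open>\<bar>v\<bar>\<close>, \<open>\<bar>w\<bar>\<close>.\<close>

lemma abs_dunkl_sigma_le_1:
  assumes "\<bar>w\<bar> \<le> \<bar>u\<bar> + \<bar>v\<bar>" "\<bar>u\<bar> \<le> \<bar>v\<bar> + \<bar>w\<bar>" "\<bar>v\<bar> \<le> \<bar>u\<bar> + \<bar>w\<bar>"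
  shows "\<bar>dunkl_sigma u v w\<bar> \<le> 1"
proof (cases "u \<noteq> 0 \<and> v \<noteq> 0")
  case True
  have "w\<^sup>2 \<le> (\<bar>u\<bar> + \<bar>v\<bar>)\<^sup>2"
    using power_mono[OF assms(1), of 2] by simp
  moreover have "(\<bar>u\<bar> - \<bar>v\<bar>)\<^sup>2 \<le> w\<^sup>2"
    unfolding abs_le_square_iff[symmetric] using assms(2,3) by linarith
  ultimately have "\<bar>u\<^sup>2 + v\<^sup>2 - w\<^sup>2\<bar> \<le> \<bar>2 * u * v\<bar>"
    by (simp add: power2_sum power2_diff abs_mult)
  then show ?thesis
    using True by (simp add: dunkl_sigma_def abs_divide)
qed (auto simp: dunkl_sigma_def)

text \<open>W takes negative values: at x = y = 1, z = -1 its bracket is -1/2. The modulus is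
  controlled because inside the triangle the bracket consists of four terms of modulus at most
  1.\<close>

lemma abs_dunkl_W_le:
  assumes "k > - 1 / 2"
  shows "\<bar>dunkl_W k x y z\<bar> \<le> 4 * dunkl_Delta k \<bar>x\<bar> \<bar>y\<bar> \<bar>z\<bar>"
proof (cases "\<bar>\<bar>x\<bar> - \<bar>y\<bar>\<bar> < \<bar>z\<bar> \<and> \<bar>z\<bar> < \<bar>x\<bar> + \<bar>y\<bar>")
  case True
  then have "\<bar>dunkl_sigma x y z\<bar> \<le> 1" "\<bar>dunkl_sigma z x y\<bar> \<le> 1" "\<bar>dunkl_sigma z y x\<bar> \<le> 1"
    by (intro abs_dunkl_sigma_le_1; linarith)+
  then have "\<bar>1 - dunkl_sigma x y z + dunkl_sigma z x y + dunkl_sigma z y x\<bar> \<le> 4" by linarith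
  then show ?thesis
    unfolding dunkl_W_def abs_mult using dunkl_Delta_nonneg[OF assms, of "\<bar>x\<bar>" "\<bar>y\<bar>" "\<bar>z\<bar>"]
    by (simp add: mult_right_mono)
qed (auto simp: dunkl_W_def dunkl_Delta_def)

lemma integrable_dunkl_W:
  assumes k: "k > - 1 / 2" and xy: "x \<noteq> 0" "y \<noteq> 0"
  shows "integrable (dunkl_measure k) (dunkl_W k x y)"
proof -
  have k': "k \<ge> - 1 / 2" using k by simp
  let ?h = "\<lambda>z. dunkl_density k z * dunkl_Delta k \<bar>x\<bar> \<bar>y\<bar> \<bar>z\<bar>"
  have i1: "integrable lborel (\<lambda>z. indicator {0<..} z *\<^sub>R ?h z)"
    using dunkl_Delta_integral(1)[OF k xy, of "\<lambda>_. 1" "\<lambda>_. 1"] by simp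
  have i2: "integrable lborel (\<lambda>z. indicator {0<..} (- z) *\<^sub>R ?h (- z))"
    using lborel_integrable_real_affine[OF i1, of "- 1" 0] by simp
  \<comment> \<open>At z = 0 both indicators vanish, and so does \<open>dunkl_Delta\<close>.\<close>
  have "?h z = indicator {0<..} z *\<^sub>R ?h z + indicator {0<..} (- z) *\<^sub>R ?h (- z)" for z
    by (cases z "0::real" rule: linorder_cases) (auto simp: dunkl_density_minus dunkl_Delta_def)
  then have "integrable lborel ?h"
    using Bochner_Integration.integrable_add[OF i1 i2] by (simp only:)
  then have "integrable lborel (\<lambda>z. 4 * ?h z)" by simp
  then have "integrable lborel (\<lambda>z. dunkl_density k z *\<^sub>R dunkl_W k x y z)"
  proof (rule Bochner_Integration.integrable_bound)
    show "AE z in lborel. norm (dunkl_density k z *\<^sub>R dunkl_W k x y z) \<le> norm (4 * ?h z)"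
    proof (rule AE_I2)
      fix z
      show "norm (dunkl_density k z *\<^sub>R dunkl_W k x y z) \<le> norm (4 * ?h z)"
        using mult_left_mono[OF abs_dunkl_W_le[OF k, of x y z] dunkl_density_nonneg[OF k', of z]]
          dunkl_density_nonneg[OF k', of z] dunkl_Delta_nonneg[OF k, of "\<bar>x\<bar>" "\<bar>y\<bar>" "\<bar>z\<bar>"]
        by (simp add: abs_mult mult_ac)
    qed
  qed measurable
  then show ?thesis
    by (simp add: integrable_dunkl_measure[OF k'])
qed

lemma dunkl_product_formula:
  assumes k: "k > - 1 / 2" and xy: "x \<noteq> 0" "y \<noteq> 0"
  shows "(\<integral>z. dunkl_exp k (\<xi> * z) * of_real (dunkl_W k x y z) \<partial>dunkl_measure k) =
    dunkl_exp k (\<xi> * x) * dunkl_exp k (\<xi> * y)"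
proof -
  have k': "k \<ge> - 1 / 2" using k by simp
  note [measurable] = borel_measurable_dunkl_exp[OF k']
  let ?s = "\<lambda>t. x\<^sup>2 + y\<^sup>2 + 2 * x * y * t"
  let ?D = "\<lambda>z. dunkl_density k z * dunkl_Delta k \<bar>x\<bar> \<bar>y\<bar> \<bar>z\<bar>"
  define F where "F z = dunkl_exp k (\<xi> * z) * of_real (dunkl_W k x y z)" for z
  have F [measurable]: "F \<in> borel_measurable borel"
    unfolding F_def[abs_def] by measurable
  have intF: "integrable (dunkl_measure k) F"
  proof (rule Bochner_Integration.integrable_bound[OF integrable_dunkl_W[OF k xy]])
    show "AE z in dunkl_measure k. norm (F z) \<le> norm (dunkl_W k x y z)"
      using norm_dunkl_exp_le_1[OF k'] by (intro AE_I2) (simp add: F_def norm_mult mult_left_le_one_le)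
  qed measurable
  then have int: "integrable lborel (\<lambda>z. dunkl_density k z *\<^sub>R F z)"
    by (simp add: integrable_dunkl_measure[OF k'])
  \<comment> \<open>Up to the factor \<open>?D z\<close>, these are the real and the imaginary part
    of the sum over z and - z. Their 2 cancels the 1/2 in
    \<open>dunkl_Delta_integral\<close>.\<close>
  define q1 where "q1 z = 2 * dunkl_even k ((\<xi> * z)\<^sup>2) * (1 - dunkl_sigma x y z)" for z
  define q2 where "q2 z = 2 * (\<xi> * z * dunkl_odd k ((\<xi> * z)\<^sup>2)) * (dunkl_sigma z x y + dunkl_sigma z y x)" for z
  define r1 where "r1 t = 2 * (dunkl_even k ((\<xi> * x)\<^sup>2 + (\<xi> * y)\<^sup>2 + 2 * (\<xi> * x) * (\<xi> * y) * t) * (1 + t))" for t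
  define r2 where "r2 t = 2 * ((\<xi> * x + \<xi> * y) * dunkl_odd k ((\<xi> * x)\<^sup>2 + (\<xi> * y)\<^sup>2 + 2 * (\<xi> * x) * (\<xi> * y) * t) * (1 + t))" for t
  have [measurable]: "dunkl_even k \<in> borel_measurable borel" "dunkl_odd k \<in> borel_measurable borel"
    by (intro borel_measurable_continuous_onI continuous_on_dunkl_parts k')+
  have q [measurable]: "q1 \<in> borel_measurable borel" "q2 \<in> borel_measurable borel"
    unfolding q1_def[abs_def] q2_def[abs_def] dunkl_sigma_def by measurable
  have r: "continuous_on {- 1..1} r1" "continuous_on {- 1..1} r2"
    unfolding r1_def r2_def
    by (intro continuous_intros continuous_on_compose2[OF continuous_on_dunkl_parts(1)[OF k', of UNIV]]
          continuous_on_compose2[OF continuous_on_dunkl_parts(2)[OF k', of UNIV]] subset_UNIV)+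
  have arg: "(\<xi> * sqrt (?s t))\<^sup>2 = (\<xi> * x)\<^sup>2 + (\<xi> * y)\<^sup>2 + 2 * (\<xi> * x) * (\<xi> * y) * t" if "t \<in> {- 1<..<1}" for t
    using dunkl_triangle_sqrt(1)[OF xy that]
    by (simp add: power_mult_distrib) (simp add: algebra_simps power2_eq_square)
  have qr1: "q1 (sqrt (?s t)) = r1 t" if t: "t \<in> {- 1<..<1}" for t
  proof -
    have "1 - dunkl_sigma x y (sqrt (?s t)) = 1 + t"
      using dunkl_triangle_sqrt(1)[OF xy t] xy by (simp add: dunkl_sigma_def field_simps)
    then show ?thesis
      unfolding q1_def r1_def arg[OF t] by simp
  qed
  have qr2: "q2 (sqrt (?s t)) = r2 t" if t: "t \<in> {- 1<..<1}" for t
  proof -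
    define z where "z = sqrt (?s t)"
    have z: "z \<noteq> 0" "z\<^sup>2 = ?s t"
      using dunkl_triangle_sqrt(1)[OF xy t] by (auto simp: z_def)
    \<comment> \<open>The z of the odd part of E cancels the z in the denominators of both
      cosines.\<close>
    have "z * (dunkl_sigma z x y + dunkl_sigma z y x) = (z\<^sup>2 + x\<^sup>2 - y\<^sup>2) / (2 * x) + (z\<^sup>2 + y\<^sup>2 - x\<^sup>2) / (2 * y)"
      using z(1) xy by (simp add: dunkl_sigma_def distrib_left)
    also have "\<dots> = (x + y) * (1 + t)"
      unfolding z(2) using xy by (simp add: field_simps power2_eq_square)
    finally have "z * (dunkl_sigma z x y + dunkl_sigma z y x) = (x + y) * (1 + t)" .
    then have "2 * (\<xi> * z * b) * (dunkl_sigma z x y + dunkl_sigma z y x) = 2 * ((\<xi> * x + \<xi> * y) * b * (1 + t))" for b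
      by (metis (no_types, opaque_lifting) distrib_left mult.assoc mult.commute)
    then show ?thesis
      unfolding q2_def r2_def arg[OF t] z_def[symmetric] by (simp only: arg[OF t, folded z_def])
  qed
  have D1: "integrable lborel (\<lambda>z. indicator {0<..} z *\<^sub>R (?D z * q1 z))"
    "(\<integral>z. indicator {0<..} z *\<^sub>R (?D z * q1 z) \<partial>lborel) = dunkl_product_const k / 2 * jacobi_integral k r1"
    using dunkl_Delta_integral[OF k xy q(1) r(1) qr1] by auto
  have D2: "integrable lborel (\<lambda>z. indicator {0<..} z *\<^sub>R (?D z * q2 z))"
    "(\<integral>z. indicator {0<..} z *\<^sub>R (?D z * q2 z) \<partial>lborel) = dunkl_product_const k / 2 * jacobi_integral k r2"
    using dunkl_Delta_integral[OF k xy q(2) r(2) qr2] by auto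
  \<comment> \<open>As functions of z, \<open>1 - dunkl_sigma x y z\<close> is even and the other
    two cosines are odd. Adding z and - z pairs the former with Re E and the latter with Im
    E.\<close>
  have sum: "dunkl_density k z *\<^sub>R F z + dunkl_density k (- z) *\<^sub>R F (- z) = of_real (?D z * q1 z) + \<i> * of_real (?D z * q2 z)" for z
  proof -
    define P where "P = 1 - dunkl_sigma x y z"
    define T where "T = dunkl_sigma z x y + dunkl_sigma z y x"
    define D where "D = dunkl_Delta k \<bar>x\<bar> \<bar>y\<bar> \<bar>z\<bar>"
    have W: "dunkl_W k x y z = (P + T) * D" "dunkl_W k x y (- z) = (P - T) * D"
      by (simp_all add: dunkl_W_def P_def T_def D_def dunkl_sigma_def)
    have F: "F z = dunkl_exp k (\<xi> * z) * of_real ((P + T) * D)" "F (- z) = cnj (dunkl_exp k (\<xi> * z)) * of_real ((P - T) * D)"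
      unfolding F_def W using dunkl_exp_minus[of k "\<xi> * z"] by simp_all
    show ?thesis
      unfolding F dunkl_density_minus D_def[symmetric] q1_def q2_def P_def[symmetric] T_def[symmetric]
      by (simp add: complex_eq_iff dunkl_exp_def algebra_simps)
  qed
  have "(\<integral>z. F z \<partial>dunkl_measure k) = (\<integral>z. indicator {0<..} z *\<^sub>R (of_real (?D z * q1 z) + \<i> * of_real (?D z * q2 z)) \<partial>lborel)"
    unfolding integral_dunkl_measure[OF k' F] lborel_integral_symmetrize(2)[OF int] sum ..
  also have "\<dots> = (\<integral>z. of_real (indicator {0<..} z *\<^sub>R (?D z * q1 z)) + \<i> * of_real (indicator {0<..} z *\<^sub>R (?D z * q2 z)) \<partial>lborel)"
    by (intro Bochner_Integration.integral_cong refl) (simp add: scaleR_conv_of_real algebra_simps)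
  also have "\<dots> = of_real (dunkl_product_const k / 2 * jacobi_integral k r1) + \<i> * of_real (dunkl_product_const k / 2 * jacobi_integral k r2)"
    unfolding D1(2)[symmetric] D2(2)[symmetric]
    by (subst Bochner_Integration.integral_add) (use D1(1) D2(1) in \<open>auto simp del: real_scaleR_def of_real_mult\<close>)
  also have "\<dots> = dunkl_exp k (\<xi> * x) * dunkl_exp k (\<xi> * y)"
    unfolding dunkl_exp_product_jacobi[OF k] r1_def r2_def jacobi_integral_cmult by (simp add: complex_eq_iff)
  finally show ?thesis unfolding F_def .
qed

lemma dunkl_exp_product_integral_W:
  assumes k: "k \<ge> - 1 / 2"
  shows "integral_dunkl_W k x y (\<lambda>z. dunkl_exp k (\<xi> * z)) = dunkl_exp k (\<xi> * x) * dunkl_exp k (\<xi> * y)"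
  using dunkl_product_formula[of k x y \<xi>] dunkl_exp_add[of k "\<xi> * x" "\<xi> * y"] k
  by (auto simp: integral_dunkl_W_def dunkl_exp_0 distrib_left)

subsection \<open>The transform of the pseudo-differential operator\<close>

lemma schwartz_family_of_schwartz:
  assumes "f \<in> schwartz"
  shows "schwartz_family (\<lambda>_ :: unit. f)"
proof -
  define D where "D n = ((\<lambda>g x. vector_derivative g (at x)) ^^ n) f" for n
  have diff: "D n differentiable at x" and b: "\<exists>C. \<forall>x. \<bar>x\<bar> ^ r * cmod (D n x) \<le> C" for n r x
    using assms unfolding schwartz_def D_def Let_def by blast+
  have "schwartz_family (\<lambda>_ :: unit. D n)" for n
  proof (coinduction arbitrary: n)
    case schwartz_family
    have b': "\<exists>C. \<forall>(i::unit) x. \<bar>x\<bar> ^ r * cmod (D n x) \<le> C" for r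
      using b[of r n] by simp
    have d: "(D n has_vector_derivative D (Suc n) x) (at x)" for x
      using diff[of n x] by (simp add: D_def vector_derivative_works)
    have ex: "\<exists>m. (\<lambda>_ :: unit. D (Suc n)) = (\<lambda>_. D m)" by blast
    show ?case
      by (rule exI[of _ "\<lambda>_. D n"], rule exI[of _ "\<lambda>_. D (Suc n)"])
         (intro conjI disjI1 refl allI; fact)
  qed
  from this[of 0] show ?thesis by (simp add: D_def)
qed

lemma Ck_plane_partial1_power:
  assumes "\<And>n. Ck_plane n g"
  shows "Ck_plane n ((partial1 ^^ l) g)"
proof (induction l arbitrary: n)
  case (Suc l)
  from Suc[of "Suc n"] show ?case by simp
qed (use assms in simp)

lemma Ck_plane_has_vector_derivative_partial1:
  assumes "Ck_plane (Suc n) g"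
  shows "((\<lambda>x. g x \<xi>) has_vector_derivative partial1 g x \<xi>) (at x)"
proof -
  have "(\<lambda>(x, \<xi>). g x \<xi>) differentiable at (x, \<xi>)"
    using assms by simp
  moreover have "(\<lambda>x. (x, \<xi>)) differentiable at x"
    unfolding differentiable_def
    by (rule exI, rule has_derivative_Pair[OF has_derivative_ident has_derivative_const])
  ultimately have "((\<lambda>(x, \<xi>). g x \<xi>) \<circ> (\<lambda>x. (x, \<xi>))) differentiable at x"
    by (intro differentiable_chain_at)
  then show ?thesis
    by (simp add: comp_def partial1_def vector_derivative_works)
qed

text \<open>Division by (1 + y^2)^(m/2), the growth allowed by the symbol estimates, makes the
  bounds in x uniform in y, and y becomes the index of the family.\<close>

lemma schwartz_family_symbol:
  assumes "\<sigma> \<in> symbol_class m"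
  shows "schwartz_family (\<lambda>y x. \<sigma> x y / of_real ((1 + y\<^sup>2) powr (m / 2)))"
proof -
  define w where "w y = (1 + y\<^sup>2) powr (m / 2)" for y :: real
  have w: "w y > 0" for y
    using add_pos_nonneg[of 1 "y\<^sup>2"] by (simp add: w_def)
  define D where "D l y x = (partial1 ^^ l) \<sigma> x y / of_real (w y)" for l y x
  have Ck: "Ck_plane n ((partial1 ^^ l) \<sigma>)" for n l
    using assms unfolding symbol_class_def by (intro Ck_plane_partial1_power) blast
  have "schwartz_family (D l)" for l
  proof (coinduction arbitrary: l)
    case schwartz_family
    have b: "\<exists>C. \<forall>y x. \<bar>x\<bar> ^ r * cmod (D l y x) \<le> C" for r
    proof -
      have "\<forall>l n r. \<exists>C. \<forall>x \<xi>. cmod (of_real ((1 + x\<^sup>2) ^ r) * (partial1 ^^ l) ((partial2 ^^ n) \<sigma>) x \<xi>)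
          \<le> C * (1 + \<bar>\<xi>\<bar>\<^sup>2) powr ((m - real n) / 2)"
        using assms unfolding symbol_class_def by blast
      from this[rule_format, of r l 0] obtain C
        where C: "\<And>x y. cmod (of_real ((1 + x\<^sup>2) ^ r) * (partial1 ^^ l) \<sigma> x y) \<le> C * w y"
        unfolding w_def by auto
      have "\<bar>x\<bar> ^ r * cmod (D l y x) \<le> C" for x y
      proof -
        have "\<bar>x\<bar> \<le> 1 + x\<^sup>2"
          using abs_le_square_iff[of 1 x] by (cases "\<bar>x\<bar> \<le> 1") (auto simp: add_increasing2 power2_eq_square
              intro: order_trans[OF self_le_power[of "\<bar>x\<bar>" 2]])
        then have "\<bar>x\<bar> ^ r * cmod ((partial1 ^^ l) \<sigma> x y) \<le> (1 + x\<^sup>2) ^ r * cmod ((partial1 ^^ l) \<sigma> x y)"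
          by (intro mult_right_mono power_mono) auto
        also have "\<dots> = cmod (of_real ((1 + x\<^sup>2) ^ r) * (partial1 ^^ l) \<sigma> x y)"
          unfolding norm_mult norm_of_real by simp
        also have "\<dots> \<le> C * w y" by (rule C)
        finally show ?thesis
          using w[of y] by (simp add: D_def norm_divide divide_simps)
      qed
      then show ?thesis by blast
    qed
    have d: "(D l y has_vector_derivative D (Suc l) y x) (at x)" for x y
      unfolding D_def[abs_def] funpow.simps comp_def
      by (intro has_vector_derivative_divide Ck_plane_has_vector_derivative_partial1[OF Ck[of 1, unfolded One_nat_def]])
    have ex: "\<exists>m. D (Suc l) = D m" by blast
    show ?case
      by (rule exI[of _ "D l"], rule exI[of _ "D (Suc l)"]) (intro conjI disjI1 refl allI; fact)
  qed
  from this[of 0] show ?thesis by (simp add: D_def[abs_def] w_def)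
qed

lemma one_plus_power_le:
  fixes s :: real
  assumes "s \<ge> 0"
  shows "(1 + s) ^ l \<le> 2 ^ l * (1 + s ^ l)"
proof -
  have "(1 + s) ^ l \<le> (2 * max 1 s) ^ l"
    using assms by (intro power_mono) auto
  also have "\<dots> = 2 ^ l * (max 1 s) ^ l" by (simp add: power_mult_distrib)
  also have "(max 1 s) ^ l \<le> 1 + s ^ l"
    using assms by (cases "s \<le> 1") (auto simp: max_def)
  finally show ?thesis by simp
qed

text \<open>Absorbs a real power into decay seminorms: it is rounded up to N, and (1 + s^2)^N \<le>
  2^N (1 + s^(2N)). This serves both the decay in \<lambda> of the first claim and the growth in y
  of the second.\<close>

lemma one_plus_square_powr_mult_le:
  fixes m s c :: real and C :: "nat \<Rightarrow> real"
  assumes "m \<le> real N" and "\<And>r. \<bar>s\<bar> ^ r * c \<le> C r" and "c \<ge> 0"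
  shows "\<bar>s\<bar> ^ r * ((1 + s\<^sup>2) powr m * c) \<le> 2 ^ N * (C r + C (r + 2 * N))"
proof -
  have ge: "1 + s\<^sup>2 \<ge> 1" by simp
  have even: "\<bar>s\<bar> ^ (2 * N) = (s\<^sup>2) ^ N" by (simp only: power_mult power2_abs)
  have "(1 + s\<^sup>2) powr m \<le> (1 + s\<^sup>2) powr (real N)"
    using assms(1) ge by (rule powr_mono)
  also have "\<dots> = (1 + s\<^sup>2) ^ N"
    by (intro powr_realpow less_le_trans[OF zero_less_one ge])
  also have "\<dots> \<le> 2 ^ N * (1 + (s\<^sup>2) ^ N)"
    by (rule one_plus_power_le) simp
  finally have "\<bar>s\<bar> ^ r * ((1 + s\<^sup>2) powr m * c) \<le> \<bar>s\<bar> ^ r * ((2 ^ N * (1 + (s\<^sup>2) ^ N)) * c)"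
    using assms(3) by (intro mult_left_mono mult_right_mono) auto
  also have "\<dots> = 2 ^ N * (\<bar>s\<bar> ^ r * c + \<bar>s\<bar> ^ (r + 2 * N) * c)"
    unfolding power_add even by (simp add: algebra_simps)
  also have "\<dots> \<le> 2 ^ N * (C r + C (r + 2 * N))"
    by (intro mult_left_mono add_mono assms) auto
  finally show ?thesis .
qed

lemma integrable_pair_dominated:
  fixes f :: "'a \<times> 'b \<Rightarrow> complex" and p :: "'a \<Rightarrow> real" and q :: "'b \<Rightarrow> real"
  assumes "sigma_finite_measure M" "sigma_finite_measure N"
    and f: "f \<in> borel_measurable (M \<Otimes>\<^sub>M N)"
    and p: "integrable M p" and q: "integrable N q"
    and le: "\<And>x y. norm (f (x, y)) \<le> p x * q y"
  shows "integrable (M \<Otimes>\<^sub>M N) f"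
proof -
  interpret M: sigma_finite_measure M by fact
  interpret N: sigma_finite_measure N by fact
  interpret pair_sigma_finite M N ..
  have [measurable]: "p \<in> borel_measurable M" "q \<in> borel_measurable N"
    using p q by auto
  have "integrable (M \<Otimes>\<^sub>M N) (\<lambda>(x, y). p x * q y)"
  proof (rule Fubini_integrable)
    show "integrable M (\<lambda>x. \<integral>y. norm (case (x, y) of (x, y) \<Rightarrow> p x * q y) \<partial>N)"
      using p by (simp add: abs_mult integrable_abs)
    show "AE x in M. integrable N (\<lambda>y. case (x, y) of (x, y) \<Rightarrow> p x * q y)"
      using q by simp
  qed measurable
  then show ?thesis
    by (rule Bochner_Integration.integrable_bound[OF _ f])
       (auto intro!: AE_I2 order_trans[OF le] simp: split_beta)
qed

lemma integral_dunkl_W_cmult: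
  "integral_dunkl_W k x y (\<lambda>z. c * g z) = c * integral_dunkl_W k x y g"
  by (simp add: integral_dunkl_W_def mult.assoc)

text \<open>The transform of a product with \<open>dunkl_exp\<close> is a generalized translate of the transform.\<close>

lemma integral_dunkl_W_transform:
  assumes k: "k \<ge> - 1 / 2" and g: "schwartz_family g"
  shows "integral_dunkl_W k u v (\<lambda>z. \<integral>x. g i x * dunkl_exp k (- z / \<beta> * x) \<partial>dunkl_measure k) =
    (\<integral>x. g i x * (dunkl_exp k (- x / \<beta> * u) * dunkl_exp k (- x / \<beta> * v)) \<partial>dunkl_measure k)"
proof (cases "k = - 1 / 2 \<or> u = 0 \<or> v = 0")
  case True
  have "dunkl_exp k (- (u + v) / \<beta> * x) = dunkl_exp k (- x / \<beta> * u) * dunkl_exp k (- x / \<beta> * v)" for x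
  proof -
    have "dunkl_exp k (- x / \<beta> * (u + v)) = dunkl_exp k (- x / \<beta> * u) * dunkl_exp k (- x / \<beta> * v)"
      using dunkl_exp_product_integral_W[OF k, of u v "- x / \<beta>"] True unfolding integral_dunkl_W_def by simp
    moreover have "- (u + v) / \<beta> * x = - x / \<beta> * (u + v)"
      by (simp add: divide_inverse algebra_simps)
    ultimately show ?thesis by (simp only:)
  qed
  then show ?thesis
    using True unfolding integral_dunkl_W_def by simp
next
  case False
  then have k': "k > - 1 / 2" and uv: "u \<noteq> 0" "v \<noteq> 0" using k by auto
  let ?\<mu> = "dunkl_measure k"
  interpret sigma_finite_measure ?\<mu> by (rule sigma_finite_dunkl_measure)
  interpret pair_sigma_finite ?\<mu> ?\<mu> ..
  note [measurable] = borel_measurable_schwartz_family[OF g, of i] borel_measurable_dunkl_exp[OF k]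
  obtain C where C: "C \<ge> 0" "\<And>i x. cmod (g i x) \<le> C * dunkl_weight k x"
    using schwartz_family_dominated[OF g] by blast
  define f where "f x z = g i x * dunkl_exp k (- z / \<beta> * x) * of_real (dunkl_W k u v z)" for x z
  \<comment> \<open>As E is bounded by 1, the majorant splits into a Schwartz bound in x and |W| in
    z.\<close>
  have int: "integrable (?\<mu> \<Otimes>\<^sub>M ?\<mu>) (case_prod f)"
  proof (rule integrable_pair_dominated)
    show "integrable ?\<mu> (\<lambda>x. C * dunkl_weight k x)"
      by (intro integrable_mult_right integrable_dunkl_weight k)
    show "integrable ?\<mu> (\<lambda>z. \<bar>dunkl_W k u v z\<bar>)"
      by (intro integrable_abs integrable_dunkl_W k' uv)
    show "case_prod f \<in> borel_measurable (?\<mu> \<Otimes>\<^sub>M ?\<mu>)"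
      unfolding f_def by measurable
    fix x z
    have "cmod (g i x) * cmod (dunkl_exp k (- z / \<beta> * x)) \<le> (C * dunkl_weight k x) * 1"
      using C by (intro mult_mono norm_dunkl_exp_le_1 k) (auto intro: dunkl_weight_nonneg mult_nonneg_nonneg)
    then show "norm (case (x, z) of (x, z) \<Rightarrow> f x z) \<le> C * dunkl_weight k x * \<bar>dunkl_W k u v z\<bar>"
      unfolding f_def by (simp add: norm_mult mult_right_mono)
  qed (rule sigma_finite_dunkl_measure)+
  \<comment> \<open>As a function of z, E(- z x / \<beta>) has spectral parameter - x / \<beta>, to
    which the product formula applies.\<close>
  have inner: "(\<integral>z. f x z \<partial>?\<mu>) = g i x * (dunkl_exp k (- x / \<beta> * u) * dunkl_exp k (- x / \<beta> * v))" for x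
  proof -
    have "(\<integral>z. f x z \<partial>?\<mu>) = (\<integral>z. g i x * (dunkl_exp k (- x / \<beta> * z) * of_real (dunkl_W k u v z)) \<partial>?\<mu>)"
      unfolding f_def by (intro Bochner_Integration.integral_cong refl) (simp add: mult_ac)
    then show ?thesis
      using dunkl_product_formula[OF k' uv, of "- x / \<beta>"] by simp
  qed
  have "integral_dunkl_W k u v (\<lambda>z. \<integral>x. g i x * dunkl_exp k (- z / \<beta> * x) \<partial>?\<mu>) =
      (\<integral>z. (\<integral>x. f x z \<partial>?\<mu>) \<partial>?\<mu>)"
    using False unfolding integral_dunkl_W_def f_def by simp
  also have "\<dots> = (\<integral>x. (\<integral>z. f x z \<partial>?\<mu>) \<partial>?\<mu>)"
    by (rule Fubini_integral[OF int])
  finally show ?thesis unfolding inner .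
qed

text \<open>The phase of the kernel is a sum of a term in \<xi> and a term in x, so the transform
  factors into a chirp, the Dunkl transform at - \<xi> / b and a second chirp.\<close>

lemma lc_dunkl_transform_eq:
  assumes "k \<ge> - 1 / 2"
  shows "lc_dunkl_transform k M f \<xi> =
    1 / (\<i> * of_real (M $ 1 $ 2)) powr of_real (k + 1) * exp (\<i> / 2 * of_real (M $ 2 $ 2 / M $ 1 $ 2 * \<xi>\<^sup>2)) *
    (\<integral>x. exp (\<i> / 2 * of_real (M $ 1 $ 1 / M $ 1 $ 2 * x\<^sup>2)) * f x * dunkl_exp k (- \<xi> / M $ 1 $ 2 * x)
      \<partial>dunkl_measure k)"
proof -
  have "f x * lc_dunkl_kernel k M \<xi> x = exp (\<i> / 2 * of_real (M $ 2 $ 2 / M $ 1 $ 2 * \<xi>\<^sup>2)) *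
      (exp (\<i> / 2 * of_real (M $ 1 $ 1 / M $ 1 $ 2 * x\<^sup>2)) * f x * dunkl_exp k (- \<xi> / M $ 1 $ 2 * x))" for x
  proof -
    have "exp (\<i> / 2 * of_real (M $ 2 $ 2 / M $ 1 $ 2 * \<xi>\<^sup>2 + M $ 1 $ 1 / M $ 1 $ 2 * x\<^sup>2)) =
        exp (\<i> / 2 * of_real (M $ 2 $ 2 / M $ 1 $ 2 * \<xi>\<^sup>2)) * exp (\<i> / 2 * of_real (M $ 1 $ 1 / M $ 1 $ 2 * x\<^sup>2))"
      unfolding of_real_add distrib_left by (rule exp_add)
    then show ?thesis
      unfolding lc_dunkl_kernel_def Let_def dunkl_kernel_eq_exp[OF assms] by (simp only: mult_ac)
  qed
  then show ?thesis
    unfolding lc_dunkl_transform_def by (simp only: integral_mult_right_zero mult.assoc)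
qed

theorem proposition3p6:
  fixes k a b c d m :: real
    and M :: "real^2^2"
    and \<sigma> :: "real \<Rightarrow> real \<Rightarrow> complex"
    and f :: "real \<Rightarrow> complex"
  assumes "k \<ge> - 1 / 2"
    and "M = vector [vector [a, b], vector [c, d]]"
    and "det M = 1"
    and "b \<noteq> 0"
    and "\<sigma> \<in> symbol_class m"
    and "f \<in> schwartz"
  shows "(\<forall>l :: nat. \<exists>C > 0. \<forall>y \<xi> :: real.
            cmod (lc_dunkl_transform k M
                    (\<lambda>x. exp (- (\<i> / 2) * of_real (a / b * x\<^sup>2)) * \<sigma> x y) \<xi>)
              \<le> C / \<bar>b\<bar> powr (2 * k + 2) * (1 + y\<^sup>2) powr (m / 2)
                  * (1 + (\<xi> / b)\<^sup>2) powr (- real l))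
       \<and> (\<forall>\<xi> :: real.
            lc_dunkl_transform k M (pseudo_diff_op k M \<sigma> f) \<xi> =
              (\<integral>y. integral_dunkl_W k \<xi> (- y)
                     (\<lambda>z. lc_dunkl_transform k M
                            (\<lambda>x. exp (- (\<i> / 2) * of_real (a / b * x\<^sup>2)) * \<sigma> x y) z
                          * lc_dunkl_transform k M f y
                          * exp (- (\<i> / 2) * of_real (d / b * (z\<^sup>2 - \<xi>\<^sup>2 + y\<^sup>2))))
                 \<partial>dunkl_measure k))"
proof -
  note k = assms(1)
  have entries: "M $ 1 $ 1 = a" "M $ 1 $ 2 = b" "M $ 2 $ 2 = d"
    using assms(2) by simp_all
  let ?\<mu> = "dunkl_measure k"
  define \<kappa> where "\<kappa> = 1 / (\<i> * of_real b) powr of_real (k + 1)"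
  define ch where "ch \<alpha> x = exp (\<i> / 2 * of_real (\<alpha> * x\<^sup>2))" for \<alpha> x :: real
  have ch_add: "ch \<alpha> x * exp (- (\<i> / 2) * of_real (\<alpha> * x\<^sup>2)) = 1" for \<alpha> x
    unfolding ch_def by (simp flip: exp_add)
  have norm_ch: "cmod (ch \<alpha> x) = 1" for \<alpha> x by (simp add: ch_def)
  have transform: "lc_dunkl_transform k M h \<xi> =
      \<kappa> * ch (d / b) \<xi> * (\<integral>x. ch (a / b) x * h x * dunkl_exp k (- \<xi> / b * x) \<partial>?\<mu>)" for h \<xi>
    unfolding lc_dunkl_transform_eq[OF k] entries \<kappa>_def ch_def ..
  define w where "w y = (1 + y\<^sup>2) powr (m / 2)" for y :: real
  have w: "w y > 0" for y
    using add_pos_nonneg[of 1 "y\<^sup>2"] by (simp add: w_def)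
  define g where "g y x = \<sigma> x y / of_real (w y)" for y x
  have g: "schwartz_family g"
    using schwartz_family_symbol[OF assms(5)] by (simp add: g_def[abs_def] w_def)
  have \<sigma>: "\<sigma> x y = of_real (w y) * g y x" for x y
    using w[of y] by (simp add: g_def)
  define S where "S y z = (\<integral>x. g y x * dunkl_exp k (- z / b * x) \<partial>?\<mu>)" for y z
  have transform_\<sigma>: "lc_dunkl_transform k M (\<lambda>x. exp (- (\<i> / 2) * of_real (a / b * x\<^sup>2)) * \<sigma> x y) z =
      \<kappa> * ch (d / b) z * (of_real (w y) * S y z)" for y z
  proof -
    have "ch (a / b) x * (exp (- (\<i> / 2) * of_real (a / b * x\<^sup>2)) * \<sigma> x y) * dunkl_exp k (- z / b * x) =
        of_real (w y) * (g y x * dunkl_exp k (- z / b * x))" for x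
      unfolding mult.assoc[symmetric] ch_add by (simp add: \<sigma> mult_ac)
    then show ?thesis
      unfolding transform S_def by (simp only: integral_mult_right_zero)
  qed

  have "\<exists>C > 0. \<forall>y \<xi> :: real. cmod (lc_dunkl_transform k M (\<lambda>x. exp (- (\<i> / 2) * of_real (a / b * x\<^sup>2)) * \<sigma> x y) \<xi>)
      \<le> C / \<bar>b\<bar> powr (2 * k + 2) * (1 + y\<^sup>2) powr (m / 2) * (1 + (\<xi> / b)\<^sup>2) powr (- real l)" for l
  proof -
    have "\<exists>C. \<forall>y \<xi>. \<bar>\<xi>\<bar> ^ r * cmod (\<integral>x. g y x * dunkl_exp k (\<xi> * x) \<partial>?\<mu>) \<le> C" for r
      by (rule schwartz_family_transform_rapid_decay[OF k g])
    then obtain B where B: "\<And>r y \<xi>. \<bar>\<xi>\<bar> ^ r * cmod (\<integral>x. g y x * dunkl_exp k (\<xi> * x) \<partial>?\<mu>) \<le> B r"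
      by metis
    \<comment> \<open>The constant of \<open>one_plus_square_powr_mult_le\<close> for N = l and r =
      0.\<close>
    define K where "K = 2 ^ l * (B 0 + B (2 * l))"
    have K: "(1 + (\<xi> / b)\<^sup>2) ^ l * cmod (S y \<xi>) \<le> K" for y \<xi>
    proof -
      have eq: "(- \<xi> / b)\<^sup>2 = (\<xi> / b)\<^sup>2" by (simp add: power_divide)
      have "(1 + (- \<xi> / b)\<^sup>2) powr (real l) * cmod (S y \<xi>) \<le> K"
        using one_plus_square_powr_mult_le[of "real l" l "- \<xi> / b" "cmod (S y \<xi>)" B 0] B[of "- \<xi> / b" _ y]
        by (simp add: K_def S_def)
      moreover have "(1 + (\<xi> / b)\<^sup>2) powr (real l) = (1 + (\<xi> / b)\<^sup>2) ^ l"
        by (intro powr_realpow add_pos_nonneg) auto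
      ultimately show ?thesis unfolding eq by simp
    qed
    have K0: "K \<ge> 0" using K[of 0 0] by (rule order_trans[rotated]) simp
    \<comment> \<open>C may depend on b, so its last factor cancels the power of |b| in the claim;
      adding 1 keeps C positive when the product with K is 0.\<close>
    define C where "C = (cmod \<kappa> * K + 1) * \<bar>b\<bar> powr (2 * k + 2)"
    have bp: "\<bar>b\<bar> powr (2 * k + 2) > 0" using assms(4) by simp
    have C: "C > 0" unfolding C_def using K0 bp by (intro mult_pos_pos add_nonneg_pos) auto
    have "cmod (lc_dunkl_transform k M (\<lambda>x. exp (- (\<i> / 2) * of_real (a / b * x\<^sup>2)) * \<sigma> x y) \<xi>)
      \<le> C / \<bar>b\<bar> powr (2 * k + 2) * (1 + y\<^sup>2) powr (m / 2) * (1 + (\<xi> / b)\<^sup>2) powr (- real l)" for y \<xi>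
    proof -
      let ?p = "(1 + (\<xi> / b)\<^sup>2) ^ l"
      have p: "?p > 0" by (intro zero_less_power add_pos_nonneg) auto
      have "cmod \<kappa> * cmod (S y \<xi>) \<le> cmod \<kappa> * (K / ?p)"
        using K[of \<xi> y] p by (intro mult_left_mono) (auto simp: field_simps)
      also have "\<dots> \<le> (cmod \<kappa> * K + 1) / ?p"
        using p by (simp add: divide_simps)
      finally have "w y * (cmod \<kappa> * cmod (S y \<xi>)) \<le> w y * ((cmod \<kappa> * K + 1) / ?p)"
        using w[of y] by (intro mult_left_mono) auto
      moreover have "(1 + (\<xi> / b)\<^sup>2) powr (- real l) = 1 / ?p"
        using add_pos_nonneg[of 1 "(\<xi> / b)\<^sup>2"] by (simp add: powr_minus powr_realpow divide_inverse)
      moreover have "C / \<bar>b\<bar> powr (2 * k + 2) = cmod \<kappa> * K + 1"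
        using bp by (simp add: C_def)
      ultimately show ?thesis
        unfolding transform_\<sigma> w_def[symmetric] using w[of y]
        by (simp add: norm_mult norm_ch mult_ac)
    qed
    with C show ?thesis by blast
  qed
  moreover
  have "lc_dunkl_transform k M (pseudo_diff_op k M \<sigma> f) \<xi> =
      (\<integral>y. integral_dunkl_W k \<xi> (- y)
             (\<lambda>z. lc_dunkl_transform k M (\<lambda>x. exp (- (\<i> / 2) * of_real (a / b * x\<^sup>2)) * \<sigma> x y) z
                  * lc_dunkl_transform k M f y
                  * exp (- (\<i> / 2) * of_real (d / b * (z\<^sup>2 - \<xi>\<^sup>2 + y\<^sup>2)))) \<partial>?\<mu>)" for \<xi>
  proof -
    interpret sigma_finite_measure ?\<mu> by (rule sigma_finite_dunkl_measure)
    interpret pair_sigma_finite ?\<mu> ?\<mu> ..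
    define Df where "Df = lc_dunkl_transform k M f"
    have f: "schwartz_family (\<lambda>_ :: unit. \<lambda>x. ch (a / b) x * f x)"
      unfolding ch_def by (rule schwartz_family_chirp[OF schwartz_family_of_schwartz[OF assms(6)]])
    note [measurable] = borel_measurable_dunkl_exp[OF k] borel_measurable_schwartz_family[OF f]
    have "continuous_on UNIV (\<lambda>(x, y). \<sigma> x y)"
    proof -
      have "Ck_plane 0 \<sigma>" using assms(5) unfolding symbol_class_def by blast
      then show ?thesis by simp
    qed
    then have "(\<lambda>(x, y). \<sigma> x y) \<in> borel_measurable (borel \<Otimes>\<^sub>M borel)"
      unfolding borel_prod by (rule borel_measurable_continuous_onI)
    then have [measurable]: "(\<lambda>(x, y). \<sigma> x y) \<in> borel_measurable (?\<mu> \<Otimes>\<^sub>M ?\<mu>)"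
      by (subst measurable_cong_sets[OF sets_pair_measure_cong refl]) auto
    have [measurable]: "ch \<alpha> \<in> borel_measurable borel" for \<alpha>
      unfolding ch_def[abs_def] by (intro borel_measurable_continuous_onI continuous_intros)
    have Df_meas [measurable]: "Df \<in> borel_measurable borel"
    proof -
      have "(\<lambda>y. \<integral>x. ch (a / b) x * f x * dunkl_exp k (- y / b * x) \<partial>?\<mu>) \<in> borel_measurable borel"
        by (rule sigma_finite_measure.borel_measurable_lebesgue_integral[OF sigma_finite_dunkl_measure]) measurable
      then show ?thesis
        unfolding Df_def transform[abs_def] by measurable
    qed
    have decay: "\<exists>C. \<forall>y. \<bar>y\<bar> ^ r * cmod (Df y) \<le> C" for r
    proof -
      obtain C where C: "\<And>\<xi>. \<bar>\<xi>\<bar> ^ r * cmod (\<integral>x. ch (a / b) x * f x * dunkl_exp k (\<xi> * x) \<partial>?\<mu>) \<le> C"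
        using schwartz_family_transform_rapid_decay[OF k f, of r] by auto
      have "\<bar>y\<bar> ^ r * cmod (Df y) \<le> \<bar>b\<bar> ^ r * cmod \<kappa> * C" for y
      proof -
        let ?I = "cmod (\<integral>x. ch (a / b) x * f x * dunkl_exp k (- y / b * x) \<partial>?\<mu>)"
        have "\<bar>y\<bar> ^ r * cmod (Df y) = \<bar>b\<bar> ^ r * cmod \<kappa> * (\<bar>- y / b\<bar> ^ r * ?I)"
          unfolding Df_def transform norm_mult norm_ch using assms(4)
          by (simp add: power_divide)
        also have "\<dots> \<le> \<bar>b\<bar> ^ r * cmod \<kappa> * C"
          by (intro mult_left_mono C) auto
        finally show ?thesis .
      qed
      then show ?thesis by blast
    qed
    obtain CD where CD: "\<And>r y. \<bar>y\<bar> ^ r * cmod (Df y) \<le> CD r"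
      using decay by metis
    obtain C1 where C1: "C1 \<ge> 0" "\<And>y x. cmod (g y x) \<le> C1 * dunkl_weight k x"
      using schwartz_family_dominated[OF g] by blast
    \<comment> \<open>The transform of f decays faster than any power and so absorbs the growth
      \<open>w y\<close> of the symbol. The index type \<open>unit\<close> makes a single function
      an instance of \<open>rapid_decay_dominated\<close>.\<close>
    have "\<exists>C. \<forall>(i::unit) y. \<bar>y\<bar> ^ r * (w y * cmod (Df y)) \<le> C" for r
    proof -
      have N: "m / 2 \<le> real (nat \<lceil>m / 2\<rceil>)" by linarith
      show ?thesis
        unfolding w_def using one_plus_square_powr_mult_le[OF N, of _ "cmod (Df _)" CD r] CD by fastforce
    qed
    from rapid_decay_dominated[OF this, of k] obtain C2
      where C2: "C2 \<ge> 0" "\<And>y. w y * cmod (Df y) \<le> C2 * dunkl_weight k y" by auto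
    \<comment> \<open>The double integrand after the chirps in x have cancelled. The inverse kernel
      contributes E(x y / b), written with arguments - x / b and - y so that both exponentials share
      the parameter - x / b; this is the origin of the - y in W.\<close>
    define \<Phi> where "\<Phi> x y = \<sigma> x y * (dunkl_exp k (- x / b * \<xi>) * dunkl_exp k (- x / b * (- y))) *
        (Df y * exp (- (\<i> / 2) * of_real (d / b * y\<^sup>2)))" for x y
    have e1: "cmod (exp (- (\<i> / 2) * of_real (d / b * y\<^sup>2))) = 1" for y by simp
    have int: "integrable (?\<mu> \<Otimes>\<^sub>M ?\<mu>) (case_prod \<Phi>)"
    proof (rule integrable_pair_dominated)
      show "integrable ?\<mu> (\<lambda>x. C1 * dunkl_weight k x)" "integrable ?\<mu> (\<lambda>y. C2 * dunkl_weight k y)"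
        by (intro integrable_mult_right integrable_dunkl_weight k)+
      show "case_prod \<Phi> \<in> borel_measurable (?\<mu> \<Otimes>\<^sub>M ?\<mu>)"
        unfolding \<Phi>_def by measurable
      fix x y
      have "cmod (case (x, y) of (x, y) \<Rightarrow> \<Phi> x y) =
          (cmod (g y x) * (w y * cmod (Df y))) * (cmod (dunkl_exp k (- x / b * \<xi>)) * cmod (dunkl_exp k (- x / b * (- y))))"
        unfolding \<Phi>_def prod.case norm_mult e1 \<sigma> using w[of y] by (simp add: mult_ac)
      also have "\<dots> \<le> (cmod (g y x) * (w y * cmod (Df y))) * (1 * 1)"
        using w[of y] by (intro mult_left_mono mult_mono norm_dunkl_exp_le_1 k) auto
      also have "\<dots> \<le> (C1 * dunkl_weight k x) * (C2 * dunkl_weight k y)"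
        unfolding mult_1_right using w[of y]
        by (intro mult_mono C1(2) C2(2) mult_nonneg_nonneg[OF C1(1) dunkl_weight_nonneg]) auto
      finally show "cmod (case (x, y) of (x, y) \<Rightarrow> \<Phi> x y) \<le> C1 * dunkl_weight k x * (C2 * dunkl_weight k y)" .
    qed (rule sigma_finite_dunkl_measure)+
    have inner: "ch (a / b) x * pseudo_diff_op k M \<sigma> f x * dunkl_exp k (- \<xi> / b * x) = (\<integral>y. \<Phi> x y \<partial>?\<mu>)" for x
    proof -
      have "ch (a / b) x * (\<sigma> x y * Df y * lc_dunkl_kernel k (matrix_inv M) x y) * dunkl_exp k (- \<xi> / b * x) = \<Phi> x y" for y
      proof -
        have "exp (- (\<i> / 2) * of_real (a / b * x\<^sup>2 + d / b * y\<^sup>2)) =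
            exp (- (\<i> / 2) * of_real (a / b * x\<^sup>2)) * exp (- (\<i> / 2) * of_real (d / b * y\<^sup>2))"
          unfolding of_real_add distrib_left by (rule exp_add)
        then have "ch (a / b) x * exp (- (\<i> / 2) * of_real (a / b * x\<^sup>2 + d / b * y\<^sup>2)) =
            exp (- (\<i> / 2) * of_real (d / b * y\<^sup>2))"
          using ch_add[of "a / b" x] by (simp only: mult.assoc[symmetric] mult_1_left)
        moreover have "- x / b * (- y) = x / b * y" "- x / b * \<xi> = - \<xi> / b * x" by simp_all
        moreover have "ch (a / b) x * (\<sigma> x y * Df y * lc_dunkl_kernel k (matrix_inv M) x y) * dunkl_exp k (- \<xi> / b * x) =
            \<sigma> x y * (dunkl_exp k (- \<xi> / b * x) * dunkl_exp k (x / b * y)) *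
            (Df y * (ch (a / b) x * exp (- (\<i> / 2) * of_real (a / b * x\<^sup>2 + d / b * y\<^sup>2))))"
          unfolding lc_dunkl_kernel_matrix_inv[OF assms(3)] entries dunkl_kernel_eq_exp[OF k]
          by (simp only: mult_ac)
        ultimately show ?thesis
          unfolding \<Phi>_def by (simp only:)
      qed
      then show ?thesis
        unfolding pseudo_diff_op_def Df_def[symmetric]
        by (simp only: integral_mult_right_zero[symmetric] integral_mult_left_zero[symmetric])
    qed
    have "lc_dunkl_transform k M (pseudo_diff_op k M \<sigma> f) \<xi> = \<kappa> * ch (d / b) \<xi> * (\<integral>x. (\<integral>y. \<Phi> x y \<partial>?\<mu>) \<partial>?\<mu>)"
      unfolding transform inner ..
    also have "(\<integral>x. (\<integral>y. \<Phi> x y \<partial>?\<mu>) \<partial>?\<mu>) = (\<integral>y. (\<integral>x. \<Phi> x y \<partial>?\<mu>) \<partial>?\<mu>)"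
      by (rule Fubini_integral[OF int, symmetric])
    also have "\<kappa> * ch (d / b) \<xi> * \<dots> = (\<integral>y. \<kappa> * ch (d / b) \<xi> * (\<integral>x. \<Phi> x y \<partial>?\<mu>) \<partial>?\<mu>)"
      by simp
    also have "\<dots> = (\<integral>y. integral_dunkl_W k \<xi> (- y)
             (\<lambda>z. lc_dunkl_transform k M (\<lambda>x. exp (- (\<i> / 2) * of_real (a / b * x\<^sup>2)) * \<sigma> x y) z
                  * Df y * exp (- (\<i> / 2) * of_real (d / b * (z\<^sup>2 - \<xi>\<^sup>2 + y\<^sup>2)))) \<partial>?\<mu>)"
    proof (rule Bochner_Integration.integral_cong[OF refl])
      fix y
      define E where "E = exp (- (\<i> / 2) * of_real (d / b * y\<^sup>2))"
      have "(\<integral>x. \<Phi> x y \<partial>?\<mu>) = (\<integral>x. of_real (w y) * (Df y * E) *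
          (g y x * (dunkl_exp k (- x / b * \<xi>) * dunkl_exp k (- x / b * (- y)))) \<partial>?\<mu>)"
        unfolding \<Phi>_def \<sigma> E_def by (intro Bochner_Integration.integral_cong refl) (simp only: mult_ac)
      also have "\<dots> = of_real (w y) * (Df y * E) * integral_dunkl_W k \<xi> (- y) (S y)"
        unfolding S_def integral_dunkl_W_transform[OF k g] by (rule integral_mult_right_zero)
      finally have 1: "\<kappa> * ch (d / b) \<xi> * (\<integral>x. \<Phi> x y \<partial>?\<mu>) =
          integral_dunkl_W k \<xi> (- y) (\<lambda>z. (\<kappa> * ch (d / b) \<xi> * (of_real (w y) * (Df y * E))) * S y z)"
        unfolding integral_dunkl_W_cmult by (simp only: mult.assoc)
      have 2: "lc_dunkl_transform k M (\<lambda>x. exp (- (\<i> / 2) * of_real (a / b * x\<^sup>2)) * \<sigma> x y) z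
          * Df y * exp (- (\<i> / 2) * of_real (d / b * (z\<^sup>2 - \<xi>\<^sup>2 + y\<^sup>2))) =
          (\<kappa> * ch (d / b) \<xi> * (of_real (w y) * (Df y * E))) * S y z" for z
      proof -
        \<comment> \<open>The exponential of the claim removes the chirp in z; its terms in \<xi>
          and y are constant in z. The integrand becomes a multiple of \<open>S y z\<close>, to
          which the translation lemma applies.\<close>
        have "ch (d / b) z * exp (- (\<i> / 2) * of_real (d / b * (z\<^sup>2 - \<xi>\<^sup>2 + y\<^sup>2))) = ch (d / b) \<xi> * E"
          unfolding ch_def E_def exp_add[symmetric] by (simp add: algebra_simps)
        then have "\<kappa> * (of_real (w y) * S y z) * Df y *
            (ch (d / b) z * exp (- (\<i> / 2) * of_real (d / b * (z\<^sup>2 - \<xi>\<^sup>2 + y\<^sup>2)))) =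
            \<kappa> * (of_real (w y) * S y z) * Df y * (ch (d / b) \<xi> * E)"
          by (rule arg_cong)
        then show ?thesis
          unfolding transform_\<sigma> by (simp only: mult_ac)
      qed
      show "\<kappa> * ch (d / b) \<xi> * (\<integral>x. \<Phi> x y \<partial>?\<mu>) = integral_dunkl_W k \<xi> (- y)
             (\<lambda>z. lc_dunkl_transform k M (\<lambda>x. exp (- (\<i> / 2) * of_real (a / b * x\<^sup>2)) * \<sigma> x y) z
                  * Df y * exp (- (\<i> / 2) * of_real (d / b * (z\<^sup>2 - \<xi>\<^sup>2 + y\<^sup>2))))"
        unfolding 1 2 ..
    qed
    finally show ?thesis unfolding Df_def .
  qed
  ultimately show ?thesis by blast
qed

end
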